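(* (Privacy) For any $\varepsilon_n>0$ and $\delta_n\in[0,1]$, the algorithm $\mathcal{A}_{\rm high}$ is $(\varepsilon_n,\delta_n)$-DP. (Accuracy) Further, there exists a constant $c>0$ such that for all constants $\zeta>0$, $C>0$, and $\delta_n\in[0,1]$, there exists an estimator $\mathcal{M}_{\zeta,C}$ such that there exist constants $N\in\mathbb{N}$ and $C'>0$ such that for all exponential families (i.e. any measure $\mu$ on $\mathbb{R}$, with associated family $\{P_\theta\}_{\theta\in\Phi}$) and all $\theta_0\in\Phi$: if - $\Omega\left(\frac{\ln n}{n}\right)\le\varepsilon_n\le O\left(\frac{1}{\sqrt n}\right)$, - $\dfrac{\mathbb{E}_{P_{\theta_0}}(X-A'(\theta_0))^4}{A''(\theta_0)^2}\le\zeta$, and - $\kappa(\theta_0)\ge\dfrac1C\cdot\dfrac{1}{\sqrt{A''(\theta_0)}}$, then for all $n\in\mathbb{N}$ such that $\kappa(\theta_0)\ge J^{-1}_{\mathrm{TV},\theta_0}\left(\frac{1}{\varepsilon_n n}\right)$ and $n\ge\max\left\{N,\frac{c\,\zeta^2\ln(1/\delta_n)}{\varepsilon_n}\right\}$, $$\mathfrak{R}_n(\theta_0,\mathcal{A}_{{\rm high},C,\zeta})\le C'\cdot J^{-1}_{\mathrm{TV},\theta_0}\left(\frac{1}{\varepsilon_n n}\right)=O\left(\frac{1}{n\varepsilon_n\sqrt{A''(\theta_0)}}\right),$$ where $\mathcal{A}_{{\rm high},C,\zeta}$ is $\mathcal{A}_{\rm high}$ with initial mean estimator $\mathcal{M}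_{\zeta,C}$.
   Context: Exponential family: for a measure $\mu$ on $\mathbb{R}$, $A(\theta)=\ln\int e^{\theta x}d\mu(x)$, $\Phi=\{\theta: A(\theta)<\infty\}$, and for $\theta\in\Phi$, $P_\theta$ has density $p_\theta(x)=e^{\theta x-A(\theta)}$ relative to $\mu$. Then $\mathbb{E}_\theta[x]=A'(\theta)$ and $\mathrm{var}_\theta(x)=A''(\theta)$. $\kappa(\theta)=\max\{r : \forall\theta'\in[\theta-r,\theta+r],\ A''(\theta)/A''(\theta')\in[\tfrac12,2]\}$. $J^{-1}_{\mathrm{TV},\theta}(\beta)=\sup\{|h| : \mathrm{TV}(P_\theta,P_{\theta+h})\le\beta\}$, with $\mathrm{TV}$ the total variation distance. A randomized mechanism $M$ is $(\varepsilon,\delta)$-DP if for all datasets $d,d'$ of the same size differing in a single record and all events $E$, $\Pr[M(d)\in E]\le e^\varepsilon\Pr[M(d')\in E]+\delta$. Algorithm $\mathtt{Count}(X,\hat t,\varepsilon)$: for $X=(x_1,\dots,x_n)$ let $f_{t}(X)=\frac1n\sum_{i=1}^n\mathbf{1}_{x_i>t}$ and $g_t(\theta)=\mathbb{E}_\theta[f_t]=\mathbb{P}_{x\sim P_\theta}(x>t)$, which is monotone and invertible in $\theta$; output $\hat\theta=g_{\hat t}^{-1}\big(f_{\hat t}(X)+\mathrm{Lap}(\tfrac{1}{\varepsilon n})\big)$, where $\mathrm{Lap}(s)$ is an independent centered Laplace variable of scale $s$. Algorithm $\mathcal{A}_{\rm high}$ with privacy parameters $(\varepsilon,\delta)$: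 the input is two samples $X_1\sim P_{\theta_0}^n$ and $X_2\sim P_{\theta_0}^n$ and an $(\varepsilon/2,\delta)$-DP mean estimator $\mathcal{M}$ (a randomized map from datasets to $\mathbb{R}$); compute $\hat t=\mathcal{M}(X_1)$ and output $\hat\theta=\mathtt{Count}(X_2,\hat t,\varepsilon/2)$. Here it is run with $\varepsilon=\varepsilon_n$, $\delta=\delta_n$. $\mathfrak{R}_n(\theta_0,\mathcal{A})$ is the (smallest) value such that, when the samples given to $\mathcal{A}$ ($n$ points in each of $X_1,X_2$) are drawn i.i.d. from $P_{\theta_0}$, the output $\hat\theta$ satisfies $|\hat\theta-\theta_0|\le\mathfrak{R}_n(\theta_0,\mathcal{A})$ with probability $0.75$. *)

theory Defs
  imports "HOL-Probability.Probability"
begin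

section \<open>Exponential families\<close>

definition log_partition :: "real measure \<Rightarrow> real \<Rightarrow> real" where
  "log_partition \<mu> \<theta> = ln (\<integral>x. exp (\<theta> * x) \<partial>\<mu>)"

text \<open>
  Since the integrand is positive, integrability says that the integral, and hence the
  log-partition function, is finite. Off this set, \<^const>\<open>log_partition\<close> has no meaning.
\<close>
definition natural_params :: "real measure \<Rightarrow> real set" where
  "natural_params \<mu> = {\<theta>. integrable \<mu> (\<lambda>x. exp (\<theta> * x))}"

definition expfam :: "real measure \<Rightarrow> real \<Rightarrow> real measure" where
  "expfam \<mu> \<theta> = density \<mu> (\<lambda>x. ennreal (exp (\<theta> * x - log_partition \<mu> \<theta>)))"

text \<open>The first and second derivative; these are meaningful in the interior of the parameter set.\<close>

definition dlog_partition :: "real measure \<Rightarrow> real \<Rightarrow> real" where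
  "dlog_partition \<mu> = deriv (log_partition \<mu>)"

definition d2log_partition :: "real measure \<Rightarrow> real \<Rightarrow> real" where
  "d2log_partition \<mu> = deriv (dlog_partition \<mu>)"

text \<open>
  The value is extended real, with a supremum in place of a maximum, because every radius is
  admissible for, e.g., a Gaussian location family. The whole interval has to lie in the
  parameter set, since the second derivative is undefined elsewhere.
\<close>
definition kappa :: "real measure \<Rightarrow> real \<Rightarrow> ereal" where
  "kappa \<mu> \<theta> = Sup {ereal r | r. 0 \<le> r \<and>
     (\<forall>\<theta>'\<in>{\<theta> - r..\<theta> + r}. \<theta>' \<in> natural_params \<mu> \<and>
        d2log_partition \<mu> \<theta> / d2log_partition \<mu> \<theta>' \<in> {1/2..2})}"

definition tv_dist :: "real measure \<Rightarrow> real measure \<Rightarrow> real" where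
  "tv_dist P Q = (SUP E\<in>sets borel. \<bar>measure P E - measure Q E\<bar>)"

definition J_TV_inv :: "real measure \<Rightarrow> real \<Rightarrow> real \<Rightarrow> ereal" where
  "J_TV_inv \<mu> \<theta> \<beta> = Sup {ereal \<bar>h\<bar> | h.
     \<theta> + h \<in> natural_params \<mu> \<and> tv_dist (expfam \<mu> \<theta>) (expfam \<mu> (\<theta> + h)) \<le> \<beta>}"


section \<open>Differential privacy\<close>

text \<open>
  A dataset of size \<open>n\<close> is a function on \<open>{..<n}\<close>, undefined elsewhere. A randomized mechanism
  is a Markov kernel from datasets to the reals.
\<close>

abbreviation datasets :: "nat \<Rightarrow> (nat \<Rightarrow> real) measure" where
  "datasets n \<equiv> (\<Pi>\<^sub>M i\<in>{..<n}. borel)"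

type_synonym mechanism = "(nat \<Rightarrow> real) \<Rightarrow> real measure"

definition neighbours :: "nat \<Rightarrow> (nat \<Rightarrow> real) \<Rightarrow> (nat \<Rightarrow> real) \<Rightarrow> bool" where
  "neighbours n d d' \<longleftrightarrow> d \<in> space (datasets n) \<and> d' \<in> space (datasets n) \<and>
     (\<exists>i<n. \<forall>j<n. j \<noteq> i \<longrightarrow> d j = d' j)"

definition diff_private :: "nat \<Rightarrow> real \<Rightarrow> real \<Rightarrow> mechanism \<Rightarrow> bool" where
  "diff_private n \<epsilon> \<delta> M \<longleftrightarrow>
     M \<in> datasets n \<rightarrow>\<^sub>M prob_algebra borel \<and>
     (\<forall>d d'. neighbours n d d' \<longrightarrow>
        (\<forall>E\<in>sets borel. measure (M d) E \<le> exp \<epsilon> * measure (M d') E + \<delta>))"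


section \<open>The algorithms\<close>

definition laplace :: "real \<Rightarrow> real measure" where
  "laplace s = density lborel (\<lambda>z. ennreal (exp (- \<bar>z\<bar> / s) / (2 * s)))"

definition frac_above :: "nat \<Rightarrow> real \<Rightarrow> (nat \<Rightarrow> real) \<Rightarrow> real" where
  "frac_above n t X = (1 / real n) * (\<Sum>i<n. if X i > t then 1 else 0)"

definition prob_above :: "real measure \<Rightarrow> real \<Rightarrow> real \<Rightarrow> real" where
  "prob_above \<mu> t \<theta> = measure (expfam \<mu> \<theta>) {t<..}"

text \<open>
  The noisy fraction may lie outside the range of \<^term>\<open>prob_above \<mu> t\<close> (e.g. outside \<open>[0,1]\<close>),
  and this function is constant if \<open>t\<close> is not inside the support. In these cases there is no
  inverse, and the output is set to \<open>0\<close> by convention.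
\<close>
definition prob_above_inv :: "real measure \<Rightarrow> real \<Rightarrow> real \<Rightarrow> real" where
  "prob_above_inv \<mu> t p =
     (if inj_on (prob_above \<mu> t) (natural_params \<mu>) \<and> p \<in> prob_above \<mu> t ` natural_params \<mu>
      then the_inv_into (natural_params \<mu>) (prob_above \<mu> t) p else 0)"

definition Count :: "real measure \<Rightarrow> nat \<Rightarrow> (nat \<Rightarrow> real) \<Rightarrow> real \<Rightarrow> real \<Rightarrow> real measure" where
  "Count \<mu> n X t \<epsilon> =
     distr (laplace (1 / (\<epsilon> * real n))) borel (\<lambda>z. prob_above_inv \<mu> t (frac_above n t X + z))"

definition A_high ::
  "real measure \<Rightarrow> nat \<Rightarrow> real \<Rightarrow> mechanism \<Rightarrow> (nat \<Rightarrow> real) \<Rightarrow> (nat \<Rightarrow> real) \<Rightarrow> real measure" where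
  "A_high \<mu> n \<epsilon> M X1 X2 = M X1 \<bind> (\<lambda>t. Count \<mu> n X2 t (\<epsilon> / 2))"

text \<open>
  The two samples of size \<open>n\<close> form one dataset of \<open>2 * n\<close> records, the first sample being the
  first \<open>n\<close> records; neighbouring inputs differ in one record of one of the samples.
\<close>
definition pooled :: "nat \<Rightarrow> ((nat \<Rightarrow> real) \<Rightarrow> (nat \<Rightarrow> real) \<Rightarrow> real measure) \<Rightarrow> mechanism" where
  "pooled n Alg X = Alg (\<lambda>i\<in>{..<n}. X i) (\<lambda>i\<in>{..<n}. X (n + i))"

text \<open>The infimum is attained whenever it is finite.\<close>
definition risk ::
  "nat \<Rightarrow> real measure \<Rightarrow> real \<Rightarrow> ((nat \<Rightarrow> real) \<Rightarrow> (nat \<Rightarrow> real) \<Rightarrow> real measure) \<Rightarrow> ereal" where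
  "risk n \<mu> \<theta>\<^sub>0 Alg = Inf {ereal r | r. 0 \<le> r \<and>
     measure ((\<Pi>\<^sub>M i\<in>{..<2 * n}. expfam \<mu> \<theta>\<^sub>0) \<bind> pooled n Alg)
       {\<theta>. \<bar>\<theta> - \<theta>\<^sub>0\<bar> \<le> r} \<ge> 3/4}"

end

theory Submission
  imports Defs
begin

text \<open>
  Privacy is post-processing of the first sample's mechanism (through the layer-cake formula)
  together with the Laplace mechanism on the second sample; the work there is to see that the
  inverse of the tail probability is jointly measurable.

  The mean estimator must cope with unknown location and scale. The first sample is cut into
  blocks of a size proportional to \<open>\<zeta>\<close>. Each block computes its mean, rounded to a dyadic grid
  whose width is proportional to the block's own standard deviation. By Chebyshev's inequality nearly all
  blocks return one of only four numbers, all close to the true mean, so one of them is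
  frequent. A frequent label is found by sampling \<open>l\<close> with weight \<open>exp (\<eta> * count l) - 1\<close>
  and a default answer with a weight of order \<open>1 / \<delta>\<close>.

  For a threshold \<open>t\<close> within a small multiple of the standard deviation \<open>\<sigma>\<close> of the mean, the
  derivative \<open>Cov(1(x > t), x)\<close> of the tail probability in the parameter is at least of order
  \<open>\<sigma> / sqrt \<zeta>\<close>, and its own derivative is bounded by the variance. The bound \<open>\<kappa>\<close> on
  the variance ratio therefore gives a neighbourhood in which tail probabilities grow linearly, while
  total variation grows at most linearly with slope \<open>2 * \<sigma>\<close>. Both the error of the
  algorithm and the inverse total variation modulus at \<open>1 / (\<epsilon> n)\<close> are then of order
  \<open>1 / (\<epsilon> n \<sigma>)\<close>. Since the accurate thresholds form a fixed set of four numbers,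
  a union bound replaces the independence of the two samples.
\<close>

section \<open>The Laplace distribution and post-processing\<close>

text \<open>With no a priori bound on location or scale there is no sensitivity to which noise could
  be calibrated, so the estimator selects a value instead of perturbing one; rounding makes distinct
  blocks return literally equal values. A label can occur in one dataset and be absent from a
  neighbour, which rules out a purely multiplicative privacy bound: the default output of mass of
  order \<open>1 / \<delta>\<close> makes such a label improbable. A frequent label must in turn
  outweigh the default, which forces \<open>\<epsilon> * k\<close> to dominate
  \<open>ln (1 / \<delta>)\<close> for \<open>k\<close> blocks, and with the block size fixed by
  \<open>\<zeta>\<close> this is the sample size condition. The fourth moment serves twice: it
  concentrates the block variances, and it bounds the mean absolute deviation from below, hence the
  covariance. The lower bound on \<open>\<epsilon>\<close> sends \<open>\<epsilon> * n\<close> to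
  infinity, uniformly over all families because every threshold on it is free of the scale
  \<open>\<sigma>\<close>; the upper bound makes the sampling error \<open>1 / sqrt n\<close> at
  most a constant times the Laplace scale \<open>1 / (\<epsilon> * n)\<close>.\<close>

lemma sets_laplace [simp, measurable_cong]: "sets (laplace s) = sets borel"
  by (simp add: laplace_def)

lemma space_laplace [simp]: "space (laplace s) = UNIV"
  by (simp add: laplace_def)

lemma emeasure_laplace:
  assumes "E \<in> sets borel"
  shows "emeasure (laplace s) E = (\<integral>\<^sup>+z. ennreal (exp (- \<bar>z\<bar> / s) / (2 * s)) * indicator E z \<partial>lborel)"
  unfolding laplace_def using assms by (subst emeasure_density) auto

lemma emeasure_laplace_atLeast:
  assumes "s > 0" "a \<ge> 0"
  shows "emeasure (laplace s) {a..} = ennreal (exp (- a / s) / 2)"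
proof -
  have lim: "((\<lambda>z. - exp (- z / s) / 2) \<longlongrightarrow> 0) at_top"
    using assms by real_asymp
  have "emeasure (laplace s) {a..} = (\<integral>\<^sup>+z. ennreal (exp (- z / s) / (2 * s)) * indicator {a..} z \<partial>lborel)"
    using assms by (subst emeasure_laplace) (auto intro!: nn_integral_cong split: split_indicator)
  also have "\<dots> = ennreal (0 - (- exp (- a / s) / 2))"
    by (rule nn_integral_FTC_atLeast[OF _ _ _ lim])
       (use assms in \<open>auto intro!: derivative_eq_intros simp: field_simps\<close>)
  finally show ?thesis by simp
qed

lemma emeasure_laplace_atMost:
  assumes "s > 0" "a \<ge> 0"
  shows "emeasure (laplace s) {..- a} = ennreal (exp (- a / s) / 2)"
proof -
  have "emeasure (laplace s) {..- a} =
      (\<integral>\<^sup>+z. ennreal (exp (- \<bar>z\<bar> / s) / (2 * s)) * indicator {..- a} z \<partial>lborel)"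
    by (simp add: emeasure_laplace)
  also have "\<dots> = (\<integral>\<^sup>+z. ennreal (exp (- \<bar>z\<bar> / s) / (2 * s)) * indicator {a..} z \<partial>lborel)"
    by (subst nn_integral_real_affine[where c = "-1" and t = 0])
       (auto intro!: nn_integral_cong split: split_indicator)
  also have "\<dots> = emeasure (laplace s) {a..}"
    by (simp add: emeasure_laplace)
  finally show ?thesis using emeasure_laplace_atLeast[OF assms] by simp
qed

lemma prob_space_laplace:
  assumes "s > 0"
  shows "prob_space (laplace s)"
proof
  have z: "emeasure (laplace s) {0} = 0"
    by (subst emeasure_laplace) (auto intro!: nn_integral_0_iff_AE[THEN iffD2] AE_I[of _ _ "{0}"])
  have "emeasure (laplace s) (space (laplace s)) = emeasure (laplace s) ({..0} \<union> ({0..} - {0}))"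
    by (rule arg_cong2[where f=emeasure]) auto
  also have "\<dots> = emeasure (laplace s) {..0} + emeasure (laplace s) ({0..} - {0})"
    by (rule plus_emeasure[symmetric]) auto
  also have "emeasure (laplace s) ({0..} - {0}) = emeasure (laplace s) {0..}"
    using z by (intro emeasure_Diff_null_set) auto
  also have "emeasure (laplace s) {..0} + emeasure (laplace s) {0..} = ennreal (1/2) + ennreal (1/2)"
    using emeasure_laplace_atMost[OF assms, of 0] emeasure_laplace_atLeast[OF assms, of 0] by simp
  also have "\<dots> = 1"
    by (subst ennreal_plus[symmetric]) auto
  finally show "emeasure (laplace s) (space (laplace s)) = 1" .
qed

lemma laplace_in_prob_algebra: "s > 0 \<Longrightarrow> laplace s \<in> space (prob_algebra borel)"
  by (simp add: space_prob_algebra prob_space_laplace)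

lemma laplace_concentration:
  assumes "s > 0" "a \<ge> 0"
  shows "measure (laplace s) {z. \<bar>z\<bar> \<le> a} \<ge> 1 - exp (- a / s)"
proof -
  interpret prob_space "laplace s" by (rule prob_space_laplace) fact
  have "1 = prob ({z. \<bar>z\<bar> \<le> a} \<union> ({a..} \<union> {..- a}))"
  proof -
    have "{z. \<bar>z\<bar> \<le> a} \<union> ({a..} \<union> {..- a}) = space (laplace s)" by auto
    then show ?thesis using prob_space by simp
  qed
  also have "\<dots> \<le> prob {z. \<bar>z\<bar> \<le> a} + prob ({a..} \<union> {..- a})"
    by (intro measure_Un_le) auto
  also have "prob ({a..} \<union> {..- a}) \<le> prob {a..} + prob {..- a}"
    by (intro measure_Un_le) auto
  also have "\<dots> = exp (- a / s)"
    using emeasure_laplace_atMost[OF assms] emeasure_laplace_atLeast[OF assms]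
    by (simp add: measure_def)
  finally show ?thesis by simp
qed

text \<open>The Laplace density changes by a factor of at most
  \<open>exp (\<bar>c\<bar> / s)\<close> under a shift by \<open>c\<close>, by the triangle
  inequality in the exponent. This is what makes adding the noise private.\<close>

lemma laplace_shift:
  assumes "s > 0" and [measurable]: "E \<in> sets borel"
  shows "measure (laplace s) {z. c + z \<in> E} \<le> exp (\<bar>c\<bar> / s) * measure (laplace s) E"
proof -
  interpret prob_space "laplace s" by (rule prob_space_laplace) fact
  have "ennreal (measure (laplace s) {z. c + z \<in> E}) = emeasure (laplace s) {z. c + z \<in> E}"
    by (simp add: emeasure_eq_measure)
  also have "\<dots> = (\<integral>\<^sup>+z. ennreal (exp (- \<bar>z\<bar> / s) / (2 * s)) * indicator E (c + z) \<partial>lborel)"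
    by (subst emeasure_laplace) (auto intro!: nn_integral_cong split: split_indicator)
  also have "\<dots> = (\<integral>\<^sup>+z. ennreal (exp (- \<bar>z - c\<bar> / s) / (2 * s)) * indicator E z \<partial>lborel)"
    by (subst nn_integral_real_affine[where c = 1 and t = "- c"])
       (auto intro!: nn_integral_cong split: split_indicator)
  also have "\<dots> \<le> (\<integral>\<^sup>+z. ennreal (exp (\<bar>c\<bar> / s)) *
      (ennreal (exp (- \<bar>z\<bar> / s) / (2 * s)) * indicator E z) \<partial>lborel)"
  proof (rule nn_integral_mono)
    fix z
    have "- \<bar>z - c\<bar> / s \<le> \<bar>c\<bar> / s + - \<bar>z\<bar> / s"
      using assms by (simp add: divide_simps)
    then have "exp (- \<bar>z - c\<bar> / s) / (2 * s) \<le> exp (\<bar>c\<bar> / s) * (exp (- \<bar>z\<bar> / s) / (2 * s))"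
      using assms by (simp add: exp_add[symmetric] divide_right_mono)
    then show "ennreal (exp (- \<bar>z - c\<bar> / s) / (2 * s)) * indicator E z \<le>
        ennreal (exp (\<bar>c\<bar> / s)) * (ennreal (exp (- \<bar>z\<bar> / s) / (2 * s)) * indicator E z)"
      by (auto split: split_indicator simp: ennreal_mult'[symmetric] intro!: ennreal_leI)
  qed
  also have "\<dots> = ennreal (exp (\<bar>c\<bar> / s)) * emeasure (laplace s) E"
    by (simp add: emeasure_laplace nn_integral_cmult)
  also have "\<dots> = ennreal (exp (\<bar>c\<bar> / s) * measure (laplace s) E)"
    by (simp add: emeasure_eq_measure ennreal_mult')
  finally show ?thesis by (simp add: ennreal_le_iff)
qed

text \<open>Fubini on the region under the graph of \<open>K\<close>. As \<open>K\<close> is at most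
  1, the levels range over a set of length one.\<close>

lemma integral_layer_cake:
  fixes K :: "real \<Rightarrow> real"
  assumes "prob_space N" and sN: "sets N = sets borel" and [measurable]: "K \<in> borel_measurable borel"
    and K: "\<And>t. 0 \<le> K t \<and> K t \<le> 1"
  shows "ennreal (\<integral>t. K t \<partial>N) = (\<integral>\<^sup>+s. ennreal (measure N {t. s < K t}) * indicator {0..1} s \<partial>lborel)"
proof -
  interpret prob_space N by fact
  note [measurable_cong] = sN
  have spN [simp]: "space N = UNIV" using sets_eq_imp_space_eq[OF sN] by simp
  interpret pair_sigma_finite N lborel ..
  have "ennreal (\<integral>t. K t \<partial>N) = (\<integral>\<^sup>+t. ennreal (K t) \<partial>N)"
    using K by (intro nn_integral_eq_integral[symmetric] integrable_const_bound[of _ 1]) auto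
  also have "\<dots> = (\<integral>\<^sup>+t. (\<integral>\<^sup>+s. indicator {(t, s). 0 \<le> s \<and> s \<le> 1 \<and> s < K t} (t, s) \<partial>lborel) \<partial>N)"
  proof (rule nn_integral_cong)
    fix t
    have "(\<integral>\<^sup>+s. indicator {(t, s). 0 \<le> s \<and> s \<le> 1 \<and> s < K t} (t, s) \<partial>lborel) =
        (\<integral>\<^sup>+s. indicator {0..<K t} s \<partial>lborel)"
      using K[of t] by (intro nn_integral_cong) (auto split: split_indicator)
    then show "ennreal (K t) = (\<integral>\<^sup>+s. indicator {(t, s). 0 \<le> s \<and> s \<le> 1 \<and> s < K t} (t, s) \<partial>lborel)"
      using K[of t] by simp
  qed
  also have "\<dots> = (\<integral>\<^sup>+s. (\<integral>\<^sup>+t. indicator {(t, s). 0 \<le> s \<and> s \<le> 1 \<and> s < K t} (t, s) \<partial>N) \<partial>lborel)"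
    by (rule Fubini'[symmetric]) measurable
  also have "\<dots> = (\<integral>\<^sup>+s. ennreal (measure N {t. s < K t}) * indicator {0..1} s \<partial>lborel)"
  proof (rule nn_integral_cong)
    fix s :: real
    have "(\<integral>\<^sup>+t. indicator {(t, s). 0 \<le> s \<and> s \<le> 1 \<and> s < K t} (t, s) \<partial>N) =
        (\<integral>\<^sup>+t. indicator {0..1} s * indicator {t. s < K t} t \<partial>N)"
      by (intro nn_integral_cong) (auto split: split_indicator)
    also have "\<dots> = indicator {0..1} s * emeasure N {t. s < K t}"
      by (subst nn_integral_cmult) auto
    finally show "(\<integral>\<^sup>+t. indicator {(t, s). 0 \<le> s \<and> s \<le> 1 \<and> s < K t} (t, s) \<partial>N) =
        ennreal (measure N {t. s < K t}) * indicator {0..1} s"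
      by (simp add: emeasure_eq_measure mult.commute)
  qed
  finally show ?thesis .
qed

text \<open>Privacy speaks of events; the layers \<open>{t. s < K t}\<close> transfer it to test
  functions with values in [0,1]. The additive term survives as a single \<open>\<delta>\<close>
  because the levels have total length one. Later \<open>K t\<close> is the probability that the
  second stage, run with threshold \<open>t\<close>, lands in the event.\<close>

lemma integral_indistinguishable:
  fixes K :: "real \<Rightarrow> real"
  assumes "prob_space N" "prob_space N'" "sets N = sets borel" "sets N' = sets borel"
    and K [measurable]: "K \<in> borel_measurable borel" "\<And>t. 0 \<le> K t \<and> K t \<le> 1"
    and le: "\<And>E. E \<in> sets borel \<Longrightarrow> measure N E \<le> exp e * measure N' E + \<delta>" and "\<delta> \<ge> 0"
  shows "(\<integral>t. K t \<partial>N) \<le> exp e * (\<integral>t. K t \<partial>N') + \<delta>"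
proof -
  note [measurable_cong] = assms(3,4)
  interpret N: prob_space N by fact
  interpret N': prob_space N' by fact
  \<comment> \<open>Monotonicity in the level yields measurability in the level.\<close>
  have mono: "antimono (\<lambda>s. measure N' {t. s < K t})"
    using assms(4) by (intro antimonoI N'.finite_measure_mono) auto
  have [measurable]: "(\<lambda>s. measure N' {t. s < K t}) \<in> borel_measurable borel"
  proof -
    have "(\<lambda>s. - measure N' {t. s < K t}) \<in> borel_measurable borel"
      using mono by (intro borel_measurable_mono) (auto simp: mono_def antimono_def)
    from borel_measurable_uminus[OF this] show ?thesis by simp
  qed
  have "ennreal (\<integral>t. K t \<partial>N) = (\<integral>\<^sup>+s. ennreal (measure N {t. s < K t}) * indicator {0..1} s \<partial>lborel)"
    using assms by (intro integral_layer_cake) auto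
  also have "\<dots> \<le> (\<integral>\<^sup>+s. ennreal (exp e) * (ennreal (measure N' {t. s < K t}) * indicator {0..1} s)
      + ennreal \<delta> * indicator {0..1} s \<partial>lborel)"
  proof (rule nn_integral_mono)
    fix s :: real
    have "measure N {t. s < K t} \<le> exp e * measure N' {t. s < K t} + \<delta>"
      by (intro le) auto
    then have "ennreal (measure N {t. s < K t}) \<le> ennreal (exp e) * ennreal (measure N' {t. s < K t}) + ennreal \<delta>"
      using \<open>\<delta> \<ge> 0\<close> by (simp add: ennreal_mult'[symmetric] ennreal_plus[symmetric] ennreal_leI del: ennreal_plus)
    then show "ennreal (measure N {t. s < K t}) * indicator {0..1} s \<le>
        ennreal (exp e) * (ennreal (measure N' {t. s < K t}) * indicator {0..1} s) + ennreal \<delta> * indicator {0..1} s"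
      by (auto split: split_indicator)
  qed
  also have "\<dots> = ennreal (exp e) * (\<integral>\<^sup>+s. ennreal (measure N' {t. s < K t}) * indicator {0..1} s \<partial>lborel) + ennreal \<delta>"
    by (subst nn_integral_add) (auto simp: nn_integral_cmult)
  also have "(\<integral>\<^sup>+s. ennreal (measure N' {t. s < K t}) * indicator {0..1} s \<partial>lborel) = ennreal (\<integral>t. K t \<partial>N')"
    using assms by (intro integral_layer_cake[symmetric]) auto
  also have "ennreal (exp e) * ennreal (\<integral>t. K t \<partial>N') + ennreal \<delta> = ennreal (exp e * (\<integral>t. K t \<partial>N') + \<delta>)"
    using K \<open>\<delta> \<ge> 0\<close> by (subst ennreal_plus) (auto simp: ennreal_mult' intro!: integral_nonneg)
  finally show ?thesis
    using K \<open>\<delta> \<ge> 0\<close> by (subst (asm) ennreal_le_iff) (auto intro!: add_nonneg_nonneg integral_nonneg)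
qed

section \<open>Exponential families and the tail probabilities of their members\<close>

text \<open>Left unnormalized so that differentiation in \<open>\<theta>\<close> merely raises
  \<open>k\<close> by one; for \<open>k = 0\<close> it is the mass that the tilted measure gives to
  \<open>E\<close>.\<close>

definition moment_on :: "real measure \<Rightarrow> real set \<Rightarrow> nat \<Rightarrow> real \<Rightarrow> real" where
  "moment_on \<mu> E k \<theta> = (\<integral>x. indicator E x * (x ^ k * exp (\<theta> * x)) \<partial>\<mu>)"

lemma exp_mult_le_ends:
  fixes a b \<theta> x :: real
  assumes "a \<le> \<theta>" "\<theta> \<le> b"
  shows "exp (\<theta> * x) \<le> exp (a * x) + exp (b * x)"
proof (cases "x \<ge> 0")
  case True
  then have "exp (\<theta> * x) \<le> exp (b * x)" using assms by (simp add: mult_right_mono)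
  then show ?thesis using exp_gt_zero[of "a * x"] by linarith
next
  case False
  then have "exp (\<theta> * x) \<le> exp (a * x)" using assms by (simp add: mult_right_mono_neg)
  then show ?thesis using exp_gt_zero[of "b * x"] by linarith
qed

context
  fixes \<mu> :: "real measure"
  assumes sets_mu [measurable_cong]: "sets \<mu> = sets borel"
begin

lemma natural_params_interval:
  assumes "a \<in> natural_params \<mu>" "b \<in> natural_params \<mu>" "a \<le> \<theta>" "\<theta> \<le> b"
  shows "\<theta> \<in> natural_params \<mu>"
proof -
  have "integrable \<mu> (\<lambda>x. exp (a * x) + exp (b * x))"
    using assms by (auto simp: natural_params_def)
  then have "integrable \<mu> (\<lambda>x. exp (\<theta> * x))"
  proof (rule Bochner_Integration.integrable_bound)
    have "exp (\<theta> * x) \<le> exp (a * x) + exp (b * x)" for x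
      by (rule exp_mult_le_ends[OF assms(3,4)])
    then show "AE x in \<mu>. norm (exp (\<theta> * x)) \<le> norm (exp (a * x) + exp (b * x))" by simp
  qed measurable
  then show ?thesis by (simp add: natural_params_def)
qed

lemma integrable_moment0:
  assumes "\<theta> \<in> natural_params \<mu>" and [measurable]: "E \<in> sets borel"
  shows "integrable \<mu> (\<lambda>x. indicator E x * exp (\<theta> * x))"
  by (rule Bochner_Integration.integrable_bound[of \<mu> "\<lambda>x. exp (\<theta> * x)"])
     (use assms(1) in \<open>auto simp: natural_params_def split: split_indicator\<close>)

lemma moment0_nonneg: "moment_on \<mu> E 0 \<theta> \<ge> 0"
  unfolding moment_on_def by (intro Bochner_Integration.integral_nonneg) auto

lemma moment0_eq: "moment_on \<mu> E 0 \<theta> = (\<integral>x. indicator E x * exp (\<theta> * x) \<partial>\<mu>)"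
  by (simp add: moment_on_def)

lemma moment0_mono:
  assumes "\<theta> \<in> natural_params \<mu>" "E \<in> sets borel" "E' \<in> sets borel" "E \<subseteq> E'"
  shows "moment_on \<mu> E 0 \<theta> \<le> moment_on \<mu> E' 0 \<theta>"
  unfolding moment0_eq
  by (intro integral_mono integrable_moment0 assms) (use assms in \<open>auto split: split_indicator\<close>)

text \<open>The weight \<open>exp (\<theta> * x)\<close> is positive, so nullity is a property of
  \<open>\<mu>\<close> alone and passes from one parameter to another.\<close>

lemma moment0_zero_iff:
  assumes "\<theta> \<in> natural_params \<mu>" and [measurable]: "E \<in> sets borel"
  shows "moment_on \<mu> E 0 \<theta> = 0 \<longleftrightarrow> (AE x in \<mu>. x \<notin> E)"
proof -
  have "moment_on \<mu> E 0 \<theta> = 0 \<longleftrightarrow> (AE x in \<mu>. indicator E x * exp (\<theta> * x) = (0::real))"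
    unfolding moment0_eq
    by (rule integral_nonneg_eq_0_iff_AE[OF integrable_moment0[OF assms]]) auto
  also have "\<dots> \<longleftrightarrow> (AE x in \<mu>. x \<notin> E)" by (simp add: indicator_def)
  finally show ?thesis .
qed

text \<open>The value 1 comes from \<open>ln 0 = 0\<close>, as for a null \<open>\<mu>\<close>. The
  quotient formula for probabilities survives this case: both sides are 0, since
  \<open>0 / 0 = 0\<close>.\<close>

lemma exp_log_partition:
  "exp (log_partition \<mu> \<theta>) = (if moment_on \<mu> UNIV 0 \<theta> = 0 then 1 else moment_on \<mu> UNIV 0 \<theta>)"
  using moment0_nonneg[of UNIV \<theta>] by (auto simp: log_partition_def moment0_eq less_le)

lemma sets_expfam [simp, measurable_cong]: "sets (expfam \<mu> \<theta>) = sets borel"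
  by (simp add: expfam_def sets_mu)

lemma space_expfam [simp]: "space (expfam \<mu> \<theta>) = UNIV"
  using sets_eq_imp_space_eq[OF sets_expfam] by simp

lemma emeasure_expfam:
  assumes "\<theta> \<in> natural_params \<mu>" and [measurable]: "E \<in> sets borel"
  shows "emeasure (expfam \<mu> \<theta>) E = ennreal (moment_on \<mu> E 0 \<theta> / moment_on \<mu> UNIV 0 \<theta>)"
proof -
  have "emeasure (expfam \<mu> \<theta>) E =
      (\<integral>\<^sup>+x. ennreal (exp (\<theta> * x - log_partition \<mu> \<theta>)) * indicator E x \<partial>\<mu>)"
    unfolding expfam_def by (subst emeasure_density) (auto simp: sets_mu)
  also have "\<dots> = (\<integral>\<^sup>+x. ennreal (indicator E x * exp (\<theta> * x) / exp (log_partition \<mu> \<theta>)) \<partial>\<mu>)"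
    by (intro nn_integral_cong) (auto simp: exp_diff split: split_indicator)
  also have "\<dots> = ennreal (\<integral>x. indicator E x * exp (\<theta> * x) / exp (log_partition \<mu> \<theta>) \<partial>\<mu>)"
    using integrable_moment0[OF assms] by (intro nn_integral_eq_integral integrable_divide) auto
  also have "(\<integral>x. indicator E x * exp (\<theta> * x) / exp (log_partition \<mu> \<theta>) \<partial>\<mu>) =
      moment_on \<mu> E 0 \<theta> / exp (log_partition \<mu> \<theta>)"
    by (simp add: moment0_eq)
  also have "\<dots> = moment_on \<mu> E 0 \<theta> / moment_on \<mu> UNIV 0 \<theta>"
    using moment0_mono[of \<theta> E UNIV] moment0_nonneg[of E \<theta>] assms by (auto simp: exp_log_partition)
  finally show ?thesis .
qed

lemma measure_expfam:
  assumes "\<theta> \<in> natural_params \<mu>" "E \<in> sets borel"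
  shows "measure (expfam \<mu> \<theta>) E = moment_on \<mu> E 0 \<theta> / moment_on \<mu> UNIV 0 \<theta>"
  using emeasure_expfam[OF assms] moment0_nonneg[of E \<theta>] moment0_nonneg[of UNIV \<theta>]
  by (simp add: measure_def)

lemma prob_above_eq:
  "\<theta> \<in> natural_params \<mu> \<Longrightarrow> prob_above \<mu> t \<theta> = moment_on \<mu> {t<..} 0 \<theta> / moment_on \<mu> UNIV 0 \<theta>"
  unfolding prob_above_def by (rule measure_expfam) auto

lemma moment0_split:
  assumes "\<theta> \<in> natural_params \<mu>"
  shows "moment_on \<mu> UNIV 0 \<theta> = moment_on \<mu> {..t} 0 \<theta> + moment_on \<mu> {t<..} 0 \<theta>"
proof -
  have "moment_on \<mu> UNIV 0 \<theta> =
      (\<integral>x. indicator {..t} x * exp (\<theta> * x) + indicator {t<..} x * exp (\<theta> * x) \<partial>\<mu>)"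
    unfolding moment0_eq by (intro Bochner_Integration.integral_cong) (auto split: split_indicator)
  also have "\<dots> = moment_on \<mu> {..t} 0 \<theta> + moment_on \<mu> {t<..} 0 \<theta>"
    unfolding moment0_eq
    by (rule Bochner_Integration.integral_add) (rule integrable_moment0[OF assms], simp)+
  finally show ?thesis .
qed

section \<open>Monotonicity and continuity of the tail probability in the parameter\<close>

lemma moment0_tilt_above:
  assumes "a \<in> natural_params \<mu>" "b \<in> natural_params \<mu>" "a \<le> b"
  shows "exp ((b - a) * t) * moment_on \<mu> {t<..} 0 a \<le> moment_on \<mu> {t<..} 0 b"
proof -
  have "exp ((b - a) * t) * moment_on \<mu> {t<..} 0 a =
      (\<integral>x. exp ((b - a) * t) * (indicator {t<..} x * exp (a * x)) \<partial>\<mu>)"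
    by (simp add: moment0_eq)
  also have "\<dots> \<le> (\<integral>x. indicator {t<..} x * exp (b * x) \<partial>\<mu>)"
  proof (intro integral_mono integrable_mult_right)
    fix x
    have "(b - a) * t + a * x \<le> b * x" if "x > t"
      using mult_left_mono[of t x "b - a"] that assms(3) by (simp add: algebra_simps)
    then show "exp ((b - a) * t) * (indicator {t<..} x * exp (a * x)) \<le> indicator {t<..} x * exp (b * x)"
      by (auto simp: exp_add[symmetric] split: split_indicator)
  qed (rule integrable_moment0, use assms in simp_all)+
  finally show ?thesis by (simp add: moment0_eq)
qed

text \<open>Equal integrals would force the nonnegative difference of the integrands to vanish
  almost everywhere; it is strictly positive beyond \<open>t\<close>, so the tail would be
  null.\<close>

lemma moment0_tilt_above_strict:
  assumes "a \<in> natural_params \<mu>" "b \<in> natural_params \<mu>" "a < b" "moment_on \<mu> {t<..} 0 a > 0"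
  shows "exp ((b - a) * t) * moment_on \<mu> {t<..} 0 a < moment_on \<mu> {t<..} 0 b"
proof -
  let ?f = "\<lambda>x. indicator {t<..} x * exp (b * x) - exp ((b - a) * t) * (indicator {t<..} x * exp (a * x))"
  have i: "integrable \<mu> (\<lambda>x. indicator {t<..} x * exp (a * x))" "integrable \<mu> (\<lambda>x. indicator {t<..} x * exp (b * x))"
    by (rule integrable_moment0[OF assms(1)], simp) (rule integrable_moment0[OF assms(2)], simp)
  have eq: "moment_on \<mu> {t<..} 0 b - exp ((b - a) * t) * moment_on \<mu> {t<..} 0 a = (\<integral>x. ?f x \<partial>\<mu>)"
    unfolding moment0_eq
    by (subst Bochner_Integration.integral_diff[OF i(2) integrable_mult_right[OF i(1)]]) simp
  have lt: "exp ((b - a) * t) * exp (a * x) < exp (b * x)" if "x > t" for x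
    using mult_strict_left_mono[of t x "b - a"] that assms(3) by (simp add: exp_add[symmetric] algebra_simps)
  have "(\<integral>x. ?f x \<partial>\<mu>) \<noteq> 0"
  proof
    assume "(\<integral>x. ?f x \<partial>\<mu>) = 0"
    then have "AE x in \<mu>. ?f x = 0"
      by (subst (asm) integral_nonneg_eq_0_iff_AE[OF Bochner_Integration.integrable_diff[OF i(2) integrable_mult_right[OF i(1)]]])
        (auto split: split_indicator intro!: AE_I2 less_imp_le lt)
    then have "AE x in \<mu>. x \<notin> {t<..}"
    proof eventually_elim
      case (elim x)
      then show ?case using lt[of x] by (cases "x > t") auto
    qed
    then show False using moment0_zero_iff[of a "{t<..}"] assms by auto
  qed
  with moment0_tilt_above[of a b t] eq assms show ?thesis by auto
qed

lemma moment0_tilt_below: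
  assumes "a \<in> natural_params \<mu>" "b \<in> natural_params \<mu>" "a \<le> b"
  shows "moment_on \<mu> {..t} 0 b \<le> exp ((b - a) * t) * moment_on \<mu> {..t} 0 a"
proof -
  have "moment_on \<mu> {..t} 0 b \<le> (\<integral>x. exp ((b - a) * t) * (indicator {..t} x * exp (a * x)) \<partial>\<mu>)"
    unfolding moment0_eq
  proof (intro integral_mono integrable_mult_right)
    fix x
    have "b * x \<le> (b - a) * t + a * x" if "x \<le> t"
      using mult_left_mono[of x t "b - a"] that assms(3) by (simp add: algebra_simps)
    then show "indicator {..t} x * exp (b * x) \<le> exp ((b - a) * t) * (indicator {..t} x * exp (a * x))"
      by (auto simp: exp_add[symmetric] split: split_indicator)
  qed (rule integrable_moment0, use assms in simp_all)+
  then show ?thesis by (simp add: moment0_eq)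
qed

text \<open>Monotone likelihood ratio: tilting from \<open>a\<close> to \<open>b\<close> multiplies
  the mass above \<open>t\<close> by at least \<open>exp ((b - a) * t)\<close> and the mass below by
  at most this factor, so the odds of exceeding \<open>t\<close> increase. A null measure is treated
  apart because the total masses are denominators.\<close>

lemma prob_above_mono:
  assumes "a \<in> natural_params \<mu>" "b \<in> natural_params \<mu>" "a \<le> b"
  shows "prob_above \<mu> t a \<le> prob_above \<mu> t b"
proof (cases "AE x in \<mu>. x \<notin> (UNIV :: real set)")
  case True
  then show ?thesis
    using assms moment0_zero_iff[of _ UNIV] by (simp add: prob_above_eq)
next
  case False
  define P Q where "P = moment_on \<mu> {t<..} 0" and "Q = moment_on \<mu> {..t} 0"
  have pos: "P a + Q a > 0" "P b + Q b > 0"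
    using False assms moment0_zero_iff[of a UNIV] moment0_zero_iff[of b UNIV] moment0_split[of a t]
      moment0_split[of b t] moment0_nonneg[of UNIV a] moment0_nonneg[of UNIV b]
    unfolding P_def Q_def by auto
  have nn: "P a \<ge> 0" "Q a \<ge> 0" by (simp_all add: P_def Q_def moment0_nonneg)
  have "P a * Q b \<le> P a * (exp ((b - a) * t) * Q a)"
    using moment0_tilt_below[OF assms, of t] nn unfolding Q_def by (intro mult_left_mono)
  also have "\<dots> = (exp ((b - a) * t) * P a) * Q a" by simp
  also have "\<dots> \<le> P b * Q a"
    using moment0_tilt_above[OF assms, of t] nn unfolding P_def by (intro mult_right_mono)
  finally have "P a / (P a + Q a) \<le> P b / (P b + Q b)"
    using pos by (simp add: divide_simps algebra_simps)
  then show ?thesis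
    using assms by (simp add: prob_above_eq moment0_split[of _ t] P_def Q_def add.commute)
qed

lemma prob_above_strict_mono:
  assumes "a \<in> natural_params \<mu>" "b \<in> natural_params \<mu>" "a < b"
    and above: "moment_on \<mu> {t<..} 0 a > 0" and below: "moment_on \<mu> {..t} 0 a > 0"
  shows "prob_above \<mu> t a < prob_above \<mu> t b"
proof -
  define P Q where "P = moment_on \<mu> {t<..} 0" and "Q = moment_on \<mu> {..t} 0"
  have "P b > 0"
    using moment0_tilt_above_strict[OF assms(1-3) above] above unfolding P_def
    by (meson exp_gt_zero less_trans mult_pos_pos)
  then have pos: "P a + Q a > 0" "P b + Q b > 0"
    using above below moment0_nonneg[of "{..t}" b] by (auto simp: P_def Q_def add_pos_nonneg)
  have "P a * Q b \<le> P a * (exp ((b - a) * t) * Q a)"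
    using moment0_tilt_below[of a b t] assms unfolding Q_def P_def by (intro mult_left_mono) auto
  also have "\<dots> = (exp ((b - a) * t) * P a) * Q a" by simp
  also have "\<dots> < P b * Q a"
    using moment0_tilt_above_strict[OF assms(1-3) above] below unfolding P_def Q_def by simp
  finally have "P a / (P a + Q a) < P b / (P b + Q b)"
    using pos by (simp add: divide_simps algebra_simps)
  then show ?thesis
    using assms by (simp add: prob_above_eq moment0_split[of _ t] P_def Q_def add.commute)
qed

text \<open>The two endpoint exponentials dominate all parameters between them, so continuity
  includes those boundary points that belong to the natural parameter set, where differentiability
  may fail.\<close>

lemma moment0_continuous_on:
  assumes "a \<in> natural_params \<mu>" "b \<in> natural_params \<mu>" and [measurable]: "E \<in> sets borel"
  shows "continuous_on {a..b} (moment_on \<mu> E 0)"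
  unfolding continuous_on_sequentially comp_def
proof (intro ballI allI impI)
  fix \<theta> u assume \<theta>: "\<theta> \<in> {a..b}" and u: "(\<forall>n. u n \<in> {a..b}) \<and> u \<longlonglongrightarrow> \<theta>"
  show "(\<lambda>n. moment_on \<mu> E 0 (u n)) \<longlonglongrightarrow> moment_on \<mu> E 0 \<theta>"
    unfolding moment0_eq
  proof (rule integral_dominated_convergence[where w = "\<lambda>x. exp (a * x) + exp (b * x)"])
    show "integrable \<mu> (\<lambda>x. exp (a * x) + exp (b * x))"
      using assms by (auto simp: natural_params_def)
    show "AE x in \<mu>. (\<lambda>n. indicator E x * exp (u n * x)) \<longlonglongrightarrow> indicator E x * exp (\<theta> * x)"
      using u by (intro AE_I2 tendsto_intros) auto
    fix n
    have "exp (u n * x) \<le> exp (a * x) + exp (b * x)" for x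
      using u by (intro exp_mult_le_ends) auto
    then show "AE x in \<mu>. norm (indicator E x * exp (u n * x)) \<le> exp (a * x) + exp (b * x)"
      by (auto split: split_indicator)
  qed measurable
qed

lemma prob_above_continuous_on:
  assumes "a \<in> natural_params \<mu>" "b \<in> natural_params \<mu>"
  shows "continuous_on {a..b} (prob_above \<mu> t)"
proof -
  have nat: "\<theta> \<in> natural_params \<mu>" if "\<theta> \<in> {a..b}" for \<theta>
    using natural_params_interval[OF assms] that by auto
  have "continuous_on {a..b} (\<lambda>\<theta>. moment_on \<mu> {t<..} 0 \<theta> / moment_on \<mu> UNIV 0 \<theta>)"
  proof (cases "AE x in \<mu>. x \<notin> (UNIV :: real set)")
    case True
    then have "moment_on \<mu> {t<..} 0 \<theta> / moment_on \<mu> UNIV 0 \<theta> = 0" if "\<theta> \<in> {a..b}" for \<theta>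
      using nat[OF that] moment0_zero_iff[of \<theta> UNIV] by simp
    then show ?thesis by (subst continuous_on_cong[OF refl, where g = "\<lambda>_. 0"]) auto
  next
    case False
    then show ?thesis
      using nat moment0_zero_iff[of _ UNIV] moment0_continuous_on[OF assms]
      by (intro continuous_on_divide) auto
  qed
  then show ?thesis using nat by (subst continuous_on_cong[OF refl prob_above_eq]) auto
qed

text \<open>Trades an image of an uncountable parameter set for a countable condition, with a view
  to measurability. By monotonicity and the intermediate value theorem, the image of an interval
  \<open>S\<close> is the union of the ranges between bracketing values, and a set \<open>D\<close>
  that is cofinal in both directions supplies enough brackets.\<close>

lemma prob_above_image_iff:
  assumes S: "S \<subseteq> natural_params \<mu>" "\<And>a b x. a \<in> S \<Longrightarrow> b \<in> S \<Longrightarrow> a \<le> x \<Longrightarrow> x \<le> b \<Longrightarrow> x \<in> S"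
    and D: "D \<subseteq> S" "\<And>s. s \<in> S \<Longrightarrow> \<exists>a\<in>D. \<exists>b\<in>D. a \<le> s \<and> s \<le> b"
  shows "p \<in> prob_above \<mu> t ` S \<longleftrightarrow> (\<exists>a\<in>D. \<exists>b\<in>D. prob_above \<mu> t a \<le> p \<and> p \<le> prob_above \<mu> t b)"
proof
  assume "p \<in> prob_above \<mu> t ` S"
  then obtain s where s: "s \<in> S" "p = prob_above \<mu> t s" by auto
  obtain a b where ab: "a \<in> D" "b \<in> D" "a \<le> s" "s \<le> b" using D(2)[OF s(1)] by auto
  have "a \<in> natural_params \<mu>" "b \<in> natural_params \<mu>" "s \<in> natural_params \<mu>"
    using ab(1,2) s(1) D(1) S(1) by auto
  with ab show "\<exists>a\<in>D. \<exists>b\<in>D. prob_above \<mu> t a \<le> p \<and> p \<le> prob_above \<mu> t b"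
    using s(2) by (intro bexI[of _ a] bexI[of _ b]) (auto intro: prob_above_mono)
next
  assume "\<exists>a\<in>D. \<exists>b\<in>D. prob_above \<mu> t a \<le> p \<and> p \<le> prob_above \<mu> t b"
  then obtain a b where ab: "a \<in> S" "b \<in> S" "prob_above \<mu> t a \<le> p" "p \<le> prob_above \<mu> t b"
    using D(1) by auto
  show "p \<in> prob_above \<mu> t ` S"
  proof (cases "a \<le> b")
    case True
    have "continuous_on {a..b} (prob_above \<mu> t)"
      by (rule prob_above_continuous_on) (use ab S(1) in auto)
    then obtain x where "a \<le> x" "x \<le> b" "prob_above \<mu> t x = p"
      using IVT'[of "prob_above \<mu> t" a p b] ab(3,4) True by auto
    then show ?thesis using S(2)[OF ab(1,2)] by auto
  next
    \<comment> \<open>Brackets in reversed order squeeze \<open>p\<close> to their common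
      value.\<close>
    case False
    then have "prob_above \<mu> t b \<le> prob_above \<mu> t a" using S(1) ab(1,2) by (intro prob_above_mono) auto
    then have "p = prob_above \<mu> t a" using ab by linarith
    then show ?thesis using ab by blast
  qed
qed

end

text \<open>\<open>S\<close> may or may not contain its endpoints: a maximum is used alone if there
  is one, and otherwise the rationals below points of \<open>S\<close> index an upper
  sequence.\<close>

lemma countable_brackets:
  fixes S :: "real set"
  obtains D where "countable D" "D \<subseteq> S" "\<And>s. s \<in> S \<Longrightarrow> \<exists>a\<in>D. \<exists>b\<in>D. a \<le> s \<and> s \<le> b"
proof (cases "S = {}")
  case True
  then show ?thesis using that[of "{}"] by auto
next
  case False
  have "\<exists>f :: nat \<Rightarrow> real. range f \<subseteq> S \<and> (\<forall>s\<in>S. \<exists>n. s \<le> f n)" if ne: "S \<noteq> {}" for S :: "real set"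
  proof (cases "\<exists>m\<in>S. \<forall>x\<in>S. x \<le> m")
    case True
    then obtain m where "m \<in> S" "\<forall>x\<in>S. x \<le> m" by auto
    then show ?thesis by (intro exI[of _ "\<lambda>_. m"]) auto
  next
    case False
    obtain s0 where s0: "s0 \<in> S" using ne by auto
    obtain q :: "nat \<Rightarrow> rat" where q: "surj q" using surj_nat_to_rat_surj by blast
    \<comment> \<open>For each rational an element of \<open>S\<close> above it, if there is any;
      the default \<open>s0\<close> keeps the range inside \<open>S\<close>.\<close>
    define f where "f n = (if \<exists>s\<in>S. of_rat (q n) \<le> s then SOME s. s \<in> S \<and> of_rat (q n) \<le> s else s0)" for n
    have f: "f n \<in> S" for n
      unfolding f_def using s0 by (auto intro: someI2_ex)
    have "\<exists>n. s \<le> f n" if "s \<in> S" for s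
    proof -
      from False that obtain x where x: "x \<in> S" "s < x" by force
      then obtain r where r: "s < of_rat r" "of_rat r < x" using of_rat_dense by blast
      obtain n where n: "r = q n" using surjD[OF q, of r] by auto
      have "\<exists>s. s \<in> S \<and> of_rat (q n) \<le> s" using x r n by (auto intro: less_imp_le)
      then have "of_rat (q n) \<le> f n" unfolding f_def by (auto intro: someI2_ex)
      then show ?thesis using r n by (intro exI[of _ n]) auto
    qed
    with f show ?thesis by (intro exI[of _ f]) auto
  qed
  note ex = this
  obtain f :: "nat \<Rightarrow> real" where f: "range f \<subseteq> S" "\<forall>s\<in>S. \<exists>n. s \<le> f n"
    using ex[OF False] by auto
  \<comment> \<open>Lower brackets are upper brackets of the reflected set.\<close>
  obtain g :: "nat \<Rightarrow> real" where g: "range g \<subseteq> uminus ` S" "\<forall>s\<in>uminus ` S. \<exists>n. s \<le> g n"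
    using ex[of "uminus ` S"] False by auto
  show ?thesis
  proof (rule that[of "range f \<union> range (\<lambda>n. - g n)"])
    have "- g n \<in> S" for n
      using subsetD[OF g(1) rangeI[of g n]] by auto
    then show "range f \<union> range (\<lambda>n. - g n) \<subseteq> S" using f by auto
    fix s assume "s \<in> S"
    then obtain n where "s \<le> f n" using f by auto
    moreover obtain m where "- s \<le> g m" using g(2) \<open>s \<in> S\<close> by auto
    ultimately show "\<exists>a\<in>range f \<union> range (\<lambda>n. - g n). \<exists>b\<in>range f \<union> range (\<lambda>n. - g n). a \<le> s \<and> s \<le> b"
      by (intro bexI[of _ "- g m"] bexI[of _ "f n"]) auto
  qed auto
qed

section \<open>Privacy of the algorithm\<close>

lemma pred_Bex_countable:
  assumes "countable D" "\<And>a. a \<in> D \<Longrightarrow> Measurable.pred M (P a)"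
  shows "Measurable.pred M (\<lambda>w. \<exists>a\<in>D. P a w)"
proof -
  have "{w \<in> space M. \<exists>a\<in>D. P a w} = (\<Union>a\<in>D. {w \<in> space M. P a w})" by auto
  also have "\<dots> \<in> sets M" using assms by (intro sets.countable_UN') (auto simp: pred_def)
  finally show ?thesis by (simp add: pred_def)
qed

lemma measure_bind_kernel:
  assumes N: "N \<in> space (prob_algebra S)" and k: "K \<in> S \<rightarrow>\<^sub>M prob_algebra L" and E: "E \<in> sets L"
  shows "measure (N \<bind> K) E = (\<integral>x. measure (K x) E \<partial>N)"
    and "integrable N (\<lambda>x. measure (K x) E)"
proof -
  interpret N: prob_space N using N by (simp add: space_prob_algebra)
  have sN [measurable_cong]: "sets N = sets S" using N by (simp add: space_prob_algebra)
  have m [measurable]: "(\<lambda>x. measure (K x) E) \<in> borel_measurable S"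
    using measurable_compose[OF k measurable_measure_prob_algebra] E by simp
  have p: "prob_space (K x)" if "x \<in> space N" for x
    using measurable_space[OF k, of x] that by (simp add: space_prob_algebra sets_eq_imp_space_eq[OF sN])
  show int: "integrable N (\<lambda>x. measure (K x) E)"
    using p by (intro N.integrable_const_bound[of _ 1]) (auto simp: prob_space.prob_le_1)
  have "emeasure (N \<bind> K) E = (\<integral>\<^sup>+x. emeasure (K x) E \<partial>N)"
    by (rule emeasure_bind_prob_algebra[OF N k E])
  also have "\<dots> = (\<integral>\<^sup>+x. ennreal (measure (K x) E) \<partial>N)"
    using p by (intro nn_integral_cong) (simp add: finite_measure.emeasure_eq_measure prob_space.finite_measure)
  also have "\<dots> = ennreal (\<integral>x. measure (K x) E \<partial>N)"
    using int by (intro nn_integral_eq_integral) auto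
  finally show "measure (N \<bind> K) E = (\<integral>x. measure (K x) E \<partial>N)"
    by (simp add: measure_def Bochner_Integration.integral_nonneg)
qed

context
  fixes \<mu> :: "real measure"
  assumes sets_mu [measurable_cong]: "sets \<mu> = sets borel"
begin

text \<open>Finite only, not a probability measure: \<open>\<mu>\<close> may be null, and the
  privacy claim covers every Borel measure.\<close>

lemma finite_measure_expfam: "\<theta> \<in> natural_params \<mu> \<Longrightarrow> finite_measure (expfam \<mu> \<theta>)"
  by (rule finite_measureI) (simp add: emeasure_expfam[OF sets_mu] space_expfam[OF sets_mu])

lemma prob_above_measurable:
  assumes "\<theta> \<in> natural_params \<mu>"
  shows "(\<lambda>t. prob_above \<mu> t \<theta>) \<in> borel_measurable borel"
proof -
  interpret finite_measure "expfam \<mu> \<theta>" using assms by (rule finite_measure_expfam)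
  have "mono (\<lambda>t. - prob_above \<mu> t \<theta>)"
    unfolding prob_above_def by (auto intro!: monoI finite_measure_mono simp: sets_expfam[OF sets_mu])
  then have "(\<lambda>t. - prob_above \<mu> t \<theta>) \<in> borel_measurable borel"
    by (rule borel_measurable_mono)
  from borel_measurable_uminus[OF this] show ?thesis by simp
qed

text \<open>Quantifying over rational parameters only makes the set of such \<open>t\<close> a countable intersection.\<close>
lemma prob_above_inj_iff:
  "inj_on (prob_above \<mu> t) (natural_params \<mu>) \<longleftrightarrow>
    (\<forall>p q :: rat. of_rat p \<in> natural_params \<mu> \<and> of_rat q \<in> natural_params \<mu> \<and> p < q \<longrightarrow>
      prob_above \<mu> t (of_rat p) < prob_above \<mu> t (of_rat q))"
  (is "?L \<longleftrightarrow> ?R")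
proof
  assume L: ?L
  show ?R
  proof (intro allI impI)
    fix p q :: rat
    assume pq: "of_rat p \<in> natural_params \<mu> \<and> of_rat q \<in> natural_params \<mu> \<and> p < q"
    then have "prob_above \<mu> t (of_rat p) \<le> prob_above \<mu> t (of_rat q)"
      by (intro prob_above_mono[OF sets_mu]) (auto simp: of_rat_less_eq)
    moreover have "prob_above \<mu> t (of_rat p) \<noteq> prob_above \<mu> t (of_rat q)"
      using inj_onD[OF L, of "of_rat p" "of_rat q"] pq by auto
    ultimately show "prob_above \<mu> t (of_rat p) < prob_above \<mu> t (of_rat q)" by linarith
  qed
next
  assume R: ?R
  have lt: "prob_above \<mu> t a < prob_above \<mu> t b"
    if ab: "a \<in> natural_params \<mu>" "b \<in> natural_params \<mu>" "a < b" for a b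
  proof -
    \<comment> \<open>Two rationals inside the interval: strictness is known between rationals only,
      and weak monotonicity bridges the outer parts.\<close>
    obtain p where p: "a < of_rat p" "of_rat p < b" using of_rat_dense[OF ab(3)] by auto
    obtain q where q: "of_rat p < (of_rat q :: real)" "of_rat q < b" using of_rat_dense[OF p(2)] by auto
    have nat: "of_rat p \<in> natural_params \<mu>" "of_rat q \<in> natural_params \<mu>"
      by (rule natural_params_interval[OF sets_mu ab(1,2)]; use p q in linarith)+
    have "prob_above \<mu> t a \<le> prob_above \<mu> t (of_rat p)"
      using ab p nat by (intro prob_above_mono[OF sets_mu]) auto
    also have "\<dots> < prob_above \<mu> t (of_rat q)" using R nat q by (simp add: of_rat_less)
    also have "\<dots> \<le> prob_above \<mu> t b"
      using ab q nat by (intro prob_above_mono[OF sets_mu]) auto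
    finally show ?thesis .
  qed
  show ?L
  proof (rule inj_onI)
    fix x y assume *: "x \<in> natural_params \<mu>" "y \<in> natural_params \<mu>" "prob_above \<mu> t x = prob_above \<mu> t y"
    then show "x = y" using lt[of x y] lt[of y x] by (cases x y rule: linorder_cases) auto
  qed
qed

text \<open>Joint in threshold and value, because the threshold is itself random. Where the tail
  probability is injective, an inverse of at most \<open>y\<close> means that the value is attained
  at a parameter at most \<open>y\<close>, which is again membership in the image of an interval;
  elsewhere the convention 0 decides.\<close>

lemma prob_above_inv_measurable:
  "(\<lambda>(t, p). prob_above_inv \<mu> t p) \<in> borel_measurable (borel \<Otimes>\<^sub>M borel)"
proof -
  let ?\<Phi> = "natural_params \<mu>" and ?g = "prob_above \<mu>"
  let ?T = "\<lambda>w. inj_on (?g (fst w)) ?\<Phi>"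
  note [measurable] = prob_above_measurable
  have T [measurable]: "Measurable.pred (borel \<Otimes>\<^sub>M borel) ?T"
    unfolding prob_above_inj_iff
  proof (intro pred_intros_countable)
    fix p q :: rat
    show "Measurable.pred (borel \<Otimes>\<^sub>M borel) (\<lambda>w. of_rat p \<in> ?\<Phi> \<and> of_rat q \<in> ?\<Phi> \<and> p < q \<longrightarrow>
      ?g (fst w) (of_rat p) < ?g (fst w) (of_rat q))"
    proof (cases "of_rat p \<in> ?\<Phi> \<and> of_rat q \<in> ?\<Phi> \<and> p < q")
      case True
      then have [measurable]: "(\<lambda>t. ?g t (of_rat p)) \<in> borel_measurable borel"
        "(\<lambda>t. ?g t (of_rat q)) \<in> borel_measurable borel"
        by (auto intro: prob_above_measurable)
      show ?thesis using True by simp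
    qed simp
  qed
  have image: "Measurable.pred (borel \<Otimes>\<^sub>M borel) (\<lambda>w. snd w \<in> ?g (fst w) ` S)"
    if S: "S \<subseteq> ?\<Phi>" "\<And>a b x. a \<in> S \<Longrightarrow> b \<in> S \<Longrightarrow> a \<le> x \<Longrightarrow> x \<le> b \<Longrightarrow> x \<in> S" for S
  proof -
    obtain D where D: "countable D" "D \<subseteq> S" "\<And>s. s \<in> S \<Longrightarrow> \<exists>a\<in>D. \<exists>b\<in>D. a \<le> s \<and> s \<le> b"
      using countable_brackets[of S] by metis
    have "(\<lambda>w. snd w \<in> ?g (fst w) ` S) = (\<lambda>w. \<exists>a\<in>D. \<exists>b\<in>D. ?g (fst w) a \<le> snd w \<and> snd w \<le> ?g (fst w) b)"
      by (rule ext, rule prob_above_image_iff[OF sets_mu S D(2,3)])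
    also have "Measurable.pred (borel \<Otimes>\<^sub>M borel) \<dots>"
    proof (intro pred_Bex_countable D(1))
      fix a b assume "a \<in> D" "b \<in> D"
      then have [measurable]: "(\<lambda>t. ?g t a) \<in> borel_measurable borel" "(\<lambda>t. ?g t b) \<in> borel_measurable borel"
        using D S by (auto intro: prob_above_measurable)
      show "Measurable.pred (borel \<Otimes>\<^sub>M borel) (\<lambda>w. ?g (fst w) a \<le> snd w \<and> snd w \<le> ?g (fst w) b)"
        by measurable
    qed
    finally show ?thesis .
  qed
  show ?thesis
  proof (rule borel_measurableI_le)
    fix y
    let ?S = "?\<Phi> \<inter> {..y}"
    have [measurable]: "Measurable.pred (borel \<Otimes>\<^sub>M borel) (\<lambda>w. snd w \<in> ?g (fst w) ` ?S)"
      "Measurable.pred (borel \<Otimes>\<^sub>M borel) (\<lambda>w. snd w \<in> ?g (fst w) ` ?\<Phi>)"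
      by (rule image; auto intro: natural_params_interval[OF sets_mu])+
    have eq: "(case w of (t, p) \<Rightarrow> prob_above_inv \<mu> t p) \<le> y \<longleftrightarrow>
        (?T w \<and> snd w \<in> ?g (fst w) ` ?S) \<or> (0 \<le> y \<and> \<not> (?T w \<and> snd w \<in> ?g (fst w) ` ?\<Phi>))" for w
    proof (cases "?T w \<and> snd w \<in> ?g (fst w) ` ?\<Phi>")
      case True
      then obtain \<theta> where \<theta>: "\<theta> \<in> ?\<Phi>" "snd w = ?g (fst w) \<theta>" by auto
      have "snd w \<in> ?g (fst w) ` ?S \<longleftrightarrow> \<theta> \<le> y"
        using True \<theta> by (auto dest: inj_onD)
      moreover have "the_inv_into ?\<Phi> (?g (fst w)) (snd w) = \<theta>"
        using True \<theta> by (simp add: the_inv_into_f_f)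
      ultimately show ?thesis using True by (simp add: prob_above_inv_def split_beta)
    next
      case False
      then show ?thesis by (auto simp: prob_above_inv_def split_beta)
    qed
    show "{w \<in> space (borel \<Otimes>\<^sub>M borel). (case w of (t, p) \<Rightarrow> prob_above_inv \<mu> t p) \<le> y} \<in> sets (borel \<Otimes>\<^sub>M borel)"
      unfolding eq by measurable
  qed
qed

section \<open>The counting step as a private Markov kernel\<close>

lemma frac_above_measurable [measurable]:
  "(\<lambda>w. frac_above n (snd w) (fst w)) \<in> borel_measurable (datasets n \<Otimes>\<^sub>M borel)"
proof -
  have "(\<lambda>w. if fst w i > snd w then 1 else 0 :: real) \<in> borel_measurable (datasets n \<Otimes>\<^sub>M borel)"
    if "i < n" for i
  proof -
    have [measurable]: "(\<lambda>w. fst w i) \<in> borel_measurable (datasets n \<Otimes>\<^sub>M borel)"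
      using that by (intro measurable_compose[OF measurable_fst] measurable_component_singleton) auto
    show ?thesis by measurable
  qed
  then show ?thesis
    unfolding frac_above_def by (intro borel_measurable_times borel_measurable_const borel_measurable_sum) auto
qed

lemma Count_measurable:
  assumes "\<epsilon> > 0" "n \<ge> 1"
  shows "(\<lambda>w. Count \<mu> n (fst w) (snd w) \<epsilon>) \<in> datasets n \<Otimes>\<^sub>M borel \<rightarrow>\<^sub>M prob_algebra borel"
proof -
  have s: "1 / (\<epsilon> * real n) > 0" using assms by simp
  note [measurable] = prob_above_inv_measurable
  have "(\<lambda>(w, z). prob_above_inv \<mu> (snd w) (frac_above n (snd w) (fst w) + z)) \<in>
      (datasets n \<Otimes>\<^sub>M borel) \<Otimes>\<^sub>M borel \<rightarrow>\<^sub>M borel"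
  proof -
    have "(\<lambda>v. (\<lambda>(t, p). prob_above_inv \<mu> t p) (snd (fst v), frac_above n (snd (fst v)) (fst (fst v)) + snd v)) \<in>
      (datasets n \<Otimes>\<^sub>M borel) \<Otimes>\<^sub>M borel \<rightarrow>\<^sub>M borel"
      by (rule measurable_compose[OF _ prob_above_inv_measurable])
         (intro measurable_Pair borel_measurable_add measurable_compose[OF measurable_fst frac_above_measurable]; measurable)
    then show ?thesis by (simp add: split_beta)
  qed
  then show ?thesis
    unfolding Count_def using laplace_in_prob_algebra[OF s]
    by (intro measurable_distr_prob_space2[where M = borel]) auto
qed

lemma measure_Count:
  assumes "\<epsilon> > 0" "n \<ge> 1" "E \<in> sets borel"
  shows "measure (Count \<mu> n X t \<epsilon>) E =
    measure (laplace (1 / (\<epsilon> * real n))) {z. frac_above n t X + z \<in> prob_above_inv \<mu> t -` E}"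
    and "prob_above_inv \<mu> t -` E \<in> sets borel"
proof -
  note [measurable] = prob_above_inv_measurable
  have m [measurable]: "prob_above_inv \<mu> t \<in> borel_measurable borel"
    using measurable_compose[OF _ prob_above_inv_measurable, of "\<lambda>p. (t, p)" borel] by simp
  show "measure (Count \<mu> n X t \<epsilon>) E =
    measure (laplace (1 / (\<epsilon> * real n))) {z. frac_above n t X + z \<in> prob_above_inv \<mu> t -` E}"
    unfolding Count_def using assms(3)
    by (subst measure_distr) (auto simp: vimage_def)
  show "prob_above_inv \<mu> t -` E \<in> sets borel"
    using measurable_sets[OF m assms(3)] by simp
qed

lemma frac_above_neighbours:
  assumes "i < n" "\<And>j. j < n \<Longrightarrow> j \<noteq> i \<Longrightarrow> X j = X' j"
  shows "\<bar>frac_above n t X - frac_above n t X'\<bar> \<le> 1 / real n"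
proof -
  define I where "I X i = (if X i > t then 1 else 0 :: real)" for X :: "nat \<Rightarrow> real" and i
  have "(\<Sum>j<n. I X j) = I X i + (\<Sum>j\<in>{..<n} - {i}. I X j)" for X
    using assms(1) by (subst sum.remove[of _ i]) auto
  moreover have "(\<Sum>j\<in>{..<n} - {i}. I X j) = (\<Sum>j\<in>{..<n} - {i}. I X' j)"
    using assms(2) by (intro sum.cong) (auto simp: I_def)
  ultimately have "\<bar>(\<Sum>j<n. I X j) - (\<Sum>j<n. I X' j)\<bar> \<le> 1"
    by (simp add: I_def)
  then have "\<bar>(\<Sum>j<n. I X j) - (\<Sum>j<n. I X' j)\<bar> / real n \<le> 1 / real n"
    by (intro divide_right_mono) auto
  then show ?thesis
    by (simp add: frac_above_def I_def[symmetric] right_diff_distrib[symmetric] abs_mult diff_divide_distrib[symmetric] abs_divide)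
qed

text \<open>For a fixed threshold the output is a fixed function of the noisy fraction. One record
  moves the fraction by at most \<open>1 / n\<close>, which is \<open>\<epsilon>\<close> times the
  noise scale.\<close>

lemma Count_private:
  assumes "\<epsilon> > 0" "n \<ge> 1" "E \<in> sets borel" "i < n" "\<And>j. j < n \<Longrightarrow> j \<noteq> i \<Longrightarrow> X j = X' j"
  shows "measure (Count \<mu> n X t \<epsilon>) E \<le> exp \<epsilon> * measure (Count \<mu> n X' t \<epsilon>) E"
proof -
  define s where "s = 1 / (\<epsilon> * real n)"
  have s: "s > 0" using assms by (simp add: s_def)
  define f f' where "f = frac_above n t X" and "f' = frac_above n t X'"
  let ?E = "prob_above_inv \<mu> t -` E"
  have [measurable]: "?E \<in> sets borel" by (rule measure_Count(2)[OF assms(1-3)])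
  have "measure (Count \<mu> n X t \<epsilon>) E = measure (laplace s) {z. (f - f') + z \<in> {y. f' + y \<in> ?E}}"
    unfolding measure_Count(1)[OF assms(1-3)] s_def f_def f'_def by simp
  also have "\<dots> \<le> exp (\<bar>f - f'\<bar> / s) * measure (laplace s) {y. f' + y \<in> ?E}"
    by (intro laplace_shift s) measurable
  also have "\<dots> \<le> exp \<epsilon> * measure (laplace s) {y. f' + y \<in> ?E}"
  proof (intro mult_right_mono measure_nonneg)
    have "\<bar>f - f'\<bar> \<le> 1 / real n"
      unfolding f_def f'_def using assms by (intro frac_above_neighbours) auto
    then show "exp (\<bar>f - f'\<bar> / s) \<le> exp \<epsilon>"
      using assms by (simp add: s_def field_simps)
  qed
  also have "measure (laplace s) {y. f' + y \<in> ?E} = measure (Count \<mu> n X' t \<epsilon>) E"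
    unfolding measure_Count(1)[OF assms(1-3)] s_def f'_def by simp
  finally show ?thesis .
qed

lemma restrict_half_measurable:
  "(\<lambda>X. (\<lambda>i\<in>{..<n}. X i)) \<in> datasets (2 * n) \<rightarrow>\<^sub>M datasets n"
  "(\<lambda>X. (\<lambda>i\<in>{..<n}. X (n + i))) \<in> datasets (2 * n) \<rightarrow>\<^sub>M datasets n"
  by (intro measurable_restrict measurable_component_singleton; simp)+

lemma A_high_kernel:
  assumes "\<epsilon> > 0" "n \<ge> 1" and M: "M \<in> datasets n \<rightarrow>\<^sub>M prob_algebra borel"
  shows "pooled n (A_high \<mu> n \<epsilon> M) \<in> datasets (2 * n) \<rightarrow>\<^sub>M prob_algebra borel"
proof -
  have "(\<lambda>X. M (\<lambda>i\<in>{..<n}. X i) \<bind> (\<lambda>t. Count \<mu> n (\<lambda>i\<in>{..<n}. X (n + i)) t (\<epsilon> / 2)))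
     \<in> datasets (2 * n) \<rightarrow>\<^sub>M prob_algebra borel"
  proof (rule measurable_bind_prob_space2[where N = borel])
    show "(\<lambda>X. M (\<lambda>i\<in>{..<n}. X i)) \<in> datasets (2 * n) \<rightarrow>\<^sub>M prob_algebra borel"
      by (rule measurable_compose[OF restrict_half_measurable(1) M])
    have "(\<lambda>v. Count \<mu> n (fst ((\<lambda>i\<in>{..<n}. fst v (n + i)), snd v)) (snd ((\<lambda>i\<in>{..<n}. fst v (n + i)), snd v)) (\<epsilon> / 2))
        \<in> datasets (2 * n) \<Otimes>\<^sub>M borel \<rightarrow>\<^sub>M prob_algebra borel"
      using assms(1,2)
      by (intro measurable_compose[OF _ Count_measurable] measurable_Pair
            measurable_compose[OF measurable_fst restrict_half_measurable(2)] measurable_snd) auto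
    then show "(\<lambda>(X, t). Count \<mu> n (\<lambda>i\<in>{..<n}. X (n + i)) t (\<epsilon> / 2))
        \<in> datasets (2 * n) \<Otimes>\<^sub>M borel \<rightarrow>\<^sub>M prob_algebra borel"
      by (simp add: split_beta)
  qed
  then show ?thesis unfolding pooled_def[abs_def] A_high_def .
qed

lemma Count_kernel:
  assumes "\<epsilon> > 0" "n \<ge> 1" "X \<in> space (datasets n)"
  shows "(\<lambda>t. Count \<mu> n X t \<epsilon>) \<in> borel \<rightarrow>\<^sub>M prob_algebra borel"
  using measurable_compose[OF _ Count_measurable[OF assms(1,2)], of "\<lambda>t. (X, t)" borel] assms(3) by simp

text \<open>A changed record lies in one sample only. In the first it changes the law of the
  threshold, with the second stage as a common test function; in the second it changes the second
  stage, with the law of the threshold fixed. Either case costs \<open>\<epsilon> / 2\<close>, which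
  is then weakened to \<open>\<epsilon>\<close>.\<close>

lemma A_high_private:
  assumes \<epsilon>: "\<epsilon> > 0" and n: "n \<ge> 1" and \<delta>: "\<delta> \<ge> 0" and M: "diff_private n (\<epsilon> / 2) \<delta> M"
  shows "diff_private (2 * n) \<epsilon> \<delta> (pooled n (A_high \<mu> n \<epsilon> M))"
  unfolding diff_private_def
proof (intro conjI allI impI ballI)
  have k: "M \<in> datasets n \<rightarrow>\<^sub>M prob_algebra borel" using M by (simp add: diff_private_def)
  show "pooled n (A_high \<mu> n \<epsilon> M) \<in> datasets (2 * n) \<rightarrow>\<^sub>M prob_algebra borel"
    by (rule A_high_kernel[OF \<epsilon> n k])
  fix d d' and E :: "real set" assume nb: "neighbours (2 * n) d d'" and E [measurable]: "E \<in> sets borel"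
  define X1 where "X1 d = (\<lambda>i\<in>{..<n}. d i)" for d :: "nat \<Rightarrow> real"
  define X2 where "X2 d = (\<lambda>i\<in>{..<n}. d (n + i))" for d :: "nat \<Rightarrow> real"
  have sp: "X1 d \<in> space (datasets n)" "X2 d \<in> space (datasets n)" for d
    by (auto simp: X1_def X2_def space_PiM)
  define K where "K d t = measure (Count \<mu> n (X2 d) t (\<epsilon> / 2)) E" for d t
  have pM: "prob_space (M (X1 d))" "sets (M (X1 d)) = sets borel" for d
    using measurable_space[OF k sp(1)] by (auto simp: space_prob_algebra)
  have A: "measure (pooled n (A_high \<mu> n \<epsilon> M) d) E = (\<integral>t. K d t \<partial>M (X1 d))" for d
    unfolding pooled_def A_high_def K_def X2_def[symmetric] unfolding X1_def[symmetric]
    using \<epsilon> n sp measurable_space[OF k sp(1)] E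
    by (intro measure_bind_kernel(1)[where S = borel and L = borel] Count_kernel) auto
  have Km [measurable]: "K d \<in> borel_measurable borel" for d
    unfolding K_def using measurable_compose[OF Count_kernel measurable_measure_prob_algebra, of "\<epsilon>/2" n "X2 d" E] sp \<epsilon> n
    by simp
  have K01: "0 \<le> K d t \<and> K d t \<le> 1" for d t
  proof -
    have "prob_space (Count \<mu> n (X2 d) t (\<epsilon> / 2))"
      using measurable_space[OF Count_kernel[of "\<epsilon>/2" n "X2 d"], of t] \<epsilon> n sp by (simp add: space_prob_algebra)
    then show ?thesis by (auto simp: K_def prob_space.prob_le_1)
  qed
  have int: "integrable (M (X1 d)) (K d')" for d d'
  proof -
    interpret prob_space "M (X1 d)" by (rule pM)
    show ?thesis using K01 Km pM(2) by (intro integrable_const_bound[of _ 1]) (auto cong: measurable_cong_sets)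
  qed
  have nn: "0 \<le> (\<integral>t. K d t \<partial>M (X1 d'))" for d d'
    using K01 by (intro Bochner_Integration.integral_nonneg) auto
  obtain i where i: "i < 2 * n" "\<And>j. j < 2 * n \<Longrightarrow> j \<noteq> i \<Longrightarrow> d j = d' j"
    using nb by (auto simp: neighbours_def)
  have "(\<integral>t. K d t \<partial>M (X1 d)) \<le> exp \<epsilon> * (\<integral>t. K d' t \<partial>M (X1 d')) + \<delta>"
  proof (cases "i < n")
    case True
    then have eq: "X2 d = X2 d'" using i by (auto simp: X2_def fun_eq_iff)
    have "neighbours n (X1 d) (X1 d')"
      unfolding neighbours_def using sp True i by (auto simp: X1_def intro!: exI[of _ i])
    then have "measure (M (X1 d)) E \<le> exp (\<epsilon> / 2) * measure (M (X1 d')) E + \<delta>" if "E \<in> sets borel" for E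
      using M that by (auto simp: diff_private_def)
    then have "(\<integral>t. K d t \<partial>M (X1 d)) \<le> exp (\<epsilon> / 2) * (\<integral>t. K d t \<partial>M (X1 d')) + \<delta>"
      by (rule integral_indistinguishable[OF pM(1) pM(1) pM(2) pM(2) Km K01 _ \<delta>])
    also have "\<dots> \<le> exp \<epsilon> * (\<integral>t. K d t \<partial>M (X1 d')) + \<delta>"
      using nn \<epsilon> by (intro add_right_mono mult_right_mono) auto
    finally show ?thesis by (simp add: K_def eq)
  next
    case False
    then have eq: "X1 d = X1 d'" using i by (auto simp: X1_def fun_eq_iff)
    have "K d t \<le> exp (\<epsilon> / 2) * K d' t" for t
      unfolding K_def using \<epsilon> n False i
      by (intro Count_private[where i = "i - n"]) (auto simp: X2_def)
    then have "(\<integral>t. K d t \<partial>M (X1 d)) \<le> (\<integral>t. exp (\<epsilon> / 2) * K d' t \<partial>M (X1 d))"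
      using int by (intro integral_mono) auto
    also have "\<dots> = exp (\<epsilon> / 2) * (\<integral>t. K d' t \<partial>M (X1 d'))" by (simp add: eq)
    also have "\<dots> \<le> exp \<epsilon> * (\<integral>t. K d' t \<partial>M (X1 d')) + \<delta>"
      using nn[of d' d'] \<epsilon> \<delta> by (intro add_increasing2 mult_right_mono) auto
    finally show ?thesis .
  qed
  then show "measure (pooled n (A_high \<mu> n \<epsilon> M) d) E \<le> exp \<epsilon> * measure (pooled n (A_high \<mu> n \<epsilon> M) d') E + \<delta>"
    unfolding A .
qed

end

section \<open>Private selection of a frequent label\<close>

definition label_count :: "nat \<Rightarrow> (nat \<Rightarrow> real) \<Rightarrow> real \<Rightarrow> real" where
  "label_count k r l = (\<Sum>j<k. if r j = l then 1 else 0)"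

text \<open>
  The unnormalized law of the sampler: a label occurring \<open>c\<close> times has mass \<open>exp (\<eta> * c) - 1\<close>,
  spread evenly over the indices that carry it, and \<open>W\<close> is the mass of the default output \<open>0\<close>.
  The shift by \<open>-1\<close> makes labels that do not occur weightless.
\<close>
definition label_mass :: "nat \<Rightarrow> real \<Rightarrow> real \<Rightarrow> (nat \<Rightarrow> real) \<Rightarrow> real set \<Rightarrow> real" where
  "label_mass k \<eta> W r E = W * indicator E 0 +
     (\<Sum>i<k. indicator E (r i) * ((exp (\<eta> * label_count k r (r i)) - 1) / label_count k r (r i)))"

definition label_weight :: "nat \<Rightarrow> real \<Rightarrow> real \<Rightarrow> (nat \<Rightarrow> real) \<Rightarrow> nat \<Rightarrow> real" where
  "label_weight k \<eta> W r i = (if i < k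
     then (exp (\<eta> * label_count k r (r i)) - 1) / label_count k r (r i) else W)"

text \<open>An index is sampled and then mapped to its label, since the index set
  \<open>{..k}\<close> is fixed whereas the labels depend on the data. Index \<open>k\<close> stands
  for the default.\<close>

definition label_sampler :: "nat \<Rightarrow> real \<Rightarrow> real \<Rightarrow> (nat \<Rightarrow> real) \<Rightarrow> real measure" where
  "label_sampler k \<eta> W r =
     distr (point_measure {..k} (\<lambda>i. ennreal (label_weight k \<eta> W r i / label_mass k \<eta> W r UNIV))) borel
       (\<lambda>i. if i < k then r i else 0)"

lemma label_count_nonneg: "label_count k r l \<ge> 0"
  unfolding label_count_def by (intro sum_nonneg) auto

text \<open>Summation over the indices that carry a label cancels the division by its count. Any
  finite superset \<open>L\<close> of the labels will do, as absent labels contribute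
  \<open>exp 0 - 1 = 0\<close>; so two datasets can be compared over the same
  \<open>L\<close>.\<close>

lemma label_mass_labels:
  assumes "finite L" "r ` {..<k} \<subseteq> L"
  shows "label_mass k \<eta> W r E = W * indicator E 0 + (\<Sum>l\<in>L. indicator E l * (exp (\<eta> * label_count k r l) - 1))"
proof -
  let ?c = "label_count k r"
  have "(\<Sum>i<k. indicator E (r i) * ((exp (\<eta> * ?c (r i)) - 1) / ?c (r i))) =
      (\<Sum>l\<in>L. \<Sum>i\<in>{i. i \<in> {..<k} \<and> r i = l}. indicator E (r i) * ((exp (\<eta> * ?c (r i)) - 1) / ?c (r i)))"
    using assms by (intro sum.group[symmetric]) auto
  also have "\<dots> = (\<Sum>l\<in>L. indicator E l * (exp (\<eta> * ?c l) - 1))"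
  proof (rule sum.cong[OF refl])
    fix l assume "l \<in> L"
    have cnt: "?c l = real (card {i. i \<in> {..<k} \<and> r i = l})"
      unfolding label_count_def by (subst sum.inter_filter[symmetric]) auto
    have "(\<Sum>i\<in>{i. i \<in> {..<k} \<and> r i = l}. indicator E (r i) * ((exp (\<eta> * ?c (r i)) - 1) / ?c (r i))) =
        (\<Sum>i\<in>{i. i \<in> {..<k} \<and> r i = l}. indicator E l * ((exp (\<eta> * ?c l) - 1) / ?c l))"
      by (intro sum.cong) auto
    also have "\<dots> = ?c l * (indicator E l * ((exp (\<eta> * ?c l) - 1) / ?c l))"
      by (simp add: cnt)
    also have "\<dots> = indicator E l * (exp (\<eta> * ?c l) - 1)"
      by (cases "?c l = 0") auto
    finally show "(\<Sum>i\<in>{i. i \<in> {..<k} \<and> r i = l}. indicator E (r i) * ((exp (\<eta> * ?c (r i)) - 1) / ?c (r i))) =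
        indicator E l * (exp (\<eta> * ?c l) - 1)" .
  qed
  finally show ?thesis by (simp add: label_mass_def)
qed

lemma label_weight_nonneg: "\<eta> \<ge> 0 \<Longrightarrow> W \<ge> 0 \<Longrightarrow> label_weight k \<eta> W r i \<ge> 0"
  using label_count_nonneg[of k r "r i"] by (auto simp: label_weight_def intro!: divide_nonneg_nonneg)

lemma label_mass_weight:
  "label_mass k \<eta> W r E = (\<Sum>i\<le>k. indicator E (if i < k then r i else 0) * label_weight k \<eta> W r i)"
proof -
  have "{..k} = insert k {..<k}" by auto
  then have "(\<Sum>i\<le>k. indicator E (if i < k then r i else 0) * label_weight k \<eta> W r i) =
      indicator E 0 * W + (\<Sum>i<k. indicator E (if i < k then r i else 0) * label_weight k \<eta> W r i)"
    by (simp only:) (subst sum.insert, auto simp: label_weight_def)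
  also have "\<dots> = label_mass k \<eta> W r E"
    unfolding label_mass_def by (intro arg_cong2[where f = "(+)"] sum.cong) (auto simp: label_weight_def)
  finally show ?thesis by simp
qed

lemma label_mass_nonneg: "\<eta> \<ge> 0 \<Longrightarrow> W \<ge> 0 \<Longrightarrow> label_mass k \<eta> W r E \<ge> 0"
  unfolding label_mass_weight by (intro sum_nonneg mult_nonneg_nonneg label_weight_nonneg) auto

lemma label_mass_total_ge: "\<eta> \<ge> 0 \<Longrightarrow> label_mass k \<eta> W r UNIV \<ge> W"
  unfolding label_mass_def using label_count_nonneg[of k r] by (auto intro!: sum_nonneg divide_nonneg_nonneg)

lemma sets_label_sampler [simp]: "sets (label_sampler k \<eta> W r) = sets borel"
  by (simp add: label_sampler_def)

lemma emeasure_label_sampler: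
  assumes "\<eta> \<ge> 0" "W > 0" "E \<in> sets borel"
  shows "emeasure (label_sampler k \<eta> W r) E = ennreal (label_mass k \<eta> W r E / label_mass k \<eta> W r UNIV)"
proof -
  define Z where "Z = label_mass k \<eta> W r UNIV"
  have Z: "Z > 0" using label_mass_total_ge[of \<eta> W k r] assms by (simp add: Z_def)
  let ?r = "\<lambda>i. if i < k then r i else 0"
  let ?w = "label_weight k \<eta> W r"
  have w: "?w i / Z \<ge> 0" for i using label_weight_nonneg[of \<eta> W k r i] assms Z by simp
  have "emeasure (label_sampler k \<eta> W r) E =
      emeasure (point_measure {..k} (\<lambda>i. ennreal (?w i / Z))) (?r -` E \<inter> {..k})"
    unfolding label_sampler_def Z_def[symmetric] using assms
    by (subst emeasure_distr) (auto simp: space_point_measure)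
  also have "\<dots> = (\<Sum>i\<in>?r -` E \<inter> {..k}. ennreal (?w i / Z))"
    by (rule emeasure_point_measure_finite) auto
  also have "\<dots> = ennreal (\<Sum>i\<in>?r -` E \<inter> {..k}. ?w i / Z)"
    using w by (intro sum_ennreal) auto
  also have "(\<Sum>i\<in>?r -` E \<inter> {..k}. ?w i / Z) = (\<Sum>i\<le>k. indicator E (?r i) * ?w i) / Z"
    unfolding sum_divide_distrib by (intro sum.mono_neutral_cong_left) (auto split: split_indicator)
  finally show ?thesis by (simp add: label_mass_weight Z_def)
qed

lemma prob_space_label_sampler:
  assumes "\<eta> \<ge> 0" "W > 0"
  shows "prob_space (label_sampler k \<eta> W r)"
proof
  have sp: "space (label_sampler k \<eta> W r) = UNIV" by (simp add: label_sampler_def)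
  show "emeasure (label_sampler k \<eta> W r) (space (label_sampler k \<eta> W r)) = 1"
    unfolding sp using label_mass_total_ge[of \<eta> W k r] assms
    by (subst emeasure_label_sampler[OF assms]) auto
qed

lemma measure_label_sampler:
  assumes "\<eta> \<ge> 0" "W > 0" "E \<in> sets borel"
  shows "measure (label_sampler k \<eta> W r) E = label_mass k \<eta> W r E / label_mass k \<eta> W r UNIV"
  using emeasure_label_sampler[OF assms] label_mass_nonneg[of \<eta> W] assms
  by (simp add: measure_def)

lemma label_count_change:
  assumes "i < k" "\<And>j. j < k \<Longrightarrow> j \<noteq> i \<Longrightarrow> r j = r' j"
  shows "label_count k r' l \<le> label_count k r l + (if l = r' i then 1 else 0)"
proof -
  have "label_count k r' l = (if r' i = l then 1 else 0) + (\<Sum>j\<in>{..<k} - {i}. if r' j = l then 1 else 0)"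
    unfolding label_count_def using assms(1) by (subst sum.remove[of _ i]) auto
  also have "(\<Sum>j\<in>{..<k} - {i}. if r' j = l then 1 else 0 :: real) = (\<Sum>j\<in>{..<k} - {i}. if r j = l then 1 else 0)"
    using assms(2) by (intro sum.cong) auto
  also have "\<dots> \<le> label_count k r l"
    unfolding label_count_def by (intro sum_mono2) auto
  finally show ?thesis by auto
qed

text \<open>Only the label \<open>r' i\<close> can gain, and by one occurrence. The identity
  \<open>exp (\<eta> * (c + 1)) - 1 = exp \<eta> * (exp (\<eta> * c) - 1) + (exp \<eta> - 1)\<close>
  explains the single additive term. In the total mass this term is absorbed, because
  \<open>W \<ge> 1\<close> makes the total at least \<open>exp (\<eta> * c)\<close>.\<close>

lemma label_mass_change:
  assumes \<eta>: "\<eta> \<ge> 0" and W: "W \<ge> 1" and i: "i < k" "\<And>j. j < k \<Longrightarrow> j \<noteq> i \<Longrightarrow> r j = r' j"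
  shows "label_mass k \<eta> W r' E \<le> exp \<eta> * label_mass k \<eta> W r E + (exp \<eta> - 1)"
    and "label_mass k \<eta> W r' UNIV \<le> exp \<eta> * label_mass k \<eta> W r UNIV"
proof -
  define L where "L = r ` {..<k} \<union> r' ` {..<k}"
  have L: "finite L" "r ` {..<k} \<subseteq> L" "r' ` {..<k} \<subseteq> L" "r' i \<in> L" using i by (auto simp: L_def)
  let ?c = "label_count k r" and ?c' = "label_count k r'"
  have e1: "exp \<eta> \<ge> 1" using \<eta> by simp
  have step: "exp (\<eta> * ?c' l) - 1 \<le> (exp (\<eta> * ?c l) - 1) + (if l = r' i then exp (\<eta> * ?c l) * (exp \<eta> - 1) else 0)" for l
  proof -
    have "exp (\<eta> * ?c' l) \<le> exp (\<eta> * (?c l + (if l = r' i then 1 else 0)))"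
    proof -
      have "label_count k r' l \<le> label_count k r l + (if l = r' i then 1 else 0)"
        by (rule label_count_change[OF i(1)]) (rule i(2))
      then show ?thesis unfolding exp_le_cancel_iff using \<eta> by (rule mult_left_mono)
    qed
    then show ?thesis by (auto simp: distrib_left exp_add algebra_simps)
  qed
  have step2: "indicator E l * (exp (\<eta> * ?c' l) - 1) \<le>
      exp \<eta> * (indicator E l * (exp (\<eta> * ?c l) - 1)) + (if l = r' i then exp \<eta> - 1 else 0)" for l
  proof -
    define x where "x = exp (\<eta> * ?c l)"
    have "x \<ge> 1" using label_count_nonneg[of k r l] \<eta> by (simp add: x_def)
    then have "x - 1 \<le> exp \<eta> * (x - 1)" using mult_right_mono[OF e1, of "x - 1"] by simp
    then show ?thesis using step[of l] e1 unfolding x_def[symmetric]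
      by (auto split: split_indicator simp: algebra_simps)
  qed
  have "label_mass k \<eta> W r' E = W * indicator E 0 + (\<Sum>l\<in>L. indicator E l * (exp (\<eta> * ?c' l) - 1))"
    by (rule label_mass_labels[OF L(1,3)])
  also have "\<dots> \<le> exp \<eta> * (W * indicator E 0) +
      (\<Sum>l\<in>L. exp \<eta> * (indicator E l * (exp (\<eta> * ?c l) - 1)) + (if l = r' i then exp \<eta> - 1 else 0))"
    using mult_right_mono[OF e1, of "W * indicator E 0"] W by (intro add_mono sum_mono step2) auto
  also have "\<dots> = exp \<eta> * label_mass k \<eta> W r E + (exp \<eta> - 1)"
    using L by (subst label_mass_labels[OF L(1,2)]) (simp add: sum.distrib distrib_left flip: sum_distrib_left)
  finally show "label_mass k \<eta> W r' E \<le> exp \<eta> * label_mass k \<eta> W r E + (exp \<eta> - 1)" .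
  have Z: "label_mass k \<eta> W r UNIV = W + (\<Sum>l\<in>L. exp (\<eta> * ?c l) - 1)"
    by (subst label_mass_labels[OF L(1,2)]) simp
  have "exp (\<eta> * ?c (r' i)) - 1 \<le> (\<Sum>l\<in>L. exp (\<eta> * ?c l) - 1)"
    using L label_count_nonneg[of k r] \<eta> by (intro member_le_sum) auto
  then have Zb: "exp (\<eta> * ?c (r' i)) \<le> label_mass k \<eta> W r UNIV" using W by (simp add: Z)
  have "label_mass k \<eta> W r' UNIV = W + (\<Sum>l\<in>L. exp (\<eta> * ?c' l) - 1)"
    by (subst label_mass_labels[OF L(1,3)]) simp
  also have "\<dots> \<le> W + (\<Sum>l\<in>L. (exp (\<eta> * ?c l) - 1) + (if l = r' i then exp (\<eta> * ?c l) * (exp \<eta> - 1) else 0))"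
    by (intro add_left_mono sum_mono step)
  also have "\<dots> = label_mass k \<eta> W r UNIV + exp (\<eta> * ?c (r' i)) * (exp \<eta> - 1)"
    using L unfolding Z by (subst sum.distrib) simp
  also have "\<dots> \<le> label_mass k \<eta> W r UNIV + label_mass k \<eta> W r UNIV * (exp \<eta> - 1)"
    using Zb e1 by (intro add_left_mono mult_right_mono) auto
  finally show "label_mass k \<eta> W r' UNIV \<le> exp \<eta> * label_mass k \<eta> W r UNIV"
    by (simp add: algebra_simps)
qed

text \<open>One factor \<open>exp \<eta>\<close> comes from the numerator and one from the
  normalization. The additive term is divided by a total of at least \<open>W\<close>, so a large
  default mass makes it small.\<close>

lemma label_sampler_private:
  assumes \<eta>: "\<eta> \<ge> 0" and W: "W \<ge> 1" and E: "E \<in> sets borel"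
    and i: "i < k" "\<And>j. j < k \<Longrightarrow> j \<noteq> i \<Longrightarrow> r j = r' j"
  shows "measure (label_sampler k \<eta> W r) E \<le>
    exp (2 * \<eta>) * measure (label_sampler k \<eta> W r') E + exp (2 * \<eta>) / W"
proof -
  define Z Z' where "Z = label_mass k \<eta> W r UNIV" and "Z' = label_mass k \<eta> W r' UNIV"
  have ZW: "Z \<ge> W" "Z' \<ge> W" using label_mass_total_ge \<eta> by (auto simp: Z_def Z'_def)
  then have Z: "Z > 0" "Z' > 0" using W by auto
  have i': "\<And>j. j < k \<Longrightarrow> j \<noteq> i \<Longrightarrow> r' j = r j" using i by simp
  have m: "label_mass k \<eta> W r E \<le> exp \<eta> * label_mass k \<eta> W r' E + (exp \<eta> - 1)"
    by (rule label_mass_change(1)[OF \<eta> W i(1) i'])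
  have "Z' \<le> exp \<eta> * Z" unfolding Z_def Z'_def by (rule label_mass_change(2)[OF \<eta> W i])
  then have inv: "1 / Z \<le> exp \<eta> / Z'" using Z by (simp add: field_simps)
  have e1: "exp \<eta> \<ge> 1" using \<eta> by simp
  have nn: "label_mass k \<eta> W r' E \<ge> 0" using \<eta> W by (intro label_mass_nonneg) auto
  have "label_mass k \<eta> W r E / Z \<le> (exp \<eta> * label_mass k \<eta> W r' E + (exp \<eta> - 1)) * (1 / Z)"
    using m Z by (simp add: divide_right_mono)
  also have "\<dots> \<le> (exp \<eta> * label_mass k \<eta> W r' E + (exp \<eta> - 1)) * (exp \<eta> / Z')"
    using inv e1 nn by (intro mult_left_mono) auto
  also have "\<dots> = exp (2 * \<eta>) * (label_mass k \<eta> W r' E / Z') + (exp \<eta> - 1) * exp \<eta> / Z'"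
    using Z unfolding mult_2 exp_add by (simp add: field_simps)
  also have "(exp \<eta> - 1) * exp \<eta> / Z' \<le> exp (2 * \<eta>) / W"
    using ZW W unfolding mult_2 exp_add by (intro frac_le) auto
  finally show ?thesis
    using \<eta> W E by (simp add: measure_label_sampler Z_def Z'_def)
qed

text \<open>Superadditivity of \<open>exp x - 1\<close> on nonnegative reals: many rare labels weigh
  no more together than one label that carries all their occurrences, so the bound does not depend
  on the number of bad labels.\<close>

lemma sum_expm1_le:
  assumes "finite L" "\<And>l. l \<in> L \<Longrightarrow> f l \<ge> (0::real)"
  shows "(\<Sum>l\<in>L. exp (f l) - 1) \<le> exp (\<Sum>l\<in>L. f l) - 1"
  using assms
proof (induction L rule: finite_induct)
  case (insert x L)
  have "0 \<le> (exp (f x) - 1) * (exp (\<Sum>l\<in>L. f l) - 1)"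
    using insert.prems by (intro mult_nonneg_nonneg) (auto intro!: sum_nonneg)
  with insert show ?case by (simp add: exp_add algebra_simps)
qed simp

text \<open>Outside \<open>G\<close> there is at most the default and the weight of one label with
  \<open>b\<close> occurrences. Inside, the pigeonhole principle gives a label with at least
  \<open>(k - b) / card G\<close> occurrences.\<close>

lemma label_sampler_utility:
  assumes \<eta>: "\<eta> \<ge> 0" and W: "W \<ge> 1" and G: "finite G" "G \<noteq> {}"
    and bad: "(\<Sum>i<k. if r i \<in> G then 0 else 1) \<le> b"
  shows "measure (label_sampler k \<eta> W r) (- G) \<le> (W + exp (\<eta> * b)) / exp (\<eta> * ((real k - b) / card G))"
proof -
  let ?c = "label_count k r"
  define L where "L = r ` {..<k} \<union> G"
  have L: "finite L" "r ` {..<k} \<subseteq> L" "G \<subseteq> L" using G by (auto simp: L_def)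
  have cnt: "(\<Sum>l\<in>A. ?c l) = (\<Sum>i<k. if r i \<in> A then 1 else 0)" if "finite A" for A
    unfolding label_count_def using that by (subst sum.swap) (simp add: sum.If_cases)
  have Gb: "- G \<in> sets borel" using G by (intro borel_open open_Compl finite_imp_closed)
  have "(\<Sum>l\<in>L - G. ?c l) = (\<Sum>i<k. if r i \<in> L - G then 1 else 0)" using L by (intro cnt) auto
  also have "\<dots> = (\<Sum>i<k. if r i \<in> G then 0 else 1)" using L by (intro sum.cong) auto
  finally have badc: "(\<Sum>l\<in>L - G. ?c l) \<le> b" using bad by simp
  have "label_mass k \<eta> W r (- G) \<le> W + (\<Sum>l\<in>L. indicator (- G) l * (exp (\<eta> * ?c l) - 1))"
    using W by (subst label_mass_labels[OF L(1,2)]) (auto split: split_indicator)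
  also have "(\<Sum>l\<in>L. indicator (- G) l * (exp (\<eta> * ?c l) - 1)) = (\<Sum>l\<in>L - G. exp (\<eta> * ?c l) - 1)"
    using L by (intro sum.mono_neutral_cong_right) (auto split: split_indicator)
  also have "\<dots> \<le> exp (\<Sum>l\<in>L - G. \<eta> * ?c l) - 1"
    using L \<eta> label_count_nonneg by (intro sum_expm1_le) auto
  also have "(\<Sum>l\<in>L - G. \<eta> * ?c l) \<le> \<eta> * b"
    using badc \<eta> by (simp add: sum_distrib_left[symmetric] mult_left_mono)
  finally have up: "label_mass k \<eta> W r (- G) \<le> W + exp (\<eta> * b)" by simp
  have "\<exists>l\<in>G. ?c l \<ge> (real k - b) / card G"
  proof (rule ccontr)
    assume "\<not> ?thesis"
    then have "(\<Sum>l\<in>G. ?c l) < (\<Sum>l\<in>G. (real k - b) / card G)"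
      using G by (intro sum_strict_mono) auto
    also have "\<dots> = real k - b" using G by simp
    also have "real k - b \<le> (\<Sum>i<k. 1) - (\<Sum>i<k. if r i \<in> G then 0 else 1)" using bad by simp
    also have "\<dots> = (\<Sum>i<k. if r i \<in> G then 1 else 0)"
      by (subst sum_subtractf[symmetric]) (intro sum.cong, auto)
    also have "\<dots> = (\<Sum>l\<in>G. ?c l)" using G by (intro cnt[symmetric]) auto
    finally show False by simp
  qed
  then obtain l where l: "l \<in> G" "?c l \<ge> (real k - b) / card G" by auto
  have "exp (\<eta> * ((real k - b) / card G)) \<le> exp (\<eta> * ?c l)"
    using l \<eta> by (simp only: exp_le_cancel_iff mult_left_mono)
  \<comment> \<open>\<open>W \<ge> 1\<close> pays for the shift by -1.\<close>
  also have "\<dots> \<le> W + (exp (\<eta> * ?c l) - 1)" using W by simp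
  also have "exp (\<eta> * ?c l) - 1 \<le> (\<Sum>l\<in>L. exp (\<eta> * ?c l) - 1)"
    using L l label_count_nonneg[of k r] \<eta> by (intro member_le_sum) auto
  also have "W + (\<Sum>l\<in>L. exp (\<eta> * ?c l) - 1) = label_mass k \<eta> W r UNIV"
    by (subst label_mass_labels[OF L(1,2)]) simp
  finally have lo: "exp (\<eta> * ((real k - b) / card G)) \<le> label_mass k \<eta> W r UNIV" by simp
  have "measure (label_sampler k \<eta> W r) (- G) = label_mass k \<eta> W r (- G) / label_mass k \<eta> W r UNIV"
    using \<eta> W Gb by (intro measure_label_sampler) auto
  also have "\<dots> \<le> (W + exp (\<eta> * b)) / exp (\<eta> * ((real k - b) / card G))"
    using up lo W by (intro frac_le) (auto intro!: add_nonneg_nonneg)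
  finally show ?thesis .
qed

lemma label_sampler_kernel:
  assumes \<eta>: "\<eta> \<ge> 0" and W: "W > 0" and r: "\<And>i. i < k \<Longrightarrow> (\<lambda>x. r x i) \<in> borel_measurable N"
  shows "(\<lambda>x. label_sampler k \<eta> W (r x)) \<in> N \<rightarrow>\<^sub>M prob_algebra borel"
proof (intro measurable_prob_algebraI measurable_subprob_algebra)
  fix x
  show "prob_space (label_sampler k \<eta> W (r x))" using assms by (intro prob_space_label_sampler)
  then show "subprob_space (label_sampler k \<eta> W (r x))" by (rule prob_space_imp_subprob_space)
next
  fix E :: "real set" assume E [measurable]: "E \<in> sets borel"
  have c: "(\<lambda>x. label_count k (r x) (r x i)) \<in> borel_measurable N" if "i < k" for i
    unfolding label_count_def
  proof (intro borel_measurable_sum)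
    fix j assume "j \<in> {..<k}"
    then have [measurable]: "(\<lambda>x. r x j) \<in> borel_measurable N" "(\<lambda>x. r x i) \<in> borel_measurable N"
      using r that by auto
    show "(\<lambda>x. if r x j = r x i then 1 else 0 :: real) \<in> borel_measurable N" by measurable
  qed
  have m: "(\<lambda>x. label_mass k \<eta> W (r x) E) \<in> borel_measurable N" if [measurable]: "E \<in> sets borel" for E
    unfolding label_mass_def
  proof (intro borel_measurable_add borel_measurable_const borel_measurable_sum)
    fix i assume "i \<in> {..<k}"
    then have [measurable]: "(\<lambda>x. r x i) \<in> borel_measurable N" "(\<lambda>x. label_count k (r x) (r x i)) \<in> borel_measurable N"
      using r c by auto
    show "(\<lambda>x. indicator E (r x i) * ((exp (\<eta> * label_count k (r x) (r x i)) - 1) / label_count k (r x) (r x i)))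
        \<in> borel_measurable N" by measurable
  qed
  have [measurable]: "(\<lambda>x. label_mass k \<eta> W (r x) E) \<in> borel_measurable N"
    "(\<lambda>x. label_mass k \<eta> W (r x) UNIV) \<in> borel_measurable N" by (rule m, simp)+
  show "(\<lambda>x. emeasure (label_sampler k \<eta> W (r x)) E) \<in> borel_measurable N"
    unfolding emeasure_label_sampler[OF \<eta> W E] by measurable
qed (rule sets_label_sampler)

section \<open>The mean estimator\<close>

definition block_mean :: "nat \<Rightarrow> (nat \<Rightarrow> real) \<Rightarrow> nat \<Rightarrow> real" where
  "block_mean B X i = (\<Sum>j<B. X (i * B + j)) / real B"

definition block_sd :: "nat \<Rightarrow> (nat \<Rightarrow> real) \<Rightarrow> nat \<Rightarrow> real" where
  "block_sd B X i = sqrt ((\<Sum>j<B. (X (i * B + j))\<^sup>2) / real B - (block_mean B X i)\<^sup>2)"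

text \<open>Rounding the deviation down to a power of two makes blocks with comparable deviations
  share a width or use adjacent ones, so that their labels can coincide exactly.\<close>

definition grid_width :: "real \<Rightarrow> real \<Rightarrow> real" where
  "grid_width \<tau> s = \<tau> * 2 powr real_of_int \<lfloor>log 2 s\<rfloor>"

definition block_label :: "nat \<Rightarrow> real \<Rightarrow> (nat \<Rightarrow> real) \<Rightarrow> nat \<Rightarrow> real" where
  "block_label B \<tau> X i = (let w = grid_width \<tau> (block_sd B X i)
     in w * real_of_int \<lfloor>block_mean B X i / w\<rfloor>)"

text \<open>
  At \<open>\<delta> = 0\<close> no accuracy is asked for, and the constant output is private.
\<close>
definition mean_estimator :: "nat \<Rightarrow> real \<Rightarrow> real \<Rightarrow> real \<Rightarrow> nat \<Rightarrow> mechanism" where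
  "mean_estimator B \<tau> \<delta> \<epsilon> n X = (if \<delta> \<le> 0 then return borel 0
     else label_sampler (n div B) (\<epsilon> / 4) (exp (\<epsilon> / 2) / \<delta>) (block_label B \<tau> X))"

lemma block_index_less: "i < n div B \<Longrightarrow> j < B \<Longrightarrow> i * B + j < (n :: nat)"
proof -
  assume "i < n div B" "j < B"
  then have "i * B + j < (i + 1) * B" by simp
  also have "\<dots> \<le> (n div B) * B" using \<open>i < n div B\<close> by (intro mult_right_mono) auto
  also have "\<dots> \<le> n" by simp
  finally show ?thesis .
qed

lemma block_label_measurable:
  assumes "i < n div B"
  shows "(\<lambda>X. block_label B \<tau> X i) \<in> borel_measurable (datasets n)"
proof -
  have X: "(\<lambda>X. X (i * B + j)) \<in> borel_measurable (datasets n)" if "j < B" for j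
    using block_index_less[OF assms that] by (intro measurable_component_singleton) auto
  have [measurable]: "(\<lambda>X. block_mean B X i) \<in> borel_measurable (datasets n)"
    unfolding block_mean_def using X by (intro borel_measurable_divide borel_measurable_sum) auto
  have [measurable]: "(\<lambda>X. block_sd B X i) \<in> borel_measurable (datasets n)"
    unfolding block_sd_def using X
    by (intro measurable_compose[OF _ borel_measurable_sqrt] borel_measurable_diff
        borel_measurable_divide borel_measurable_sum borel_measurable_power) auto
  have [measurable]: "(\<lambda>X. grid_width \<tau> (block_sd B X i)) \<in> borel_measurable (datasets n)"
    unfolding grid_width_def by measurable
  show ?thesis unfolding block_label_def Let_def by measurable
qed

lemma block_label_cong:
  assumes "\<And>j. j < B \<Longrightarrow> X (i * B + j) = X' (i * B + j)"
  shows "block_label B \<tau> X i = block_label B \<tau> X' i"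
proof -
  have "block_mean B X i = block_mean B X' i"
    unfolding block_mean_def using assms by simp
  moreover have "block_sd B X i = block_sd B X' i"
    unfolding block_sd_def calculation using assms by simp
  ultimately show ?thesis by (simp add: block_label_def)
qed

text \<open>A record belongs to at most one block, so neighbouring datasets have label vectors that
  differ in at most one index, and the sampler runs at
  \<open>\<eta> = \<epsilon> / 4\<close>.\<close>

lemma mean_estimator_private:
  assumes e: "\<epsilon> > 0" and \<delta>: "\<delta> \<in> {0..1}" and B: "B > 0"
  shows "diff_private n (\<epsilon> / 2) \<delta> (mean_estimator B \<tau> \<delta> \<epsilon> n)"
proof (cases "\<delta> = 0")
  case True
  have "measure (return borel (0::real)) E \<le> exp (\<epsilon> / 2) * measure (return borel 0) E" for E
    using e mult_right_mono[of 1 "exp (\<epsilon> / 2)" "measure (return borel (0::real)) E"] by simp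
  moreover have "(\<lambda>_. return borel (0::real)) \<in> datasets n \<rightarrow>\<^sub>M prob_algebra borel"
    by (intro measurable_const) (simp add: space_prob_algebra prob_space_return)
  moreover have "mean_estimator B \<tau> \<delta> \<epsilon> n = (\<lambda>_. return borel 0)"
    using True by (simp add: mean_estimator_def fun_eq_iff)
  ultimately show ?thesis using True by (simp add: diff_private_def)
next
  case False
  then have \<delta>: "0 < \<delta>" "\<delta> \<le> 1" using \<delta> by auto
  define k W r where "k = n div B" and "W = exp (\<epsilon> / 2) / \<delta>" and "r = block_label B \<tau>"
  have W: "W \<ge> 1" using \<delta> e by (simp add: W_def order.trans[OF \<delta>(2)])
  have eq: "mean_estimator B \<tau> \<delta> \<epsilon> n = (\<lambda>X. label_sampler k (\<epsilon> / 4) W (r X))"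
    using \<delta> by (simp add: mean_estimator_def fun_eq_iff k_def W_def r_def)
  have "measure (label_sampler k (\<epsilon> / 4) W (r d)) E \<le>
      exp (\<epsilon> / 2) * measure (label_sampler k (\<epsilon> / 4) W (r d')) E + \<delta>"
    if nb: "neighbours n d d'" and E: "E \<in> sets borel" for d d' E
  proof -
    obtain p where p: "p < n" "\<And>j. j < n \<Longrightarrow> j \<noteq> p \<Longrightarrow> d j = d' j"
      using nb by (auto simp: neighbours_def)
    have same: "r d i = r d' i" if "i < k" "i \<noteq> p div B" for i
      unfolding r_def
    proof (rule block_label_cong)
      fix j assume "j < B"
      then have "(i * B + j) div B = i" by simp
      then have "i * B + j \<noteq> p" using that by auto
      then show "d (i * B + j) = d' (i * B + j)"
        using that \<open>j < B\<close> block_index_less by (intro p) (auto simp: k_def)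
    qed
    \<comment> \<open>The default mass \<open>W\<close> is chosen for this identity.\<close>
    have dW: "exp (2 * (\<epsilon> / 4)) / W = \<delta>" using \<delta> by (simp add: W_def)
    show ?thesis
    proof (cases "k = 0")
      case True
      have "measure (label_sampler k (\<epsilon> / 4) W (r d)) E = measure (label_sampler k (\<epsilon> / 4) W (r d')) E"
        using e W E True by (simp add: measure_label_sampler label_mass_def)
      moreover have "1 * measure (label_sampler k (\<epsilon> / 4) W (r d')) E \<le>
          exp (\<epsilon> / 2) * measure (label_sampler k (\<epsilon> / 4) W (r d')) E"
        using e by (intro mult_right_mono) auto
      ultimately show ?thesis using \<delta> by simp
    next
      case False
      \<comment> \<open>A record behind the last full block changes no label; index 0 is then an
        arbitrary legal choice.\<close>
      define i where "i = (if p div B < k then p div B else 0)"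
      have "i < k" using False by (simp add: i_def)
      then have "measure (label_sampler k (\<epsilon> / 4) W (r d)) E \<le>
        exp (2 * (\<epsilon> / 4)) * measure (label_sampler k (\<epsilon> / 4) W (r d')) E + exp (2 * (\<epsilon> / 4)) / W"
        using e W E same by (intro label_sampler_private[where i = i]) (auto simp: i_def split: if_splits)
      then show ?thesis unfolding dW by simp
    qed
  qed
  moreover have "(\<lambda>X. label_sampler k (\<epsilon> / 4) W (r X)) \<in> datasets n \<rightarrow>\<^sub>M prob_algebra borel"
    using e W by (intro label_sampler_kernel) (auto simp: r_def k_def intro!: block_label_measurable)
  ultimately show ?thesis unfolding diff_private_def eq by blast
qed

section \<open>Second moments of sums over independent coordinates\<close>

lemma expectation_coordinates_sq:
  fixes D :: "real measure" and g :: "real \<Rightarrow> real"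
  assumes "prob_space D" and sD: "sets D = sets borel" and g [measurable]: "g \<in> borel_measurable borel"
    and g2: "integrable D (\<lambda>x. (g x)\<^sup>2)" and g0: "(\<integral>x. g x \<partial>D) = 0"
    and I: "finite N" "I \<subseteq> N"
  shows "integrable (PiM N (\<lambda>_. D)) (\<lambda>X. (\<Sum>i\<in>I. g (X i))\<^sup>2)"
    and "(\<integral>X. (\<Sum>i\<in>I. g (X i))\<^sup>2 \<partial>PiM N (\<lambda>_. D)) = real (card I) * (\<integral>x. (g x)\<^sup>2 \<partial>D)"
proof -
  interpret D: prob_space D by fact
  interpret product_prob_space "\<lambda>_. D" by standard
  note [measurable_cong] = sD
  have g1: "integrable D g" by (rule D.square_integrable_imp_integrable[OF _ g2]) simp
  \<comment> \<open>A product over two coordinates is rewritten as a product over all of them, with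
    factor 1 elsewhere, so that the product formula for integrals applies. For
    \<open>i \<noteq> j\<close> the factor at \<open>i\<close> has integral 0, which kills the cross
    terms.\<close>
  define f where "f i j l x = (if l = i then g x else 1) * (if l = j then g x else 1)" for i j l :: 'a and x
  have f: "integrable D (f i j l)" for i j l
    using g1 g2 by (cases "l = i"; cases "l = j") (auto simp: f_def[abs_def] power2_eq_square)
  have fint: "(\<integral>x. f i j l x \<partial>D) = (if i = j then if l = i then \<integral>x. (g x)\<^sup>2 \<partial>D else 1 else if l = i \<or> l = j then 0 else 1)" for i j l
    using g0 D.prob_space by (auto simp: f_def power2_eq_square)
  have prod: "g (X i) * g (X j) = (\<Prod>l\<in>N. f i j l (X l))" if "i \<in> I" "j \<in> I" for X i j
    unfolding f_def prod.distrib using that I by (simp add: prod.delta subset_iff)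
  have int: "integrable (PiM N (\<lambda>_. D)) (\<lambda>X. g (X i) * g (X j))" if "i \<in> I" "j \<in> I" for i j
    unfolding prod[OF that] by (rule product_integrable_prod[OF I(1) f])
  have val: "(\<integral>X. g (X i) * g (X j) \<partial>PiM N (\<lambda>_. D)) = (if i = j then \<integral>x. (g x)\<^sup>2 \<partial>D else 0)"
    if "i \<in> I" "j \<in> I" for i j
  proof -
    have "(\<integral>X. g (X i) * g (X j) \<partial>PiM N (\<lambda>_. D)) = (\<Prod>l\<in>N. \<integral>x. f i j l x \<partial>D)"
      unfolding prod[OF that] by (rule product_integral_prod[OF I(1) f])
    also have "\<dots> = (if i = j then \<integral>x. (g x)\<^sup>2 \<partial>D else 0)"
    proof (cases "i = j")
      case True
      then show ?thesis using that I by (simp add: fint prod.delta subset_iff)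
    next
      case False
      then have "\<exists>l\<in>N. (\<integral>x. f i j l x \<partial>D) = 0" using that I by (intro bexI[of _ i]) (auto simp: fint)
      then show ?thesis using False I(1) by (simp add: prod_zero_iff)
    qed
    finally show ?thesis .
  qed
  have sq: "(\<Sum>i\<in>I. g (X i))\<^sup>2 = (\<Sum>i\<in>I. \<Sum>j\<in>I. g (X i) * g (X j))" for X
    by (simp add: power2_eq_square sum_product)
  show "integrable (PiM N (\<lambda>_. D)) (\<lambda>X. (\<Sum>i\<in>I. g (X i))\<^sup>2)"
    unfolding sq using int by (intro Bochner_Integration.integrable_sum)
  have fI: "finite I" using I finite_subset by auto
  have "(\<integral>X. (\<Sum>i\<in>I. g (X i))\<^sup>2 \<partial>PiM N (\<lambda>_. D)) = (\<Sum>i\<in>I. \<Sum>j\<in>I. \<integral>X. g (X i) * g (X j) \<partial>PiM N (\<lambda>_. D))"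
    unfolding sq using int by (simp add: Bochner_Integration.integral_sum Bochner_Integration.integrable_sum)
  also have "\<dots> = (\<Sum>i\<in>I. \<Sum>j\<in>I. if i = j then \<integral>x. (g x)\<^sup>2 \<partial>D else 0)"
    using val by (intro sum.cong refl) auto
  also have "\<dots> = real (card I) * (\<integral>x. (g x)\<^sup>2 \<partial>D)"
    using fI by simp
  finally show "(\<integral>X. (\<Sum>i\<in>I. g (X i))\<^sup>2 \<partial>PiM N (\<lambda>_. D)) = real (card I) * (\<integral>x. (g x)\<^sup>2 \<partial>D)" .
qed

lemma Chebyshev_coordinates:
  fixes D :: "real measure" and g :: "real \<Rightarrow> real"
  assumes "prob_space D" and sD: "sets D = sets borel" and g [measurable]: "g \<in> borel_measurable borel"
    and g2: "integrable D (\<lambda>x. (g x)\<^sup>2)" and g0: "(\<integral>x. g x \<partial>D) = 0"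
    and I: "finite N" "I \<subseteq> N" and a: "a > 0"
  shows "measure (PiM N (\<lambda>_. D)) {X \<in> space (PiM N (\<lambda>_. D)). a \<le> \<bar>\<Sum>i\<in>I. g (X i)\<bar>}
    \<le> real (card I) * (\<integral>x. (g x)\<^sup>2 \<partial>D) / a\<^sup>2"
proof -
  note sq = expectation_coordinates_sq[OF assms(1-7)]
  have eq: "{X \<in> space (PiM N (\<lambda>_. D)). a \<le> \<bar>\<Sum>i\<in>I. g (X i)\<bar>} =
      {X \<in> space (PiM N (\<lambda>_. D)). a\<^sup>2 \<le> (\<Sum>i\<in>I. g (X i))\<^sup>2}"
    using a by (auto simp: abs_le_square_iff[symmetric])
  have "measure (PiM N (\<lambda>_. D)) {X \<in> space (PiM N (\<lambda>_. D)). a\<^sup>2 \<le> (\<Sum>i\<in>I. g (X i))\<^sup>2} \<le>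
      (\<integral>X. (\<Sum>i\<in>I. g (X i))\<^sup>2 \<partial>PiM N (\<lambda>_. D)) / a\<^sup>2"
    using a by (intro integral_Markov_inequality_measure[where A = "{}"] sq(1)) auto
  then show ?thesis unfolding eq sq(2) .
qed

section \<open>Accuracy of the mean estimator\<close>

text \<open>\<open>a\<close> selects one of the two grid widths that a deviation within a factor
  \<open>sqrt 2\<close> of \<open>\<sigma>\<close> can produce, and \<open>b\<close> one of the two
  cells that the window of length \<open>\<tau> * \<sigma> / 4\<close> centred at \<open>m\<close>
  can meet; \<open>m - \<tau> * \<sigma> / 8\<close> is the left end of this window.\<close>

definition good_label :: "real \<Rightarrow> real \<Rightarrow> real \<Rightarrow> nat \<Rightarrow> nat \<Rightarrow> real" where
  "good_label \<tau> \<sigma> m a b = (let w = \<tau> * 2 powr (real_of_int \<lfloor>log 2 (\<sigma> / sqrt 2)\<rfloor> + real a)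
     in w * (real_of_int \<lfloor>(m - \<tau> * \<sigma> / 8) / w\<rfloor> + real b))"

definition good_labels :: "real \<Rightarrow> real \<Rightarrow> real \<Rightarrow> real set" where
  "good_labels \<tau> \<sigma> m = (\<lambda>(a, b). good_label \<tau> \<sigma> m a b) ` ({0, 1} \<times> {0, 1})"

lemma finite_good_labels: "finite (good_labels \<tau> \<sigma> m)" "good_labels \<tau> \<sigma> m \<noteq> {}"
  "card (good_labels \<tau> \<sigma> m) \<le> 4"
proof -
  show "finite (good_labels \<tau> \<sigma> m)" "good_labels \<tau> \<sigma> m \<noteq> {}" by (auto simp: good_labels_def)
  have "card (good_labels \<tau> \<sigma> m) \<le> card ({0, 1 :: nat} \<times> {0, 1 :: nat})"
    unfolding good_labels_def by (rule card_image_le) auto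
  then show "card (good_labels \<tau> \<sigma> m) \<le> 4" by simp
qed

section \<open>Deterministic analysis of the rounding grid\<close>

lemma floor_cases_within_one:
  fixes x y :: real
  assumes "x \<le> y" "y \<le> x + 1"
  shows "\<exists>b\<in>{0, 1::nat}. real_of_int \<lfloor>y\<rfloor> = real_of_int \<lfloor>x\<rfloor> + real b"
proof -
  have "\<lfloor>y\<rfloor> = \<lfloor>x\<rfloor> \<or> \<lfloor>y\<rfloor> = \<lfloor>x\<rfloor> + 1"
    using floor_mono[OF assms(1)] floor_mono[OF assms(2)] by simp linarith
  then show ?thesis by auto
qed

context
  fixes \<tau> \<sigma> m :: real
  assumes \<tau>: "\<tau> > 0" and \<sigma>: "\<sigma> > 0"
begin

lemma dyadic_floor_bounds:
  "\<sigma> / (2 * sqrt 2) \<le> 2 powr real_of_int \<lfloor>log 2 (\<sigma> / sqrt 2)\<rfloor>"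
  "2 powr real_of_int \<lfloor>log 2 (\<sigma> / sqrt 2)\<rfloor> \<le> \<sigma> / sqrt 2"
proof -
  let ?L = "log 2 (\<sigma> / sqrt 2)"
  have p: "2 powr ?L = \<sigma> / sqrt 2" using \<sigma> by simp
  have "2 powr real_of_int \<lfloor>?L\<rfloor> \<le> 2 powr ?L" by (intro powr_mono) auto
  then show "2 powr real_of_int \<lfloor>?L\<rfloor> \<le> \<sigma> / sqrt 2" unfolding p .
  have "2 powr (?L - 1) \<le> 2 powr real_of_int \<lfloor>?L\<rfloor>" by (intro powr_mono) linarith+
  moreover have "2 powr (?L - 1) = \<sigma> / (2 * sqrt 2)" by (simp only: powr_diff p) simp
  ultimately show "\<sigma> / (2 * sqrt 2) \<le> 2 powr real_of_int \<lfloor>?L\<rfloor>" by simp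
qed

lemma sqrt2_bounds: "sqrt 2 \<ge> 1.4" "sqrt 2 \<le> (1.42 :: real)"
  by (rule real_le_rsqrt, simp add: power2_eq_square) (rule real_le_lsqrt, simp_all add: power2_eq_square)

text \<open>The width is at most \<open>2 * \<tau> * \<sigma> / sqrt 2\<close>, and a good label is
  at most one width away from the left end of the window. The factor 2 leaves room for the offset
  \<open>\<tau> * \<sigma> / 8\<close> of that end.\<close>

lemma good_labels_close:
  assumes "t \<in> good_labels \<tau> \<sigma> m"
  shows "\<bar>t - m\<bar> \<le> 2 * \<tau> * \<sigma>"
proof -
  obtain a b where ab: "a \<in> {0, 1}" "b \<in> {0, 1}" "t = good_label \<tau> \<sigma> m a b"
    using assms by (auto simp: good_labels_def)
  define D where "D = 2 powr real_of_int \<lfloor>log 2 (\<sigma> / sqrt 2)\<rfloor>"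
  define w where "w = \<tau> * 2 powr (real_of_int \<lfloor>log 2 (\<sigma> / sqrt 2)\<rfloor> + real a)"
  define x where "x = (m - \<tau> * \<sigma> / 8) / w"
  have w0: "w > 0" using \<tau> by (simp add: w_def)
  have "D \<le> \<sigma> / sqrt 2" unfolding D_def by (rule dyadic_floor_bounds)
  also have "\<dots> \<le> \<sigma> / 1.4" using \<sigma> sqrt2_bounds by (intro divide_left_mono) auto
  finally have D: "D \<le> \<sigma> / 1.4" .
  have "w = \<tau> * (D * 2 powr real a)" by (simp add: w_def D_def powr_add)
  also have "2 powr real a \<le> (2 :: real)" using ab by auto
  finally have "w \<le> \<tau> * (D * 2)" using \<tau> by (simp add: D_def)
  also have "\<dots> \<le> \<tau> * (\<sigma> / 1.4 * 2)" using D \<tau> by (intro mult_left_mono mult_right_mono) auto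
  finally have w: "w \<le> 1.5 * (\<tau> * \<sigma>)"
    using mult_pos_pos[OF \<tau> \<sigma>] by (simp add: field_simps)
  have t: "t = w * (real_of_int \<lfloor>x\<rfloor> + real b)"
    unfolding ab(3) good_label_def Let_def w_def x_def by simp
  have "\<bar>real_of_int \<lfloor>x\<rfloor> + real b - x\<bar> \<le> 1" using ab(2) by auto linarith+
  then have "\<bar>w * (real_of_int \<lfloor>x\<rfloor> + real b - x)\<bar> \<le> w"
    using w0 by (simp add: abs_mult mult_left_le)
  moreover have "w * x = m - \<tau> * \<sigma> / 8" using w0 by (simp add: x_def)
  ultimately have "\<bar>t - (m - \<tau> * \<sigma> / 8)\<bar> \<le> w" by (simp add: t algebra_simps)
  then have "\<bar>t - m\<bar> \<le> 1.5 * (\<tau> * \<sigma>) + (\<tau> * \<sigma>) / 8"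
    using w mult_pos_pos[OF \<tau> \<sigma>] by linarith
  then show ?thesis using mult_pos_pos[OF \<tau> \<sigma>] by linarith
qed

lemma rounded_in_good_labels:
  assumes y: "\<bar>y - m\<bar> \<le> \<tau> * \<sigma> / 8" and s: "\<sigma> / sqrt 2 \<le> s" "s \<le> 2 * (\<sigma> / sqrt 2)"
  shows "grid_width \<tau> s * real_of_int \<lfloor>y / grid_width \<tau> s\<rfloor> \<in> good_labels \<tau> \<sigma> m"
proof -
  let ?L = "log 2 (\<sigma> / sqrt 2)"
  have s0: "\<sigma> / sqrt 2 > 0" using \<sigma> by simp
  have "?L \<le> log 2 s" using s s0 by (simp add: log_le_cancel_iff)
  moreover have "log 2 s \<le> log 2 (2 * (\<sigma> / sqrt 2))" using s s0 by (subst log_le_cancel_iff) auto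
  then have "log 2 s \<le> ?L + 1" using s0 \<sigma> by (subst (asm) log_mult) auto
  ultimately obtain a where a: "a \<in> {0, 1::nat}" "real_of_int \<lfloor>log 2 s\<rfloor> = real_of_int \<lfloor>?L\<rfloor> + real a"
    using floor_cases_within_one by blast
  define w where "w = grid_width \<tau> s"
  have weq: "w = \<tau> * 2 powr (real_of_int \<lfloor>?L\<rfloor> + real a)" by (simp add: w_def grid_width_def a(2))
  have w0: "w > 0" using \<tau> by (simp add: weq)
  \<comment> \<open>The window of admissible means has length \<open>\<tau> * \<sigma> / 4\<close>.
    It is no longer than one grid width and so meets at most two cells.\<close>
  have "\<sigma> / 4 \<le> \<sigma> / (2 * sqrt 2)" using \<sigma> sqrt2_bounds by (intro divide_left_mono) auto
  also have "\<dots> \<le> 2 powr real_of_int \<lfloor>?L\<rfloor>" by (rule dyadic_floor_bounds)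
  also have "\<dots> \<le> 2 powr (real_of_int \<lfloor>?L\<rfloor> + real a)" by (intro powr_mono) auto
  finally have "\<tau> * (\<sigma> / 4) \<le> w" unfolding weq using \<tau> by (intro mult_left_mono) auto
  then have w: "\<tau> * \<sigma> / 4 \<le> w" by simp
  have "y \<le> (m - \<tau> * \<sigma> / 8) + w" "m - \<tau> * \<sigma> / 8 \<le> y" using y w by linarith+
  then have "y / w \<le> (m - \<tau> * \<sigma> / 8) / w + 1" "(m - \<tau> * \<sigma> / 8) / w \<le> y / w"
    using divide_right_mono[of y "(m - \<tau> * \<sigma> / 8) + w" w] divide_right_mono[of "m - \<tau> * \<sigma> / 8" y w] w0
    by (simp_all add: add_divide_distrib)
  then obtain b where b: "b \<in> {0, 1::nat}"
      "real_of_int \<lfloor>y / w\<rfloor> = real_of_int \<lfloor>(m - \<tau> * \<sigma> / 8) / w\<rfloor> + real b"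
    using floor_cases_within_one by blast
  have "w * real_of_int \<lfloor>y / w\<rfloor> = good_label \<tau> \<sigma> m a b"
    unfolding good_label_def Let_def weq[symmetric] b(2) ..
  then show ?thesis using a b unfolding w_def[symmetric] good_labels_def by auto
qed

text \<open>The empirical variance is the second moment around \<open>m\<close> minus the squared
  error of the mean. The former is within a quarter of \<open>\<sigma>\<^sup>2\<close>, the latter
  is negligible by \<open>\<tau> \<le> 1 / 8\<close>, so the block deviation is within a factor
  \<open>sqrt 2\<close> of \<open>\<sigma>\<close>.\<close>

lemma block_label_good:
  assumes B: "B > 0" and \<tau>8: "\<tau> \<le> 1 / 8"
    and mean: "\<bar>\<Sum>j<B. X (i * B + j) - m\<bar> \<le> real B * (\<tau> * \<sigma> / 8)"
    and var: "\<bar>\<Sum>j<B. (X (i * B + j) - m)\<^sup>2 - \<sigma>\<^sup>2\<bar> \<le> real B * (\<sigma>\<^sup>2 / 4)"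
  shows "block_label B \<tau> X i \<in> good_labels \<tau> \<sigma> m"
proof -
  define y where "y = block_mean B X i"
  define S where "S = (\<Sum>j<B. (X (i * B + j))\<^sup>2) / real B"
  define V where "V = (\<Sum>j<B. (X (i * B + j) - m)\<^sup>2) / real B"
  have B0: "real B > 0" using B by simp
  have "(\<Sum>j<B. X (i * B + j) - m) = real B * (y - m)"
    using B0 by (simp add: sum_subtractf y_def block_mean_def field_simps)
  then have y: "\<bar>y - m\<bar> \<le> \<tau> * \<sigma> / 8" using mean B0 by (simp add: abs_mult)
  have "(\<Sum>j<B. (X (i * B + j) - m)\<^sup>2 - \<sigma>\<^sup>2) = real B * (V - \<sigma>\<^sup>2)"
    using B0 by (simp add: sum_subtractf V_def field_simps)
  then have V: "\<bar>V - \<sigma>\<^sup>2\<bar> \<le> \<sigma>\<^sup>2 / 4" using var B0 by (simp add: abs_mult)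
  have "(\<Sum>j<B. (X (i * B + j) - m)\<^sup>2) =
      (\<Sum>j<B. (X (i * B + j))\<^sup>2) - 2 * m * (\<Sum>j<B. X (i * B + j)) + real B * m\<^sup>2"
    by (simp add: power2_diff sum.distrib sum_subtractf sum_distrib_left algebra_simps)
  then have "V = S - 2 * m * y + m\<^sup>2"
    using B0 by (simp add: V_def S_def y_def block_mean_def add_divide_distrib diff_divide_distrib)
  then have SV: "S - y\<^sup>2 = V - (y - m)\<^sup>2" by (simp add: power2_diff algebra_simps)
  have "\<tau> * \<sigma> \<le> 1 / 8 * \<sigma>" using \<tau>8 \<sigma> by (intro mult_right_mono) auto
  then have "\<bar>y - m\<bar> \<le> \<sigma> / 64" using y by linarith
  then have "(y - m)\<^sup>2 \<le> (\<sigma> / 64)\<^sup>2" using \<sigma> by (simp add: abs_le_square_iff[symmetric])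
  then have "(y - m)\<^sup>2 \<le> \<sigma>\<^sup>2 / 4096" by (simp add: power_divide)
  moreover have "0 \<le> (y - m)\<^sup>2" "0 \<le> \<sigma>\<^sup>2" by simp_all
  ultimately have ym: "0 \<le> (y - m)\<^sup>2" "(y - m)\<^sup>2 \<le> \<sigma>\<^sup>2 / 4" by linarith+
  have S: "\<sigma>\<^sup>2 / 2 \<le> S - y\<^sup>2" "S - y\<^sup>2 \<le> 2 * \<sigma>\<^sup>2"
    unfolding SV using V ym by linarith+
  have s1: "sqrt (\<sigma>\<^sup>2 / 2) = \<sigma> / sqrt 2" using \<sigma> by (simp add: real_sqrt_divide)
  have s2: "sqrt (2 * \<sigma>\<^sup>2) = 2 * (\<sigma> / sqrt 2)"
    using \<sigma> by (simp add: real_sqrt_mult field_simps)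
  have sd: "block_sd B X i = sqrt (S - y\<^sup>2)" by (simp add: block_sd_def S_def y_def)
  have "\<sigma> / sqrt 2 \<le> block_sd B X i" using real_sqrt_le_mono[OF S(1)] unfolding sd s1 .
  moreover have "block_sd B X i \<le> 2 * (\<sigma> / sqrt 2)" using real_sqrt_le_mono[OF S(2)] unfolding sd s2 .
  ultimately show ?thesis
    unfolding block_label_def Let_def y_def[symmetric] by (intro rounded_in_good_labels y)
qed

end

section \<open>Most blocks are good with high probability\<close>

lemma square_diff_squares: "(z\<^sup>2 - s\<^sup>2)\<^sup>2 = z ^ 4 - 2 * s\<^sup>2 * z\<^sup>2 + s ^ 4" for z s :: real
  by (simp add: power2_diff power_mult[symmetric])

lemma measurable_coordinate:
  assumes "sets D = sets borel" "l \<in> N"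
  shows "(\<lambda>X. X l) \<in> borel_measurable (PiM N (\<lambda>_. D))"
  using measurable_component_singleton[OF assms(2), of "\<lambda>_. D"]
  by (simp add: measurable_cong_sets[OF refl assms(1)])

text \<open>Chebyshev's inequality twice: the deviations, of variance
  \<open>\<sigma>\<^sup>2\<close>, contribute \<open>64 / \<tau>\<^sup>2\<close>, and the centred
  squares, whose variance the fourth moment bounds by \<open>\<zeta> * \<sigma> ^ 4\<close>,
  contribute \<open>16 * \<zeta>\<close>. The product has \<open>N \<ge> n\<close> factors because
  both samples will live on one space.\<close>

lemma block_label_bad_prob:
  fixes D :: "real measure"
  assumes "prob_space D" and sD: "sets D = sets borel"
    and \<sigma>: "\<sigma> > 0" and \<tau>: "0 < \<tau>" "\<tau> \<le> 1 / 8" and B: "B > 0" and i: "i < n div B" and n: "n \<le> N"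
    and mean: "integrable D (\<lambda>x. x)" "(\<integral>x. x \<partial>D) = m"
    and var: "integrable D (\<lambda>x. (x - m)\<^sup>2)" "(\<integral>x. (x - m)\<^sup>2 \<partial>D) = \<sigma>\<^sup>2"
    and m4: "integrable D (\<lambda>x. (x - m) ^ 4)" "(\<integral>x. (x - m) ^ 4 \<partial>D) \<le> \<zeta> * \<sigma> ^ 4"
  shows "measure (PiM {..<N} (\<lambda>_. D)) {X \<in> space (PiM {..<N} (\<lambda>_. D)). block_label B \<tau> X i \<notin> good_labels \<tau> \<sigma> m}
    \<le> (64 / \<tau>\<^sup>2 + 16 * \<zeta>) / real B"
proof -
  interpret D: prob_space D by fact
  note [measurable_cong] = sD
  let ?P = "PiM {..<N} (\<lambda>_. D)"
  interpret P: prob_space ?P by (intro prob_space_PiM assms)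
  define I where "I = (\<lambda>j. i * B + j) ` {..<B}"
  have I: "I \<subseteq> {..<N}" using block_index_less[OF i] n by (force simp: I_def)
  have inj: "inj_on (\<lambda>j. i * B + j) {..<B}" by (auto simp: inj_on_def)
  have cI: "card I = B" unfolding I_def by (simp add: card_image inj)
  have sumI: "(\<Sum>l\<in>I. f l) = (\<Sum>j<B. f (i * B + j))" for f :: "nat \<Rightarrow> real"
    unfolding I_def by (simp add: sum.reindex[OF inj])
  have B0: "real B > 0" using B by simp
  have sq4: "((x - m)\<^sup>2 - \<sigma>\<^sup>2)\<^sup>2 = (x - m) ^ 4 - 2 * \<sigma>\<^sup>2 * (x - m)\<^sup>2 + \<sigma> ^ 4" for x
    by (rule square_diff_squares)
  let ?A1 = "{X \<in> space ?P. real B * (\<tau> * \<sigma> / 8) \<le> \<bar>\<Sum>l\<in>I. X l - m\<bar>}"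
  let ?A2 = "{X \<in> space ?P. real B * (\<sigma>\<^sup>2 / 4) \<le> \<bar>\<Sum>l\<in>I. (X l - m)\<^sup>2 - \<sigma>\<^sup>2\<bar>}"
  have comp: "(\<lambda>X. X l) \<in> borel_measurable ?P" if "l \<in> I" for l
    using that I by (intro measurable_coordinate sD) auto
  have sets: "?A1 \<in> sets ?P" "?A2 \<in> sets ?P"
  proof -
    have [measurable]: "(\<lambda>X. \<Sum>l\<in>I. X l - m) \<in> borel_measurable ?P" "(\<lambda>X. \<Sum>l\<in>I. (X l - m)\<^sup>2 - \<sigma>\<^sup>2) \<in> borel_measurable ?P"
      using comp by (auto intro!: borel_measurable_sum borel_measurable_diff borel_measurable_power)
    show "?A1 \<in> sets ?P" "?A2 \<in> sets ?P" by measurable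
  qed
  have "measure ?P ?A1 \<le> real (card I) * (\<integral>x. (x - m)\<^sup>2 \<partial>D) / (real B * (\<tau> * \<sigma> / 8))\<^sup>2"
  proof (rule Chebyshev_coordinates[OF assms(1,2)])
    show "integrable D (\<lambda>x. (x - m)\<^sup>2)" by (rule var)
    show "(\<integral>x. x - m \<partial>D) = 0" using mean D.prob_space by simp
  qed (use I B0 \<sigma> \<tau> in auto)
  also have "\<dots> = 64 / \<tau>\<^sup>2 / real B"
    unfolding cI var using B0 \<tau> \<sigma> by (simp add: power2_eq_square field_simps)
  finally have A1: "measure ?P ?A1 \<le> 64 / \<tau>\<^sup>2 / real B" .
  have "(\<integral>x. ((x - m)\<^sup>2 - \<sigma>\<^sup>2)\<^sup>2 \<partial>D) = (\<integral>x. (x - m) ^ 4 \<partial>D) - 2 * \<sigma>\<^sup>2 * \<sigma>\<^sup>2 + \<sigma> ^ 4"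
    unfolding sq4 using var m4 D.prob_space by simp
  also have "2 * \<sigma>\<^sup>2 * \<sigma>\<^sup>2 = 2 * \<sigma> ^ 4" by (simp add: power2_eq_square power4_eq_xxxx)
  also have "(\<integral>x. (x - m) ^ 4 \<partial>D) - 2 * \<sigma> ^ 4 + \<sigma> ^ 4 \<le> \<zeta> * \<sigma> ^ 4"
    using m4(2) zero_le_power[of \<sigma> 4] \<sigma> by linarith
  finally have v4: "(\<integral>x. ((x - m)\<^sup>2 - \<sigma>\<^sup>2)\<^sup>2 \<partial>D) \<le> \<zeta> * \<sigma> ^ 4" .
  have "measure ?P ?A2 \<le> real (card I) * (\<integral>x. ((x - m)\<^sup>2 - \<sigma>\<^sup>2)\<^sup>2 \<partial>D) / (real B * (\<sigma>\<^sup>2 / 4))\<^sup>2"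
  proof (rule Chebyshev_coordinates[OF assms(1,2)])
    show "integrable D (\<lambda>x. ((x - m)\<^sup>2 - \<sigma>\<^sup>2)\<^sup>2)" unfolding sq4 using var m4 by auto
    show "(\<integral>x. (x - m)\<^sup>2 - \<sigma>\<^sup>2 \<partial>D) = 0" using var D.prob_space by simp
  qed (use I B0 \<sigma> in auto)
  also have "\<dots> \<le> real B * (\<zeta> * \<sigma> ^ 4) / (real B * (\<sigma>\<^sup>2 / 4))\<^sup>2"
    unfolding cI using v4 by (intro divide_right_mono mult_left_mono) auto
  also have "\<dots> = 16 * \<zeta> / real B"
    using B0 \<sigma> by (simp add: power2_eq_square power4_eq_xxxx field_simps)
  finally have A2: "measure ?P ?A2 \<le> 16 * \<zeta> / real B" .
  have "{X \<in> space ?P. block_label B \<tau> X i \<notin> good_labels \<tau> \<sigma> m} \<subseteq> ?A1 \<union> ?A2"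
  proof
    fix X assume X: "X \<in> {X \<in> space ?P. block_label B \<tau> X i \<notin> good_labels \<tau> \<sigma> m}"
    show "X \<in> ?A1 \<union> ?A2"
    proof (rule ccontr)
      assume "X \<notin> ?A1 \<union> ?A2"
      then have "block_label B \<tau> X i \<in> good_labels \<tau> \<sigma> m"
        using X by (intro block_label_good[OF \<tau>(1) \<sigma> B \<tau>(2)]) (auto simp: sumI)
      then show False using X by simp
    qed
  qed
  then have "measure ?P {X \<in> space ?P. block_label B \<tau> X i \<notin> good_labels \<tau> \<sigma> m} \<le> measure ?P (?A1 \<union> ?A2)"
    using sets by (intro P.finite_measure_mono) auto
  also have "\<dots> \<le> measure ?P ?A1 + measure ?P ?A2" using sets by (intro measure_Un_le)
  finally show ?thesis using A1 A2 by (simp add: add_divide_distrib)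
qed

text \<open>Markov's inequality for the expected number of bad blocks. A tenth of the blocks is the
  proportion of bad labels that the sampler will tolerate.\<close>

lemma many_blocks_good:
  fixes D :: "real measure"
  assumes "prob_space D" and sD: "sets D = sets borel"
    and \<sigma>: "\<sigma> > 0" and \<tau>: "0 < \<tau>" "\<tau> \<le> 1 / 8" and B: "B > 0" and n: "n \<le> N" and k: "n div B > 0"
    and mean: "integrable D (\<lambda>x. x)" "(\<integral>x. x \<partial>D) = m"
    and var: "integrable D (\<lambda>x. (x - m)\<^sup>2)" "(\<integral>x. (x - m)\<^sup>2 \<partial>D) = \<sigma>\<^sup>2"
    and m4: "integrable D (\<lambda>x. (x - m) ^ 4)" "(\<integral>x. (x - m) ^ 4 \<partial>D) \<le> \<zeta> * \<sigma> ^ 4"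
  defines "bad \<equiv> \<lambda>X. \<Sum>i<n div B. if block_label B \<tau> X i \<in> good_labels \<tau> \<sigma> m then 0 else 1 :: real"
  shows "bad \<in> borel_measurable (PiM {..<N} (\<lambda>_. D))"
    and "measure (PiM {..<N} (\<lambda>_. D)) {X \<in> space (PiM {..<N} (\<lambda>_. D)). real (n div B) / 10 \<le> bad X}
      \<le> 10 * (64 / \<tau>\<^sup>2 + 16 * \<zeta>) / real B"
proof -
  let ?P = "PiM {..<N} (\<lambda>_. D)"
  let ?G = "good_labels \<tau> \<sigma> m" and ?k = "n div B"
  interpret P: prob_space ?P by (intro prob_space_PiM assms)
  have sP: "sets ?P = sets (datasets N)" by (intro sets_PiM_cong) (auto simp: sD)
  have G: "?G \<in> sets borel" by (intro borel_closed finite_imp_closed finite_good_labels)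
  have lab: "(\<lambda>X. block_label B \<tau> X i) \<in> borel_measurable ?P" if "i < ?k" for i
  proof -
    have "i < N div B" using that n div_le_mono[of n N B] by simp
    then show ?thesis using block_label_measurable[of i N B \<tau>] by (simp add: measurable_cong_sets[OF sP])
  qed
  have set: "{X \<in> space ?P. block_label B \<tau> X i \<notin> ?G} \<in> sets ?P" if "i < ?k" for i
  proof -
    have [measurable]: "(\<lambda>X. block_label B \<tau> X i) \<in> borel_measurable ?P" "?G \<in> sets borel" using lab that G by auto
    show ?thesis by measurable
  qed
  have bad: "bad X = (\<Sum>i<?k. indicator {X \<in> space ?P. block_label B \<tau> X i \<notin> ?G} X)" if "X \<in> space ?P" for X
    unfolding bad_def using that by (intro sum.cong) auto
  have int: "integrable ?P (\<lambda>X. \<Sum>i<?k. indicator {X \<in> space ?P. block_label B \<tau> X i \<notin> ?G} X :: real)"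
    using set by (intro Bochner_Integration.integrable_sum integrable_real_indicator) (auto simp: P.emeasure_eq_measure)
  have intb: "integrable ?P bad"
    using int bad by (subst Bochner_Integration.integrable_cong[OF refl]) auto
  then show "bad \<in> borel_measurable ?P" by auto
  have "(\<integral>X. bad X \<partial>?P) = (\<integral>X. (\<Sum>i<?k. indicator {X \<in> space ?P. block_label B \<tau> X i \<notin> ?G} X) \<partial>?P)"
    using bad by (intro Bochner_Integration.integral_cong) auto
  also have "\<dots> = (\<Sum>i<?k. \<integral>X. indicator {X \<in> space ?P. block_label B \<tau> X i \<notin> ?G} X \<partial>?P)"
    using set by (intro Bochner_Integration.integral_sum integrable_real_indicator) (auto simp: P.emeasure_eq_measure)
  also have "\<dots> = (\<Sum>i<?k. measure ?P {X \<in> space ?P. block_label B \<tau> X i \<notin> ?G})"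
    using set by (intro sum.cong refl) (simp add: Int_def conj_commute)
  also have "\<dots> \<le> (\<Sum>i<?k. (64 / \<tau>\<^sup>2 + 16 * \<zeta>) / real B)"
    by (intro sum_mono block_label_bad_prob[where n = n] assms) auto
  finally have E: "(\<integral>X. bad X \<partial>?P) \<le> real ?k * ((64 / \<tau>\<^sup>2 + 16 * \<zeta>) / real B)" by simp
  have "measure ?P {X \<in> space ?P. real ?k / 10 \<le> bad X} \<le> (\<integral>X. bad X \<partial>?P) / (real ?k / 10)"
    using k by (intro integral_Markov_inequality_measure[where A = "{}"] intb)
      (auto simp: bad_def intro!: AE_I2 sum_nonneg)
  also have "\<dots> \<le> real ?k * ((64 / \<tau>\<^sup>2 + 16 * \<zeta>) / real B) / (real ?k / 10)"
    using E by (intro divide_right_mono) auto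
  also have "\<dots> = 10 * (64 / \<tau>\<^sup>2 + 16 * \<zeta>) / real B" using k by simp
  finally show "measure ?P {X \<in> space ?P. real ?k / 10 \<le> bad X} \<le> 10 * (64 / \<tau>\<^sup>2 + 16 * \<zeta>) / real B" .
qed

section \<open>Differentiating moments\<close>

lemma exp_remainder_bound:
  fixes y :: real
  shows "\<bar>exp y - 1 - y\<bar> \<le> y\<^sup>2 * exp \<bar>y\<bar>"
proof -
  obtain t where t: "\<bar>t\<bar> \<le> \<bar>y\<bar>" "exp y = (\<Sum>k<2. y ^ k / fact k) + exp t / fact 2 * y ^ 2"
    using Maclaurin_exp_le[of y 2] by auto
  have "exp y - 1 - y = exp t / 2 * y\<^sup>2" using t(2) by (simp add: numeral_2_eq_2)
  then have "\<bar>exp y - 1 - y\<bar> = exp t / 2 * y\<^sup>2" by (simp only: abs_mult) simp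
  also have "exp t / 2 \<le> exp \<bar>y\<bar>"
    using t(1) exp_gt_zero[of t] exp_le_cancel_iff[of t "\<bar>y\<bar>"] by linarith
  then have "exp t / 2 * y\<^sup>2 \<le> exp \<bar>y\<bar> * y\<^sup>2" by (intro mult_right_mono) auto
  finally show ?thesis by (simp add: mult.commute)
qed

lemma abs_power_le_exp:
  fixes x :: real
  assumes "r > 0"
  shows "\<bar>x\<bar> ^ k \<le> fact k / r ^ k * exp (r * \<bar>x\<bar>)"
proof -
  have "(r * \<bar>x\<bar>) ^ k / fact k \<le> exp (r * \<bar>x\<bar>)"
  proof -
    have "(r * \<bar>x\<bar>) ^ k / fact k \<le> (\<Sum>j<Suc k. (r * \<bar>x\<bar>) ^ j / fact j)"
      using assms by (intro member_le_sum) auto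
    also have "\<dots> \<le> exp (r * \<bar>x\<bar>)"
    proof -
      obtain t where "exp (r * \<bar>x\<bar>) = (\<Sum>j<Suc k. (r * \<bar>x\<bar>) ^ j / fact j) + exp t / fact (Suc k) * (r * \<bar>x\<bar>) ^ Suc k"
        using Maclaurin_exp_le[of "r * \<bar>x\<bar>" "Suc k"] by auto
      then show ?thesis using assms by simp
    qed
    finally show ?thesis .
  qed
  then show ?thesis using assms by (simp add: power_mult_distrib field_simps)
qed

context
  fixes \<mu> :: "real measure"
  assumes sets_mu [measurable_cong]: "sets \<mu> = sets borel"
begin

text \<open>The power of \<open>\<bar>x\<bar>\<close> is absorbed by
  \<open>exp ((r - s) * \<bar>x\<bar>)\<close>; what is left,
  \<open>exp (\<theta> * x + r * \<bar>x\<bar>)\<close>, is one of the two endpoint exponentials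
  according to the sign of \<open>x\<close>.\<close>

lemma integrable_moment_abs:
  assumes r: "r > 0" and ends: "\<theta> - r \<in> natural_params \<mu>" "\<theta> + r \<in> natural_params \<mu>" and s: "s < r" "0 \<le> s"
  shows "integrable \<mu> (\<lambda>x. \<bar>x\<bar> ^ k * exp (\<theta> * x + s * \<bar>x\<bar>))"
proof (rule Bochner_Integration.integrable_bound)
  show "integrable \<mu> (\<lambda>x. (fact k / (r - s) ^ k) * (exp ((\<theta> - r) * x) + exp ((\<theta> + r) * x)))"
    using ends by (auto simp: natural_params_def)
  have "\<bar>x\<bar> ^ k * exp (\<theta> * x + s * \<bar>x\<bar>) \<le> (fact k / (r - s) ^ k) * (exp ((\<theta> - r) * x) + exp ((\<theta> + r) * x))" for x
  proof -
    have "\<bar>x\<bar> ^ k * exp (\<theta> * x + s * \<bar>x\<bar>) \<le> (fact k / (r - s) ^ k * exp ((r - s) * \<bar>x\<bar>)) * exp (\<theta> * x + s * \<bar>x\<bar>)"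
      using s by (intro mult_right_mono abs_power_le_exp) auto
    also have "\<dots> = (fact k / (r - s) ^ k) * exp (\<theta> * x + r * \<bar>x\<bar>)"
      by (simp add: exp_add[symmetric] algebra_simps)
    also have "\<dots> \<le> (fact k / (r - s) ^ k) * (exp ((\<theta> - r) * x) + exp ((\<theta> + r) * x))"
      using s by (intro mult_left_mono) (cases "x \<ge> 0"; auto simp: algebra_simps)+
    finally show ?thesis .
  qed
  then show "AE x in \<mu>. norm (\<bar>x\<bar> ^ k * exp (\<theta> * x + s * \<bar>x\<bar>)) \<le>
      norm ((fact k / (r - s) ^ k) * (exp ((\<theta> - r) * x) + exp ((\<theta> + r) * x)))"
    using s by (auto simp: abs_mult)
qed measurable

lemma integrable_moment:
  assumes r: "r > 0" and ends: "\<theta> - r \<in> natural_params \<mu>" "\<theta> + r \<in> natural_params \<mu>" and [measurable]: "E \<in> sets borel"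
  shows "integrable \<mu> (\<lambda>x. indicator E x * (x ^ k * exp (\<theta> * x)))"
proof (rule Bochner_Integration.integrable_bound)
  show "integrable \<mu> (\<lambda>x. \<bar>x\<bar> ^ k * exp (\<theta> * x + 0 * \<bar>x\<bar>))"
    by (rule integrable_moment_abs[OF r ends]) (use r in auto)
qed (auto simp: abs_mult power_abs split: split_indicator)

text \<open>Second-order remainder: the difference quotient is off by at most
  \<open>C * \<bar>h\<bar>\<close>, where the moment \<open>C\<close> carries the exponential slack
  \<open>r / 2\<close> that absorbs \<open>exp \<bar>h * x\<bar>\<close>.\<close>

lemma moment_has_derivative:
  assumes r: "r > 0" and ends: "\<theta> - r \<in> natural_params \<mu>" "\<theta> + r \<in> natural_params \<mu>" and E [measurable]: "E \<in> sets borel"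
  shows "(moment_on \<mu> E k has_real_derivative moment_on \<mu> E (Suc k) \<theta>) (at \<theta>)"
proof -
  define C where "C = (\<integral>x. \<bar>x\<bar> ^ (k + 2) * exp (\<theta> * x + (r / 2) * \<bar>x\<bar>) \<partial>\<mu>)"
  have intC: "integrable \<mu> (\<lambda>x. \<bar>x\<bar> ^ (k + 2) * exp (\<theta> * x + (r / 2) * \<bar>x\<bar>))"
    using r by (intro integrable_moment_abs[OF r ends]) auto
  have bound: "\<bar>(moment_on \<mu> E k (\<theta> + h) - moment_on \<mu> E k \<theta>) / h - moment_on \<mu> E (Suc k) \<theta>\<bar> \<le> C * \<bar>h\<bar>"
    if h: "\<bar>h\<bar> \<le> r / 2" "h \<noteq> 0" for h
  proof -
    have sub: "\<theta> + h - r / 2 \<in> natural_params \<mu>" "\<theta> + h + r / 2 \<in> natural_params \<mu>"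
      by (rule natural_params_interval[OF sets_mu ends]; use h in linarith)+
    have i: "integrable \<mu> (\<lambda>x. indicator E x * (x ^ k * exp ((\<theta> + h) * x)))"
      "integrable \<mu> (\<lambda>x. indicator E x * (x ^ k * exp (\<theta> * x)))"
      "integrable \<mu> (\<lambda>x. indicator E x * (x ^ Suc k * exp (\<theta> * x)))"
      by (rule integrable_moment[of "r / 2", OF _ sub E], use r in simp)
         (rule integrable_moment[OF r ends E])+
    let ?f = "\<lambda>x. indicator E x * (x ^ k * exp ((\<theta> + h) * x)) - indicator E x * (x ^ k * exp (\<theta> * x))
        - h * (indicator E x * (x ^ Suc k * exp (\<theta> * x)))"
    have eq: "moment_on \<mu> E k (\<theta> + h) - moment_on \<mu> E k \<theta> - h * moment_on \<mu> E (Suc k) \<theta> = (\<integral>x. ?f x \<partial>\<mu>)"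
      unfolding moment_on_def using i by simp
    have pt: "\<bar>?f x\<bar> \<le> h\<^sup>2 * (\<bar>x\<bar> ^ (k + 2) * exp (\<theta> * x + (r / 2) * \<bar>x\<bar>))" for x
    proof -
      have "?f x = indicator E x * (x ^ k * exp (\<theta> * x) * (exp (h * x) - 1 - h * x))"
        by (simp add: exp_add distrib_right algebra_simps)
      then have "\<bar>?f x\<bar> = indicator E x * (\<bar>x\<bar> ^ k * exp (\<theta> * x) * \<bar>exp (h * x) - 1 - h * x\<bar>)"
        by (simp add: abs_mult power_abs)
      also have "\<dots> \<le> \<bar>x\<bar> ^ k * exp (\<theta> * x) * \<bar>exp (h * x) - 1 - h * x\<bar>"
        by (auto split: split_indicator)
      also have "\<dots> \<le> \<bar>x\<bar> ^ k * exp (\<theta> * x) * ((h * x)\<^sup>2 * exp \<bar>h * x\<bar>)"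
        by (intro mult_left_mono exp_remainder_bound) auto
      also have "\<dots> \<le> \<bar>x\<bar> ^ k * exp (\<theta> * x) * ((h * x)\<^sup>2 * exp ((r / 2) * \<bar>x\<bar>))"
        unfolding abs_mult using h(1) by (intro mult_left_mono iffD2[OF exp_le_cancel_iff] mult_right_mono) auto
      also have "\<dots> = h\<^sup>2 * (\<bar>x\<bar> ^ (k + 2) * exp (\<theta> * x + (r / 2) * \<bar>x\<bar>))"
        by (simp add: exp_add power_mult_distrib power_add power2_eq_square)
      finally show ?thesis .
    qed
    have "\<bar>\<integral>x. ?f x \<partial>\<mu>\<bar> \<le> (\<integral>x. \<bar>?f x\<bar> \<partial>\<mu>)" by (rule integral_abs_bound)
    also have "\<dots> \<le> (\<integral>x. h\<^sup>2 * (\<bar>x\<bar> ^ (k + 2) * exp (\<theta> * x + (r / 2) * \<bar>x\<bar>)) \<partial>\<mu>)"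
      using pt by (intro integral_mono integrable_abs Bochner_Integration.integrable_diff i integrable_mult_right intC)
    also have "\<dots> = h\<^sup>2 * C" by (simp add: C_def)
    finally have "\<bar>moment_on \<mu> E k (\<theta> + h) - moment_on \<mu> E k \<theta> - h * moment_on \<mu> E (Suc k) \<theta>\<bar> \<le> h\<^sup>2 * C"
      by (simp add: eq)
    then have "\<bar>moment_on \<mu> E k (\<theta> + h) - moment_on \<mu> E k \<theta> - h * moment_on \<mu> E (Suc k) \<theta>\<bar> / \<bar>h\<bar> \<le> h\<^sup>2 * C / \<bar>h\<bar>"
      by (intro divide_right_mono) auto
    also have "h\<^sup>2 * C / \<bar>h\<bar> = C * \<bar>h\<bar>"
      using h by (simp add: power2_eq_square abs_if field_simps)
    also have "\<bar>moment_on \<mu> E k (\<theta> + h) - moment_on \<mu> E k \<theta> - h * moment_on \<mu> E (Suc k) \<theta>\<bar> / \<bar>h\<bar> =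
        \<bar>(moment_on \<mu> E k (\<theta> + h) - moment_on \<mu> E k \<theta>) / h - moment_on \<mu> E (Suc k) \<theta>\<bar>"
      using h by (simp add: abs_divide[symmetric] diff_divide_distrib)
    finally show ?thesis .
  qed
  have "((\<lambda>h. (moment_on \<mu> E k (\<theta> + h) - moment_on \<mu> E k \<theta>) / h - moment_on \<mu> E (Suc k) \<theta>) \<longlongrightarrow> 0) (at 0)"
  proof (rule Lim_null_comparison)
    show "\<forall>\<^sub>F h in at 0. norm ((moment_on \<mu> E k (\<theta> + h) - moment_on \<mu> E k \<theta>) / h - moment_on \<mu> E (Suc k) \<theta>) \<le> C * \<bar>h\<bar>"
      unfolding eventually_at using r bound by (intro exI[of _ "r / 2"]) (auto simp: dist_real_def)
    show "((\<lambda>h. C * \<bar>h\<bar>) \<longlongrightarrow> 0) (at 0)"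
      by (intro tendsto_eq_intros) auto
  qed
  then show ?thesis
    unfolding has_field_derivative_def[symmetric] DERIV_def by (simp add: LIM_zero_iff)
qed

end

section \<open>Mean and variance of an exponential family\<close>

text \<open>Hoelder's inequality between first, second and fourth absolute moments gives a mean
  absolute deviation of at least \<open>\<sigma> / sqrt \<zeta>\<close>. Half of it is the mean of
  the positive part, and moving the threshold from \<open>m\<close> to \<open>t\<close> costs at
  most \<open>\<bar>t - m\<bar>\<close>, which is half of that half.\<close>

lemma upper_mean_deviation:
  fixes D :: "real measure"
  assumes "prob_space D" and sD: "sets D = sets borel" and \<sigma>: "\<sigma> > 0" and \<zeta>: "\<zeta> > 0"
    and mean: "integrable D (\<lambda>x. x)" "(\<integral>x. x \<partial>D) = m"
    and var: "integrable D (\<lambda>x. (x - m)\<^sup>2)" "(\<integral>x. (x - m)\<^sup>2 \<partial>D) = \<sigma>\<^sup>2"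
    and m4: "integrable D (\<lambda>x. (x - m) ^ 4)" "(\<integral>x. (x - m) ^ 4 \<partial>D) \<le> \<zeta> * \<sigma> ^ 4"
    and t: "\<bar>t - m\<bar> \<le> \<sigma> / (4 * sqrt \<zeta>)"
  shows "(\<integral>x. indicator {t<..} x * (x - m) \<partial>D) \<ge> \<sigma> / (4 * sqrt \<zeta>)"
proof -
  interpret D: prob_space D by fact
  note [measurable_cong] = sD
  define l where "l = sqrt \<zeta> * \<sigma>"
  have l: "l > 0" "l\<^sup>2 = \<zeta> * \<sigma>\<^sup>2" using \<sigma> \<zeta> by (simp_all add: l_def power_mult_distrib)
  have z: "integrable D (\<lambda>x. x - m)" using mean by simp
  \<comment> \<open>A pointwise form of Hoelder's inequality: the two sides differ by
    \<open>u * (u - l)\<^sup>2 * (u + 2 * l)\<close> with \<open>u = \<bar>x - m\<bar>\<close>. The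
    value \<open>l = sqrt \<zeta> * \<sigma>\<close> maximizes the resulting lower bound on the mean
    of \<open>u\<close>.\<close>
  have pt: "3 * l\<^sup>2 * (x - m)\<^sup>2 - (x - m) ^ 4 \<le> 2 * l ^ 3 * \<bar>x - m\<bar>" for x
  proof -
    define u where "u = \<bar>x - m\<bar>"
    have "2 * l ^ 3 * u - (3 * l\<^sup>2 * u\<^sup>2 - u ^ 4) = u * ((u - l)\<^sup>2 * (u + 2 * l))"
      by (simp add: power2_eq_square power3_eq_cube power4_eq_xxxx algebra_simps)
    moreover have "0 \<le> u * ((u - l)\<^sup>2 * (u + 2 * l))"
      using l by (intro mult_nonneg_nonneg) (auto simp: u_def)
    moreover have "u\<^sup>2 = (x - m)\<^sup>2" "u ^ 4 = (x - m) ^ 4" by (simp_all add: u_def)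
    ultimately show ?thesis unfolding u_def[symmetric] by simp
  qed
  have "3 * l\<^sup>2 * \<sigma>\<^sup>2 - \<zeta> * \<sigma> ^ 4 \<le> (\<integral>x. 3 * l\<^sup>2 * (x - m)\<^sup>2 - (x - m) ^ 4 \<partial>D)"
    using var m4 by simp
  also have "\<dots> \<le> (\<integral>x. 2 * l ^ 3 * \<bar>x - m\<bar> \<partial>D)"
    using var m4 z pt by (intro integral_mono) auto
  also have "\<dots> = 2 * l ^ 3 * (\<integral>x. \<bar>x - m\<bar> \<partial>D)" by simp
  also have "3 * l\<^sup>2 * \<sigma>\<^sup>2 - \<zeta> * \<sigma> ^ 4 = 2 * l\<^sup>2 * \<sigma>\<^sup>2"
    unfolding l(2) by (simp add: power2_eq_square power4_eq_xxxx)
  also have "2 * l ^ 3 * (\<integral>x. \<bar>x - m\<bar> \<partial>D) = 2 * l\<^sup>2 * (l * (\<integral>x. \<bar>x - m\<bar> \<partial>D))"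
    by (simp add: power2_eq_square power3_eq_cube)
  finally have "\<sigma>\<^sup>2 \<le> l * (\<integral>x. \<bar>x - m\<bar> \<partial>D)"
    using l(1) by simp
  then have abs: "\<sigma> / sqrt \<zeta> \<le> (\<integral>x. \<bar>x - m\<bar> \<partial>D)"
    using \<sigma> \<zeta> by (simp add: l_def power2_eq_square field_simps)
  have "(\<integral>x. \<bar>x - m\<bar> \<partial>D) / 2 - \<bar>t - m\<bar> = (\<integral>x. (\<bar>x - m\<bar> + (x - m)) / 2 - \<bar>t - m\<bar> \<partial>D)"
    using z mean D.prob_space by simp
  also have "\<dots> \<le> (\<integral>x. indicator {t<..} x * (x - m) \<partial>D)"
  proof (rule integral_mono)
    show "integrable D (\<lambda>x. (\<bar>x - m\<bar> + (x - m)) / 2 - \<bar>t - m\<bar>)" using z by auto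
    show "integrable D (\<lambda>x. indicator {t<..} x * (x - m))"
      using z by (rule Bochner_Integration.integrable_bound) (auto split: split_indicator)
    fix x show "(\<bar>x - m\<bar> + (x - m)) / 2 - \<bar>t - m\<bar> \<le> indicator {t<..} x * (x - m)"
      by (auto split: split_indicator simp: abs_if field_simps)
  qed
  finally show ?thesis using abs t by (simp add: field_simps)
qed

definition nmoment :: "real measure \<Rightarrow> real set \<Rightarrow> nat \<Rightarrow> real \<Rightarrow> real" where
  "nmoment \<mu> E k \<theta> = moment_on \<mu> E k \<theta> / moment_on \<mu> UNIV 0 \<theta>"

text \<open>The covariance of \<open>indicator E\<close> and the identity, i.e. the derivative of the probability of \<open>E\<close>.\<close>
definition cov_ind :: "real measure \<Rightarrow> real set \<Rightarrow> real \<Rightarrow> real" where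
  "cov_ind \<mu> E \<theta> = nmoment \<mu> E 1 \<theta> - nmoment \<mu> E 0 \<theta> * nmoment \<mu> UNIV 1 \<theta>"

context
  fixes \<mu> :: "real measure" and \<theta>\<^sub>0 r :: real
  assumes sets_mu [measurable_cong]: "sets \<mu> = sets borel"
    and r: "r > 0" and ends: "\<theta>\<^sub>0 - r \<in> natural_params \<mu>" "\<theta>\<^sub>0 + r \<in> natural_params \<mu>"
    and d2_pos: "d2log_partition \<mu> \<theta>\<^sub>0 > 0"
begin

lemma near_natural: "\<bar>\<theta> - \<theta>\<^sub>0\<bar> \<le> r \<Longrightarrow> \<theta> \<in> natural_params \<mu>"
  by (rule natural_params_interval[OF sets_mu ends]) linarith+

lemma near_ends:
  assumes "\<bar>\<theta> - \<theta>\<^sub>0\<bar> < r"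
  obtains s where "s > 0" "\<theta> - s \<in> natural_params \<mu>" "\<theta> + s \<in> natural_params \<mu>"
  by (rule that[of "r - \<bar>\<theta> - \<theta>\<^sub>0\<bar>"]) (use assms in \<open>auto intro!: near_natural\<close>)

lemma near_integrable_moment:
  assumes "\<bar>\<theta> - \<theta>\<^sub>0\<bar> < r" "E \<in> sets borel"
  shows "integrable \<mu> (\<lambda>x. indicator E x * (x ^ k * exp (\<theta> * x)))"
proof -
  obtain s where s: "s > 0" "\<theta> - s \<in> natural_params \<mu>" "\<theta> + s \<in> natural_params \<mu>"
    by (rule near_ends[OF assms(1)])
  show ?thesis by (rule integrable_moment[OF sets_mu s assms(2)])
qed

lemma near_moment_derivative:
  assumes "\<bar>\<theta> - \<theta>\<^sub>0\<bar> < r" "E \<in> sets borel"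
  shows "(moment_on \<mu> E k has_real_derivative moment_on \<mu> E (Suc k) \<theta>) (at \<theta>)"
proof -
  obtain s where s: "s > 0" "\<theta> - s \<in> natural_params \<mu>" "\<theta> + s \<in> natural_params \<mu>"
    by (rule near_ends[OF assms(1)])
  show ?thesis by (rule moment_has_derivative[OF sets_mu s assms(2)])
qed

text \<open>For a null measure the log-partition function is constantly 0 by convention, which
  contradicts a positive second derivative.\<close>

lemma not_null: "\<not> (AE x in \<mu>. x \<notin> (UNIV :: real set))"
proof
  assume null: "AE x in \<mu>. x \<notin> (UNIV :: real set)"
  have "(\<integral>x. exp (\<theta> * x) \<partial>\<mu>) = 0" for \<theta>
    using null by (intro integral_eq_zero_AE) auto
  then have "log_partition \<mu> = (\<lambda>_. 0)" by (simp add: log_partition_def fun_eq_iff)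
  then have "d2log_partition \<mu> \<theta>\<^sub>0 = 0" by (simp add: d2log_partition_def dlog_partition_def)
  with d2_pos show False by simp
qed

lemma total_pos: "\<theta> \<in> natural_params \<mu> \<Longrightarrow> moment_on \<mu> UNIV 0 \<theta> > 0"
  using moment0_zero_iff[OF sets_mu, of \<theta> UNIV] moment0_nonneg[OF sets_mu, of UNIV \<theta>] not_null
  by (auto simp: less_le)

lemma near_total_pos: "\<bar>\<theta> - \<theta>\<^sub>0\<bar> < r \<Longrightarrow> moment_on \<mu> UNIV 0 \<theta> > 0"
  by (intro total_pos near_natural) auto

section \<open>Derivatives of normalized moments as covariances\<close>

lemma nmoment_derivative:
  assumes "\<bar>\<theta> - \<theta>\<^sub>0\<bar> < r" "E \<in> sets borel"
  shows "(nmoment \<mu> E k has_real_derivative nmoment \<mu> E (Suc k) \<theta> - nmoment \<mu> E k \<theta> * nmoment \<mu> UNIV 1 \<theta>) (at \<theta>)"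
proof -
  have pos: "moment_on \<mu> UNIV 0 \<theta> \<noteq> 0" using near_total_pos[OF assms(1)] by simp
  have "((\<lambda>\<theta>. moment_on \<mu> E k \<theta> / moment_on \<mu> UNIV 0 \<theta>) has_real_derivative
      (moment_on \<mu> E (Suc k) \<theta> * moment_on \<mu> UNIV 0 \<theta> - moment_on \<mu> E k \<theta> * moment_on \<mu> UNIV (Suc 0) \<theta>)
        / (moment_on \<mu> UNIV 0 \<theta> * moment_on \<mu> UNIV 0 \<theta>)) (at \<theta>)"
    using assms pos by (intro DERIV_divide near_moment_derivative) auto
  then show ?thesis
    unfolding nmoment_def[abs_def] using pos by (simp add: diff_divide_distrib)
qed

lemma near_open: "open {\<theta>. \<bar>\<theta> - \<theta>\<^sub>0\<bar> < r}"
proof -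
  have "{\<theta>. \<bar>\<theta> - \<theta>\<^sub>0\<bar> < r} = ball \<theta>\<^sub>0 r" by (auto simp: dist_real_def)
  then show ?thesis by simp
qed

lemma dlog_partition_eq:
  assumes "\<bar>\<theta> - \<theta>\<^sub>0\<bar> < r"
  shows "dlog_partition \<mu> \<theta> = nmoment \<mu> UNIV 1 \<theta>"
proof -
  have eq: "log_partition \<mu> = (\<lambda>\<theta>. ln (moment_on \<mu> UNIV 0 \<theta>))"
    by (simp add: log_partition_def moment0_eq[OF sets_mu] fun_eq_iff)
  have "(log_partition \<mu> has_real_derivative moment_on \<mu> UNIV (Suc 0) \<theta> / moment_on \<mu> UNIV 0 \<theta>) (at \<theta>)"
    unfolding eq
    using DERIV_chain2[OF DERIV_ln_divide[OF near_total_pos[OF assms]] near_moment_derivative[OF assms, of UNIV 0]]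
    by simp
  then show ?thesis by (simp add: dlog_partition_def nmoment_def DERIV_imp_deriv)
qed

lemma d2log_partition_eq:
  assumes "\<bar>\<theta> - \<theta>\<^sub>0\<bar> < r"
  shows "d2log_partition \<mu> \<theta> = nmoment \<mu> UNIV 2 \<theta> - (nmoment \<mu> UNIV 1 \<theta>)\<^sup>2"
proof -
  have "(dlog_partition \<mu> has_real_derivative nmoment \<mu> UNIV (Suc 1) \<theta> - nmoment \<mu> UNIV 1 \<theta> * nmoment \<mu> UNIV 1 \<theta>) (at \<theta>)"
  proof (rule has_field_derivative_transform_within_open[OF nmoment_derivative near_open])
    show "\<And>x. x \<in> {\<theta>. \<bar>\<theta> - \<theta>\<^sub>0\<bar> < r} \<Longrightarrow> nmoment \<mu> UNIV 1 x = dlog_partition \<mu> x"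
      using dlog_partition_eq by simp
  qed (use assms in auto)
  then show ?thesis
    by (simp add: d2log_partition_def DERIV_imp_deriv power2_eq_square numeral_2_eq_2)
qed

lemma measure_expfam_derivative:
  assumes "\<bar>\<theta> - \<theta>\<^sub>0\<bar> < r" "E \<in> sets borel"
  shows "((\<lambda>\<theta>. measure (expfam \<mu> \<theta>) E) has_real_derivative cov_ind \<mu> E \<theta>) (at \<theta>)"
proof (rule has_field_derivative_transform_within_open[OF _ near_open])
  show "(nmoment \<mu> E 0 has_real_derivative cov_ind \<mu> E \<theta>) (at \<theta>)"
    unfolding cov_ind_def using nmoment_derivative[OF assms, of 0] by simp
  show "\<And>x. x \<in> {\<theta>. \<bar>\<theta> - \<theta>\<^sub>0\<bar> < r} \<Longrightarrow> nmoment \<mu> E 0 x = measure (expfam \<mu> x) E"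
    using assms by (simp add: nmoment_def measure_expfam[OF sets_mu] near_natural)
qed (use assms in auto)

lemma nmoment_square:
  assumes "\<bar>\<theta> - \<theta>\<^sub>0\<bar> < r" and [measurable]: "E \<in> sets borel"
  shows "nmoment \<mu> E 2 \<theta> - 2 * c * nmoment \<mu> E 1 \<theta> + c\<^sup>2 * nmoment \<mu> E 0 \<theta> =
    (\<integral>x. indicator E x * ((x - c)\<^sup>2 * exp (\<theta> * x)) \<partial>\<mu>) / moment_on \<mu> UNIV 0 \<theta>"
    and "integrable \<mu> (\<lambda>x. indicator E x * ((x - c)\<^sup>2 * exp (\<theta> * x)))"
proof -
  note i = near_integrable_moment[OF assms]
  have eq: "indicator E x * ((x - c)\<^sup>2 * exp (\<theta> * x)) = indicator E x * (x\<^sup>2 * exp (\<theta> * x))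
      - 2 * c * (indicator E x * (x ^ 1 * exp (\<theta> * x))) + c\<^sup>2 * (indicator E x * (x ^ 0 * exp (\<theta> * x)))" for x
    by (simp add: power2_diff algebra_simps)
  show "integrable \<mu> (\<lambda>x. indicator E x * ((x - c)\<^sup>2 * exp (\<theta> * x)))"
    unfolding eq by (intro Bochner_Integration.integrable_add Bochner_Integration.integrable_diff integrable_mult_right i)
  have "(\<integral>x. indicator E x * ((x - c)\<^sup>2 * exp (\<theta> * x)) \<partial>\<mu>) =
      moment_on \<mu> E 2 \<theta> - 2 * c * moment_on \<mu> E 1 \<theta> + c\<^sup>2 * moment_on \<mu> E 0 \<theta>"
    unfolding eq moment_on_def
    by (simp only: Bochner_Integration.integral_add Bochner_Integration.integral_diff integral_mult_right_zero
        Bochner_Integration.integrable_diff integrable_mult_right i)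
  then show "nmoment \<mu> E 2 \<theta> - 2 * c * nmoment \<mu> E 1 \<theta> + c\<^sup>2 * nmoment \<mu> E 0 \<theta> =
    (\<integral>x. indicator E x * ((x - c)\<^sup>2 * exp (\<theta> * x)) \<partial>\<mu>) / moment_on \<mu> UNIV 0 \<theta>"
    by (simp add: nmoment_def add_divide_distrib diff_divide_distrib)
qed

text \<open>The expression is the expectation of \<open>(x - c)\<^sup>2\<close> on \<open>E\<close>,
  expanded into moments to match the derivative formulas. Around the mean it is at most the full
  variance.\<close>

lemma nmoment_square_bounds:
  assumes "\<bar>\<theta> - \<theta>\<^sub>0\<bar> < r" "E \<in> sets borel"
  shows "0 \<le> nmoment \<mu> E 2 \<theta> - 2 * c * nmoment \<mu> E 1 \<theta> + c\<^sup>2 * nmoment \<mu> E 0 \<theta>"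
    and "nmoment \<mu> E 2 \<theta> - 2 * nmoment \<mu> UNIV 1 \<theta> * nmoment \<mu> E 1 \<theta> + (nmoment \<mu> UNIV 1 \<theta>)\<^sup>2 * nmoment \<mu> E 0 \<theta>
      \<le> d2log_partition \<mu> \<theta>"
proof -
  note pos = near_total_pos[OF assms(1)]
  show "0 \<le> nmoment \<mu> E 2 \<theta> - 2 * c * nmoment \<mu> E 1 \<theta> + c\<^sup>2 * nmoment \<mu> E 0 \<theta>"
    unfolding nmoment_square[OF assms] using pos by (intro divide_nonneg_pos Bochner_Integration.integral_nonneg) auto
  let ?M = "nmoment \<mu> UNIV 1 \<theta>"
  have "nmoment \<mu> UNIV 0 \<theta> = 1" using pos by (simp add: nmoment_def)
  then have "d2log_partition \<mu> \<theta> = nmoment \<mu> UNIV 2 \<theta> - 2 * ?M * nmoment \<mu> UNIV 1 \<theta> + ?M\<^sup>2 * nmoment \<mu> UNIV 0 \<theta>"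
    unfolding d2log_partition_eq[OF assms(1)] by (simp add: power2_eq_square)
  also have "\<dots> = (\<integral>x. indicator UNIV x * ((x - ?M)\<^sup>2 * exp (\<theta> * x)) \<partial>\<mu>) / moment_on \<mu> UNIV 0 \<theta>"
    by (rule nmoment_square(1)[OF assms(1)]) simp
  finally have V: "d2log_partition \<mu> \<theta> = (\<integral>x. indicator UNIV x * ((x - ?M)\<^sup>2 * exp (\<theta> * x)) \<partial>\<mu>) / moment_on \<mu> UNIV 0 \<theta>" .
  show "nmoment \<mu> E 2 \<theta> - 2 * ?M * nmoment \<mu> E 1 \<theta> + ?M\<^sup>2 * nmoment \<mu> E 0 \<theta> \<le> d2log_partition \<mu> \<theta>"
    unfolding nmoment_square[OF assms] V using pos assms
    by (intro divide_right_mono integral_mono nmoment_square(2)) (auto split: split_indicator)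
qed

lemma nmoment0_bounds:
  assumes "\<bar>\<theta> - \<theta>\<^sub>0\<bar> < r" "E \<in> sets borel"
  shows "0 \<le> nmoment \<mu> E 0 \<theta>" "nmoment \<mu> E 0 \<theta> \<le> 1"
  using near_total_pos[OF assms(1)] moment0_nonneg[OF sets_mu, of E \<theta>]
    moment0_mono[OF sets_mu near_natural assms(2), of \<theta> UNIV] assms(1)
  by (simp_all add: nmoment_def)

text \<open>Cauchy-Schwarz, obtained by expanding the nonnegative expectation of a square on
  \<open>E\<close> around the mean shifted by the covariance \<open>q\<close> itself.\<close>

lemma cov_ind_bound:
  assumes "\<bar>\<theta> - \<theta>\<^sub>0\<bar> < r" "E \<in> sets borel"
  shows "\<bar>cov_ind \<mu> E \<theta>\<bar> \<le> sqrt (d2log_partition \<mu> \<theta>)"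
proof -
  define M q where "M = nmoment \<mu> UNIV 1 \<theta>" and "q = cov_ind \<mu> E \<theta>"
  define a0 a1 a2 where "a0 = nmoment \<mu> E 0 \<theta>" and "a1 = nmoment \<mu> E 1 \<theta>" and "a2 = nmoment \<mu> E 2 \<theta>"
  have q: "q = a1 - a0 * M" by (simp add: q_def cov_ind_def M_def a0_def a1_def)
  have "0 \<le> a2 - 2 * (M + q) * a1 + (M + q)\<^sup>2 * a0"
    unfolding a0_def a1_def a2_def by (rule nmoment_square_bounds(1)[OF assms])
  also have "\<dots> = (a2 - 2 * M * a1 + M\<^sup>2 * a0) - 2 * q * (a1 - a0 * M) + q\<^sup>2 * a0"
    by (simp add: power2_eq_square algebra_simps)
  also have "\<dots> = (a2 - 2 * M * a1 + M\<^sup>2 * a0) - 2 * q\<^sup>2 + q\<^sup>2 * a0"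
    by (simp add: q[symmetric] power2_eq_square)
  also have "\<dots> \<le> d2log_partition \<mu> \<theta> - 2 * q\<^sup>2 + q\<^sup>2 * 1"
    using nmoment_square_bounds(2)[OF assms] nmoment0_bounds[OF assms]
    unfolding M_def a0_def a1_def a2_def by (intro add_mono diff_mono mult_left_mono) auto
  finally have "q\<^sup>2 \<le> d2log_partition \<mu> \<theta>" by simp
  then show ?thesis unfolding q_def by (metis real_sqrt_abs real_sqrt_le_iff)
qed

text \<open>The derivative is the expectation of the squared deviation on \<open>E\<close> minus the
  variance times the probability of \<open>E\<close>; both terms lie between 0 and the
  variance.\<close>

lemma cov_ind_derivative:
  assumes "\<bar>\<theta> - \<theta>\<^sub>0\<bar> < r" "E \<in> sets borel"
  shows "\<exists>d. (cov_ind \<mu> E has_real_derivative d) (at \<theta>) \<and> \<bar>d\<bar> \<le> d2log_partition \<mu> \<theta>"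
proof -
  define M V where "M = nmoment \<mu> UNIV 1 \<theta>" and "V = d2log_partition \<mu> \<theta>"
  define a0 a1 a2 where "a0 = nmoment \<mu> E 0 \<theta>" and "a1 = nmoment \<mu> E 1 \<theta>" and "a2 = nmoment \<mu> E 2 \<theta>"
  have V: "V = nmoment \<mu> UNIV 2 \<theta> - M * M"
    unfolding V_def M_def d2log_partition_eq[OF assms(1)] power2_eq_square ..
  have "((\<lambda>\<theta>. nmoment \<mu> E 1 \<theta> - nmoment \<mu> E 0 \<theta> * nmoment \<mu> UNIV 1 \<theta>) has_real_derivative
      (nmoment \<mu> E (Suc 1) \<theta> - nmoment \<mu> E 1 \<theta> * nmoment \<mu> UNIV 1 \<theta>) -
      ((nmoment \<mu> E (Suc 0) \<theta> - nmoment \<mu> E 0 \<theta> * nmoment \<mu> UNIV 1 \<theta>) * nmoment \<mu> UNIV 1 \<theta> +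
       (nmoment \<mu> UNIV (Suc 1) \<theta> - nmoment \<mu> UNIV 1 \<theta> * nmoment \<mu> UNIV 1 \<theta>) * nmoment \<mu> E 0 \<theta>)) (at \<theta>)"
    using assms by (intro DERIV_diff DERIV_mult nmoment_derivative) auto
  then have d: "(cov_ind \<mu> E has_real_derivative (a2 - a1 * M) - ((a1 - a0 * M) * M + V * a0)) (at \<theta>)"
    unfolding cov_ind_def[abs_def] a0_def a1_def a2_def V M_def by (simp add: numeral_2_eq_2)
  have eq: "(a2 - a1 * M) - ((a1 - a0 * M) * M + V * a0) = (a2 - 2 * M * a1 + M\<^sup>2 * a0) - V * a0"
    by (simp add: power2_eq_square algebra_simps)
  have S: "0 \<le> a2 - 2 * M * a1 + M\<^sup>2 * a0" "a2 - 2 * M * a1 + M\<^sup>2 * a0 \<le> V"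
    unfolding a0_def a1_def a2_def M_def V_def by (rule nmoment_square_bounds[OF assms])+
  have a0: "0 \<le> a0" "a0 \<le> 1" unfolding a0_def by (rule nmoment0_bounds[OF assms])+
  have "0 \<le> V * a0" "V * a0 \<le> V" using S a0 by (auto simp: mult_left_le)
  then have "\<bar>(a2 - a1 * M) - ((a1 - a0 * M) * M + V * a0)\<bar> \<le> V" unfolding eq using S by linarith
  with d show ?thesis unfolding V_def[symmetric] by (intro exI conjI)
qed

lemma expfam_expectation:
  assumes "\<bar>\<theta> - \<theta>\<^sub>0\<bar> < r" and [measurable]: "E \<in> sets borel"
  shows "integrable (expfam \<mu> \<theta>) (\<lambda>x. indicator E x * x ^ k)"
    and "(\<integral>x. indicator E x * x ^ k \<partial>expfam \<mu> \<theta>) = nmoment \<mu> E k \<theta>"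
proof -
  have e: "exp (\<theta> * x - log_partition \<mu> \<theta>) = exp (\<theta> * x) / moment_on \<mu> UNIV 0 \<theta>" for x
    using near_total_pos[OF assms(1)] by (simp add: exp_diff exp_log_partition[OF sets_mu])
  have pos: "exp (\<theta> * x) / moment_on \<mu> UNIV 0 \<theta> \<ge> 0" for x
    using near_total_pos[OF assms(1)] by simp
  have eq: "(exp (\<theta> * x) / moment_on \<mu> UNIV 0 \<theta>) *\<^sub>R (indicator E x * x ^ k) =
      (indicator E x * (x ^ k * exp (\<theta> * x))) / moment_on \<mu> UNIV 0 \<theta>" for x by simp
  show "integrable (expfam \<mu> \<theta>) (\<lambda>x. indicator E x * x ^ k)"
  proof -
    have "integrable \<mu> (\<lambda>x. (exp (\<theta> * x) / moment_on \<mu> UNIV 0 \<theta>) *\<^sub>R (indicator E x * x ^ k))"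
      unfolding eq by (intro integrable_divide near_integrable_moment assms)
    then show ?thesis
      unfolding expfam_def e by (subst integrable_density) (use pos in auto)
  qed
  show "(\<integral>x. indicator E x * x ^ k \<partial>expfam \<mu> \<theta>) = nmoment \<mu> E k \<theta>"
  proof -
    have "(\<integral>x. indicator E x * x ^ k \<partial>expfam \<mu> \<theta>) =
        (\<integral>x. (exp (\<theta> * x) / moment_on \<mu> UNIV 0 \<theta>) *\<^sub>R (indicator E x * x ^ k) \<partial>\<mu>)"
      unfolding expfam_def e by (subst integral_density) (use pos in auto)
    also have "\<dots> = nmoment \<mu> E k \<theta>"
      unfolding eq nmoment_def by (simp add: moment_on_def)
    finally show ?thesis .
  qed
qed

end

section \<open>The parameter neighbourhood\<close>

text \<open>The bound on \<open>\<rho>\<close> limits the drift of the covariance to \<open>2 *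
  \<sigma>\<^sup>2 * \<rho> \<le> \<sigma> / (8 * sqrt \<zeta>)\<close>, half of its lower bound at
  the centre. Strictness of \<open>\<rho> < r\<close> keeps the closed interval inside the region of
  differentiability.\<close>

locale expfam_neighbourhood =
  fixes \<mu> :: "real measure" and \<theta>\<^sub>0 r \<sigma> \<zeta> \<rho> :: real
  assumes sets_mu [measurable_cong]: "sets \<mu> = sets borel"
    and r: "r > 0" and ends: "\<theta>\<^sub>0 - r \<in> natural_params \<mu>" "\<theta>\<^sub>0 + r \<in> natural_params \<mu>"
    and \<sigma>: "\<sigma> > 0" and d2: "d2log_partition \<mu> \<theta>\<^sub>0 = \<sigma>\<^sup>2" and \<zeta>: "\<zeta> > 0"
    and d2_near: "\<And>\<theta>. \<bar>\<theta> - \<theta>\<^sub>0\<bar> < r \<Longrightarrow> d2log_partition \<mu> \<theta> \<le> 2 * \<sigma>\<^sup>2"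
    and fourth: "(\<integral>x. (x - dlog_partition \<mu> \<theta>\<^sub>0) ^ 4 \<partial>expfam \<mu> \<theta>\<^sub>0) \<le> \<zeta> * \<sigma> ^ 4"
    and \<rho>: "0 < \<rho>" "\<rho> < r" "\<rho> \<le> 1 / (16 * sqrt \<zeta> * \<sigma>)"
begin

lemma d2_pos: "d2log_partition \<mu> \<theta>\<^sub>0 > 0"
  using d2 \<sigma> by simp

lemmas loc = sets_mu r ends d2_pos

lemma center: "\<bar>\<theta>\<^sub>0 - \<theta>\<^sub>0\<bar> < r" using r by simp

lemma prob_space_expfam: "\<theta> \<in> natural_params \<mu> \<Longrightarrow> prob_space (expfam \<mu> \<theta>)"
  by (rule prob_spaceI)
    (use total_pos[OF loc, of \<theta>] in \<open>simp add: space_expfam[OF sets_mu] emeasure_expfam[OF sets_mu]\<close>)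

lemma prob_space_center: "prob_space (expfam \<mu> \<theta>\<^sub>0)"
  using r by (intro prob_space_expfam near_natural[OF loc]) simp

lemma expfam_integrable_power: "integrable (expfam \<mu> \<theta>\<^sub>0) (\<lambda>x. x ^ k)"
  using expfam_expectation(1)[OF loc center, of UNIV k] by simp

lemma expfam_expectation_power: "(\<integral>x. x ^ k \<partial>expfam \<mu> \<theta>\<^sub>0) = nmoment \<mu> UNIV k \<theta>\<^sub>0"
  using expfam_expectation(2)[OF loc center, of UNIV k] by simp

lemma expfam_mean:
  "integrable (expfam \<mu> \<theta>\<^sub>0) (\<lambda>x. x)" "(\<integral>x. x \<partial>expfam \<mu> \<theta>\<^sub>0) = dlog_partition \<mu> \<theta>\<^sub>0"
  using expfam_integrable_power[of 1] expfam_expectation_power[of 1] dlog_partition_eq[OF loc center] by simp_all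

lemma expfam_variance:
  "integrable (expfam \<mu> \<theta>\<^sub>0) (\<lambda>x. (x - dlog_partition \<mu> \<theta>\<^sub>0)\<^sup>2)"
  "(\<integral>x. (x - dlog_partition \<mu> \<theta>\<^sub>0)\<^sup>2 \<partial>expfam \<mu> \<theta>\<^sub>0) = \<sigma>\<^sup>2"
proof -
  interpret prob_space "expfam \<mu> \<theta>\<^sub>0" by (rule prob_space_center)
  define m where "m = dlog_partition \<mu> \<theta>\<^sub>0"
  have eq: "(x - m)\<^sup>2 = x ^ 2 - 2 * m * x ^ 1 + m\<^sup>2" for x by (simp add: power2_diff)
  show "integrable (expfam \<mu> \<theta>\<^sub>0) (\<lambda>x. (x - dlog_partition \<mu> \<theta>\<^sub>0)\<^sup>2)"
    unfolding m_def[symmetric] eq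
    by (intro Bochner_Integration.integrable_add Bochner_Integration.integrable_diff integrable_mult_right
        expfam_integrable_power integrable_const)
  have "(\<integral>x. (x - m)\<^sup>2 \<partial>expfam \<mu> \<theta>\<^sub>0) = nmoment \<mu> UNIV 2 \<theta>\<^sub>0 - 2 * m * nmoment \<mu> UNIV 1 \<theta>\<^sub>0 + m\<^sup>2"
    unfolding eq expfam_expectation_power[symmetric] using prob_space
    by (simp only: Bochner_Integration.integral_add Bochner_Integration.integral_diff integral_mult_right_zero
        Bochner_Integration.integrable_diff integrable_mult_right expfam_integrable_power integrable_const
        lebesgue_integral_const) simp
  also have "\<dots> = \<sigma>\<^sup>2"
    unfolding m_def dlog_partition_eq[OF loc center] d2[symmetric] d2log_partition_eq[OF loc center]
    by (simp add: power2_eq_square)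
  finally show "(\<integral>x. (x - dlog_partition \<mu> \<theta>\<^sub>0)\<^sup>2 \<partial>expfam \<mu> \<theta>\<^sub>0) = \<sigma>\<^sup>2" by (simp add: m_def)
qed

lemma expfam_integrable_fourth: "integrable (expfam \<mu> \<theta>\<^sub>0) (\<lambda>x. (x - m) ^ 4)"
proof -
  interpret prob_space "expfam \<mu> \<theta>\<^sub>0" by (rule prob_space_center)
  have eq: "(x - m) ^ 4 = x ^ 4 - 4 * m * x ^ 3 + 6 * m\<^sup>2 * x ^ 2 - 4 * m ^ 3 * x ^ 1 + m ^ 4" for x
    by (simp add: power2_eq_square power3_eq_cube power4_eq_xxxx algebra_simps)
  show ?thesis
    unfolding eq
    by (intro Bochner_Integration.integrable_add Bochner_Integration.integrable_diff integrable_mult_right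
        expfam_integrable_power integrable_const)
qed

text \<open>The squared deviation has nonnegative variance, so its second moment is at least
  \<open>\<sigma> ^ 4\<close>. The fact is needed when constants depending on \<open>\<zeta>\<close>
  are compared, such as \<open>\<zeta> \<le> \<zeta>\<^sup>2\<close>.\<close>

lemma zeta_ge_1: "\<zeta> \<ge> 1"
proof -
  interpret prob_space "expfam \<mu> \<theta>\<^sub>0" by (rule prob_space_center)
  let ?z = "\<lambda>x. x - dlog_partition \<mu> \<theta>\<^sub>0"
  have eq: "((?z x)\<^sup>2 - \<sigma>\<^sup>2)\<^sup>2 = ?z x ^ 4 - 2 * \<sigma>\<^sup>2 * (?z x)\<^sup>2 + \<sigma> ^ 4" for x
    by (rule square_diff_squares)
  have "0 \<le> (\<integral>x. ((?z x)\<^sup>2 - \<sigma>\<^sup>2)\<^sup>2 \<partial>expfam \<mu> \<theta>\<^sub>0)"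
    by (intro Bochner_Integration.integral_nonneg) auto
  also have "\<dots> = (\<integral>x. ?z x ^ 4 \<partial>expfam \<mu> \<theta>\<^sub>0) - 2 * \<sigma>\<^sup>2 * \<sigma>\<^sup>2 + \<sigma> ^ 4"
    unfolding eq using expfam_variance expfam_integrable_fourth prob_space by simp
  also have "2 * \<sigma>\<^sup>2 * \<sigma>\<^sup>2 = 2 * \<sigma> ^ 4" by (simp add: power2_eq_square power4_eq_xxxx)
  finally have "1 * \<sigma> ^ 4 \<le> \<zeta> * \<sigma> ^ 4" using fourth by linarith
  then show ?thesis using \<sigma> by (simp add: mult_le_cancel_right)
qed

text \<open>The covariance is the mean of \<open>x - m\<close> above the threshold, to which the
  bound on the upper deviation applies.\<close>

lemma cov_ind_lower:
  assumes "\<bar>t - dlog_partition \<mu> \<theta>\<^sub>0\<bar> \<le> \<sigma> / (4 * sqrt \<zeta>)"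
  shows "cov_ind \<mu> {t<..} \<theta>\<^sub>0 \<ge> \<sigma> / (4 * sqrt \<zeta>)"
proof -
  from upper_mean_deviation[OF prob_space_center sets_expfam[OF sets_mu] \<sigma> \<zeta> expfam_mean expfam_variance
      expfam_integrable_fourth fourth assms]
  have "\<sigma> / (4 * sqrt \<zeta>) \<le> (\<integral>x. indicator {t<..} x * (x - dlog_partition \<mu> \<theta>\<^sub>0) \<partial>expfam \<mu> \<theta>\<^sub>0)" .
  also have "\<dots> = (\<integral>x. indicator {t<..} x * x ^ 1 - dlog_partition \<mu> \<theta>\<^sub>0 * (indicator {t<..} x * x ^ 0) \<partial>expfam \<mu> \<theta>\<^sub>0)"
    by (simp add: algebra_simps)
  also have "\<dots> = nmoment \<mu> {t<..} 1 \<theta>\<^sub>0 - dlog_partition \<mu> \<theta>\<^sub>0 * nmoment \<mu> {t<..} 0 \<theta>\<^sub>0"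
    using expfam_expectation[OF loc center, of "{t<..}" 0] expfam_expectation[OF loc center, of "{t<..}" 1] by simp
  also have "\<dots> = cov_ind \<mu> {t<..} \<theta>\<^sub>0"
    by (simp add: cov_ind_def dlog_partition_eq[OF loc center] mult.commute)
  finally show ?thesis .
qed

lemma rho_near: "\<theta> \<in> {\<theta>\<^sub>0 - \<rho>..\<theta>\<^sub>0 + \<rho>} \<Longrightarrow> \<bar>\<theta> - \<theta>\<^sub>0\<bar> < r"
  using \<rho> by auto

lemma cov_ind_lower_near:
  assumes t: "\<bar>t - dlog_partition \<mu> \<theta>\<^sub>0\<bar> \<le> \<sigma> / (4 * sqrt \<zeta>)" and \<theta>: "\<theta> \<in> {\<theta>\<^sub>0 - \<rho>..\<theta>\<^sub>0 + \<rho>}"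
  shows "cov_ind \<mu> {t<..} \<theta> \<ge> \<sigma> / (8 * sqrt \<zeta>)"
proof -
  have "\<forall>\<theta>\<in>{\<theta>\<^sub>0 - \<rho>..\<theta>\<^sub>0 + \<rho>}. \<exists>d. (cov_ind \<mu> {t<..} has_real_derivative d) (at \<theta>) \<and> \<bar>d\<bar> \<le> 2 * \<sigma>\<^sup>2"
  proof
    fix \<theta> assume \<theta>: "\<theta> \<in> {\<theta>\<^sub>0 - \<rho>..\<theta>\<^sub>0 + \<rho>}"
    obtain d where "(cov_ind \<mu> {t<..} has_real_derivative d) (at \<theta>)" "\<bar>d\<bar> \<le> d2log_partition \<mu> \<theta>"
      using cov_ind_derivative[OF loc rho_near[OF \<theta>], of "{t<..}"] by auto
    then show "\<exists>d. (cov_ind \<mu> {t<..} has_real_derivative d) (at \<theta>) \<and> \<bar>d\<bar> \<le> 2 * \<sigma>\<^sup>2"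
      using d2_near[OF rho_near[OF \<theta>]] by (intro exI[of _ d]) auto
  qed
  then obtain d where d: "\<And>\<theta>. \<theta> \<in> {\<theta>\<^sub>0 - \<rho>..\<theta>\<^sub>0 + \<rho>} \<Longrightarrow> (cov_ind \<mu> {t<..} has_real_derivative d \<theta>) (at \<theta>)"
      "\<And>\<theta>. \<theta> \<in> {\<theta>\<^sub>0 - \<rho>..\<theta>\<^sub>0 + \<rho>} \<Longrightarrow> \<bar>d \<theta>\<bar> \<le> 2 * \<sigma>\<^sup>2"
    by metis
  have "norm (cov_ind \<mu> {t<..} \<theta> - cov_ind \<mu> {t<..} \<theta>\<^sub>0) \<le> 2 * \<sigma>\<^sup>2 * norm (\<theta> - \<theta>\<^sub>0)"
    using d \<theta> \<rho> by (intro field_differentiable_bound[of "{\<theta>\<^sub>0 - \<rho>..\<theta>\<^sub>0 + \<rho>}" _ d])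
      (auto intro: has_field_derivative_at_within)
  also have "\<dots> \<le> 2 * \<sigma>\<^sup>2 * (1 / (16 * sqrt \<zeta> * \<sigma>))"
    using \<theta> \<rho> by (intro mult_left_mono) auto
  also have "\<dots> = \<sigma> / (8 * sqrt \<zeta>)" using \<sigma> by (simp add: power2_eq_square)
  finally have "\<bar>cov_ind \<mu> {t<..} \<theta> - cov_ind \<mu> {t<..} \<theta>\<^sub>0\<bar> \<le> \<sigma> / (8 * sqrt \<zeta>)" by simp
  moreover have "\<sigma> / (4 * sqrt \<zeta>) = \<sigma> / (8 * sqrt \<zeta>) + \<sigma> / (8 * sqrt \<zeta>)" by simp
  ultimately show ?thesis using cov_ind_lower[OF t] by linarith
qed

lemma prob_above_growth:
  assumes t: "\<bar>t - dlog_partition \<mu> \<theta>\<^sub>0\<bar> \<le> \<sigma> / (4 * sqrt \<zeta>)"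
    and ab: "\<theta>\<^sub>0 - \<rho> \<le> a" "a \<le> b" "b \<le> \<theta>\<^sub>0 + \<rho>"
  shows "prob_above \<mu> t b - prob_above \<mu> t a \<ge> (b - a) * (\<sigma> / (8 * sqrt \<zeta>))"
proof (cases "a = b")
  case False
  then have "a < b" using ab by simp
  then have "\<exists>z>a. z < b \<and> measure (expfam \<mu> b) {t<..} - measure (expfam \<mu> a) {t<..} = (b - a) * cov_ind \<mu> {t<..} z"
    using ab by (intro MVT2 measure_expfam_derivative[OF loc] rho_near) auto
  then obtain z where z: "a < z" "z < b" "prob_above \<mu> t b - prob_above \<mu> t a = (b - a) * cov_ind \<mu> {t<..} z"
    by (auto simp: prob_above_def)
  then show ?thesis
    using ab mult_left_mono[OF cov_ind_lower_near[OF t, of z], of "b - a"] by simp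
qed simp

section \<open>Two-sided bounds on the total variation modulus\<close>

lemma tv_dist_upper:
  assumes "\<bar>h\<bar> \<le> \<rho>"
  shows "tv_dist (expfam \<mu> \<theta>\<^sub>0) (expfam \<mu> (\<theta>\<^sub>0 + h)) \<le> 2 * \<sigma> * \<bar>h\<bar>"
  unfolding tv_dist_def
proof (rule cSUP_least)
  fix E :: "real set" assume E: "E \<in> sets borel"
  have "norm (measure (expfam \<mu> \<theta>\<^sub>0) E - measure (expfam \<mu> (\<theta>\<^sub>0 + h)) E) \<le> 2 * \<sigma> * norm (\<theta>\<^sub>0 - (\<theta>\<^sub>0 + h))"
  proof (rule field_differentiable_bound[where S = "{\<theta>\<^sub>0 - \<rho>..\<theta>\<^sub>0 + \<rho>}" and f' = "cov_ind \<mu> E"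
        and f = "\<lambda>\<theta>. measure (expfam \<mu> \<theta>) E" and x = \<theta>\<^sub>0 and y = "\<theta>\<^sub>0 + h"])
    fix \<theta> assume \<theta>: "\<theta> \<in> {\<theta>\<^sub>0 - \<rho>..\<theta>\<^sub>0 + \<rho>}"
    show "((\<lambda>\<theta>. measure (expfam \<mu> \<theta>) E) has_field_derivative cov_ind \<mu> E \<theta>) (at \<theta> within {\<theta>\<^sub>0 - \<rho>..\<theta>\<^sub>0 + \<rho>})"
      by (rule has_field_derivative_at_within[OF measure_expfam_derivative[OF loc rho_near[OF \<theta>] E]])
    have "\<bar>cov_ind \<mu> E \<theta>\<bar> \<le> sqrt (d2log_partition \<mu> \<theta>)" by (rule cov_ind_bound[OF loc rho_near[OF \<theta>] E])
    \<comment> \<open>The slope \<open>sqrt 2 * \<sigma>\<close> is rounded up to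
      \<open>2 * \<sigma>\<close>.\<close>
    also have "d2log_partition \<mu> \<theta> \<le> (2 * \<sigma>)\<^sup>2"
    proof -
      have "0 \<le> \<sigma>\<^sup>2" "(2 * \<sigma>)\<^sup>2 = 4 * \<sigma>\<^sup>2" by (simp_all add: power_mult_distrib)
      then show ?thesis using d2_near[OF rho_near[OF \<theta>]] by linarith
    qed
    then have "sqrt (d2log_partition \<mu> \<theta>) \<le> sqrt ((2 * \<sigma>)\<^sup>2)" by (rule real_sqrt_le_mono)
    also have "\<dots> = 2 * \<sigma>" using \<sigma> by (intro real_sqrt_unique) auto
    finally show "norm (cov_ind \<mu> E \<theta>) \<le> 2 * \<sigma>" by simp
  qed (use assms \<rho> in auto)
  then show "\<bar>measure (expfam \<mu> \<theta>\<^sub>0) E - measure (expfam \<mu> (\<theta>\<^sub>0 + h)) E\<bar> \<le> 2 * \<sigma> * \<bar>h\<bar>" by simp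
qed auto

lemma J_TV_inv_lower:
  assumes "\<beta> > 0" "\<beta> / (2 * \<sigma>) \<le> \<rho>"
  shows "ereal (\<beta> / (2 * \<sigma>)) \<le> J_TV_inv \<mu> \<theta>\<^sub>0 \<beta>"
  unfolding J_TV_inv_def
proof (rule Sup_upper)
  have h: "\<bar>\<beta> / (2 * \<sigma>)\<bar> = \<beta> / (2 * \<sigma>)" using assms \<sigma> by simp
  have "\<theta>\<^sub>0 + \<beta> / (2 * \<sigma>) \<in> natural_params \<mu>"
    using assms \<rho> h by (intro near_natural[OF loc]) simp
  moreover have "tv_dist (expfam \<mu> \<theta>\<^sub>0) (expfam \<mu> (\<theta>\<^sub>0 + \<beta> / (2 * \<sigma>))) \<le> \<beta>"
    using tv_dist_upper[of "\<beta> / (2 * \<sigma>)"] assms \<sigma> h by simp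
  ultimately show "ereal (\<beta> / (2 * \<sigma>)) \<in> {ereal \<bar>h\<bar> |h. \<theta>\<^sub>0 + h \<in> natural_params \<mu> \<and>
      tv_dist (expfam \<mu> \<theta>\<^sub>0) (expfam \<mu> (\<theta>\<^sub>0 + h)) \<le> \<beta>}"
    using h by (intro CollectI exI[of _ "\<beta> / (2 * \<sigma>)"]) simp
qed

lemma tv_dist_ge_prob_above:
  assumes "\<theta> \<in> natural_params \<mu>"
  shows "\<bar>prob_above \<mu> t \<theta>\<^sub>0 - prob_above \<mu> t \<theta>\<bar> \<le> tv_dist (expfam \<mu> \<theta>\<^sub>0) (expfam \<mu> \<theta>)"
  unfolding tv_dist_def prob_above_def
proof (rule cSUP_upper)
  interpret P: prob_space "expfam \<mu> \<theta>\<^sub>0" by (rule prob_space_center)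
  interpret Q: prob_space "expfam \<mu> \<theta>" by (intro prob_space_expfam assms)
  have "\<bar>P.prob E - Q.prob E\<bar> \<le> 1" for E
    using P.prob_le_1[of E] Q.prob_le_1[of E] measure_nonneg[of "expfam \<mu> \<theta>\<^sub>0" E] measure_nonneg[of "expfam \<mu> \<theta>" E]
    by linarith
  then show "bdd_above ((\<lambda>E. \<bar>P.prob E - Q.prob E\<bar>) ` sets borel)" by (intro bdd_aboveI2) auto
qed simp

text \<open>A distant parameter might be close in total variation. Truncating
  \<open>\<bar>h\<bar>\<close> at \<open>\<rho>\<close> and using monotone tail probabilities beyond
  the neighbourhood gives \<open>k * c \<le> \<beta> < \<rho> * c\<close>, so nothing was truncated.
  The tail event at the mean alone separates the two laws.\<close>

lemma J_TV_inv_upper: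
  assumes \<beta>: "0 \<le> \<beta>" "\<beta> < \<rho> * (\<sigma> / (8 * sqrt \<zeta>))"
  shows "J_TV_inv \<mu> \<theta>\<^sub>0 \<beta> \<le> ereal (8 * sqrt \<zeta> * \<beta> / \<sigma>)"
  unfolding J_TV_inv_def
proof (rule Sup_least, clarsimp)
  fix h assume nat: "\<theta>\<^sub>0 + h \<in> natural_params \<mu>" and tv: "tv_dist (expfam \<mu> \<theta>\<^sub>0) (expfam \<mu> (\<theta>\<^sub>0 + h)) \<le> \<beta>"
  define t where "t = dlog_partition \<mu> \<theta>\<^sub>0"
  define c where "c = \<sigma> / (8 * sqrt \<zeta>)"
  have c: "c > 0" using \<sigma> \<zeta> by (simp add: c_def)
  have t: "\<bar>t - dlog_partition \<mu> \<theta>\<^sub>0\<bar> \<le> \<sigma> / (4 * sqrt \<zeta>)" using \<sigma> \<zeta> by (simp add: t_def)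
  have n0: "\<theta>\<^sub>0 \<in> natural_params \<mu>" using r by (intro near_natural[OF loc]) simp
  define k where "k = min \<bar>h\<bar> \<rho>"
  have k: "0 \<le> k" "k \<le> \<rho>" "k \<le> \<bar>h\<bar>" using \<rho> by (auto simp: k_def)
  have nk: "\<theta>\<^sub>0 + k \<in> natural_params \<mu>" "\<theta>\<^sub>0 - k \<in> natural_params \<mu>"
    using k \<rho> by (auto intro!: near_natural[OF loc])
  have "k * c \<le> \<bar>prob_above \<mu> t \<theta>\<^sub>0 - prob_above \<mu> t (\<theta>\<^sub>0 + h)\<bar>"
  proof (cases "h \<ge> 0")
    case True
    have "prob_above \<mu> t (\<theta>\<^sub>0 + k) \<le> prob_above \<mu> t (\<theta>\<^sub>0 + h)"
      using k True nat nk by (intro prob_above_mono[OF sets_mu]) auto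
    moreover have "k * c \<le> prob_above \<mu> t (\<theta>\<^sub>0 + k) - prob_above \<mu> t \<theta>\<^sub>0"
      using prob_above_growth[OF t, of \<theta>\<^sub>0 "\<theta>\<^sub>0 + k"] k \<rho> by (simp add: c_def)
    ultimately show ?thesis by linarith
  next
    case False
    have "prob_above \<mu> t (\<theta>\<^sub>0 + h) \<le> prob_above \<mu> t (\<theta>\<^sub>0 - k)"
      using k False nat nk by (intro prob_above_mono[OF sets_mu]) auto
    moreover have "k * c \<le> prob_above \<mu> t \<theta>\<^sub>0 - prob_above \<mu> t (\<theta>\<^sub>0 - k)"
      using prob_above_growth[OF t, of "\<theta>\<^sub>0 - k" \<theta>\<^sub>0] k \<rho> by (simp add: c_def)
    ultimately show ?thesis by linarith
  qed
  also have "\<dots> \<le> \<beta>" using tv_dist_ge_prob_above[OF nat, of t] tv by linarith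
  finally have kc: "k * c \<le> \<beta>" .
  then have "k * c < \<rho> * c" using \<beta> by (simp add: c_def)
  then have "k < \<rho>" using c by simp
  then have "\<bar>h\<bar> = k" by (auto simp: k_def min_def split: if_splits)
  then have "\<bar>h\<bar> * c \<le> \<beta>" using kc by simp
  then show "\<bar>h\<bar> \<le> 8 * sqrt \<zeta> * \<beta> / \<sigma>"
    using \<sigma> \<zeta> by (simp add: c_def field_simps)
qed

text \<open>The intermediate value theorem gives a preimage at distance at most \<open>h\<close>.
  The inverse also demands injectivity on the whole parameter set: local growth shows that neither
  side of \<open>t\<close> is null, and strict monotonicity then holds globally.\<close>

lemma prob_above_inv_close:
  assumes t: "\<bar>t - dlog_partition \<mu> \<theta>\<^sub>0\<bar> \<le> \<sigma> / (4 * sqrt \<zeta>)"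
    and p: "\<bar>p - prob_above \<mu> t \<theta>\<^sub>0\<bar> \<le> \<rho> * (\<sigma> / (8 * sqrt \<zeta>))"
  shows "\<bar>prob_above_inv \<mu> t p - \<theta>\<^sub>0\<bar> \<le> 8 * sqrt \<zeta> * \<bar>p - prob_above \<mu> t \<theta>\<^sub>0\<bar> / \<sigma>"
proof -
  define c where "c = \<sigma> / (8 * sqrt \<zeta>)"
  have c: "c > 0" using \<sigma> \<zeta> by (simp add: c_def)
  define h where "h = \<bar>p - prob_above \<mu> t \<theta>\<^sub>0\<bar> / c"
  have h: "0 \<le> h" "h \<le> \<rho>" "h * c = \<bar>p - prob_above \<mu> t \<theta>\<^sub>0\<bar>"
    using c p by (simp_all add: h_def c_def[symmetric] pos_divide_le_eq)
  have ab: "\<theta>\<^sub>0 - h \<in> natural_params \<mu>" "\<theta>\<^sub>0 + h \<in> natural_params \<mu>"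
    using h \<rho> by (auto intro!: near_natural[OF loc])
  have "prob_above \<mu> t (\<theta>\<^sub>0 - h) \<le> p"
    using prob_above_growth[OF t, of "\<theta>\<^sub>0 - h" \<theta>\<^sub>0] h \<rho> unfolding c_def[symmetric] by auto
  moreover have "p \<le> prob_above \<mu> t (\<theta>\<^sub>0 + h)"
    using prob_above_growth[OF t, of \<theta>\<^sub>0 "\<theta>\<^sub>0 + h"] h \<rho> unfolding c_def[symmetric] by auto
  ultimately obtain \<theta> where \<theta>: "\<theta>\<^sub>0 - h \<le> \<theta>" "\<theta> \<le> \<theta>\<^sub>0 + h" "prob_above \<mu> t \<theta> = p"
    using IVT'[of "prob_above \<mu> t" "\<theta>\<^sub>0 - h" p "\<theta>\<^sub>0 + h"] h prob_above_continuous_on[OF sets_mu ab] by auto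
  have nat: "\<theta> \<in> natural_params \<mu>" by (rule natural_params_interval[OF sets_mu ab \<theta>(1,2)])
  have nats: "\<theta>\<^sub>0 \<in> natural_params \<mu>" "\<theta>\<^sub>0 + \<rho> \<in> natural_params \<mu>"
    using \<rho> r by (auto intro!: near_natural[OF loc])
  have "0 < \<rho> * c" using \<rho> c by simp
  also have "\<rho> * c \<le> prob_above \<mu> t (\<theta>\<^sub>0 + \<rho>) - prob_above \<mu> t \<theta>\<^sub>0"
    using prob_above_growth[OF t, of \<theta>\<^sub>0 "\<theta>\<^sub>0 + \<rho>"] \<rho> by (simp add: c_def)
  finally have lt: "prob_above \<mu> t \<theta>\<^sub>0 < prob_above \<mu> t (\<theta>\<^sub>0 + \<rho>)" by simp
  have above: "\<not> (AE x in \<mu>. x \<notin> {t<..})"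
  proof
    assume null: "AE x in \<mu>. x \<notin> {t<..}"
    have "prob_above \<mu> t \<theta> = 0" if "\<theta> \<in> natural_params \<mu>" for \<theta>
      using null moment0_zero_iff[OF sets_mu that, of "{t<..}"] by (simp add: prob_above_eq[OF sets_mu that])
    then show False using lt nats by simp
  qed
  have below: "\<not> (AE x in \<mu>. x \<notin> {..t})"
  proof
    assume null: "AE x in \<mu>. x \<notin> {..t}"
    have "prob_above \<mu> t \<theta> = 1" if "\<theta> \<in> natural_params \<mu>" for \<theta>
      using null moment0_zero_iff[OF sets_mu that, of "{..t}"] moment0_split[OF sets_mu that, of t] total_pos[OF loc that]
      by (simp add: prob_above_eq[OF sets_mu that])
    then show False using lt nats by simp
  qed
  have strict: "prob_above \<mu> t a < prob_above \<mu> t b"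
    if "a \<in> natural_params \<mu>" "b \<in> natural_params \<mu>" "a < b" for a b
    using that above below moment0_zero_iff[OF sets_mu that(1)] moment0_nonneg[OF sets_mu]
    by (intro prob_above_strict_mono[OF sets_mu]) (auto simp: less_le)
  have inj: "inj_on (prob_above \<mu> t) (natural_params \<mu>)"
  proof (rule inj_onI)
    fix x y assume "x \<in> natural_params \<mu>" "y \<in> natural_params \<mu>" "prob_above \<mu> t x = prob_above \<mu> t y"
    then show "x = y" using strict[of x y] strict[of y x] by (cases x y rule: linorder_cases) auto
  qed
  have "prob_above_inv \<mu> t p = \<theta>"
    using inj nat \<theta>(3) the_inv_into_f_eq[OF inj \<theta>(3) nat] by (auto simp: prob_above_inv_def)
  moreover have "8 * sqrt \<zeta> * \<bar>p - prob_above \<mu> t \<theta>\<^sub>0\<bar> / \<sigma> = h"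
    by (simp add: h_def c_def)
  ultimately show ?thesis using \<theta>(1,2) by auto
qed

end

section \<open>Accuracy of the algorithm\<close>

text \<open>Here \<open>u\<close> is \<open>\<eta>\<close> times the number of blocks, a tenth of
  which are bad, and \<open>g\<close> is the number of good labels. The good exponent
  \<open>9 / 40 * u\<close> exceeds \<open>1 + u / 10\<close>, the bound for both default and bad
  labels, by \<open>u / 8 - 1 \<ge> 99\<close>.\<close>

lemma sampler_failure_bound:
  fixes u W g l :: real
  assumes u: "u \<ge> 800" "u \<ge> 10 * l" and W: "W \<le> exp (1 + l)" and g: "0 < g" "g \<le> 4"
  shows "(W + exp (u / 10)) / exp (9 / 10 * u / g) \<le> 1 / 50"
proof -
  have "9 / 10 * u / 4 \<le> 9 / 10 * u / g" using u g by (intro divide_left_mono) auto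
  then have lo: "exp (9 / 40 * u) \<le> exp (9 / 10 * u / g)" by simp
  have "W \<le> exp (1 + u / 10)" using u(2) by (intro order_trans[OF W]) simp
  moreover have "exp (u / 10) \<le> exp (1 + u / 10)" by simp
  ultimately have up: "W + exp (u / 10) \<le> 2 * exp (1 + u / 10)" by linarith
  have "100 \<le> 1 + (u / 8 - 1)" using u by simp
  also have "\<dots> \<le> exp (u / 8 - 1)" by (rule exp_ge_add_one_self)
  finally have "100 * exp (1 + u / 10) \<le> exp (u / 8 - 1) * exp (1 + u / 10)" by (intro mult_right_mono) auto
  also have "\<dots> = exp (9 / 40 * u)" by (simp add: exp_add[symmetric])
  finally have "W + exp (u / 10) \<le> 1 / 50 * exp (9 / 10 * u / g)" using up lo by linarith
  then show ?thesis by (simp add: pos_divide_le_eq)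
qed

text \<open>Chebyshev's inequality with the variance of an indicator bounded by 1. The threshold is
  fixed, and the fraction reads the second half of the coordinates.\<close>

lemma frac_above_deviation:
  fixes D :: "real measure"
  assumes "prob_space D" and sD: "sets D = sets borel" and n: "n \<ge> 1"
  shows "{X \<in> space (PiM {..<2 * n} (\<lambda>_. D)).
      \<bar>frac_above n t (\<lambda>i\<in>{..<n}. X (n + i)) - measure D {t<..}\<bar> \<ge> 10 / sqrt n} \<in> sets (PiM {..<2 * n} (\<lambda>_. D))"
      (is "?A \<in> _")
    and "measure (PiM {..<2 * n} (\<lambda>_. D)) {X \<in> space (PiM {..<2 * n} (\<lambda>_. D)).
      \<bar>frac_above n t (\<lambda>i\<in>{..<n}. X (n + i)) - measure D {t<..}\<bar> \<ge> 10 / sqrt n} \<le> 1 / 100"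
proof -
  interpret D: prob_space D by fact
  note [measurable_cong] = sD
  have spD: "space D = UNIV" using sets_eq_imp_space_eq[OF sD] by simp
  let ?P = "PiM {..<2 * n} (\<lambda>_. D)"
  define p where "p = measure D {t<..}"
  define g where "g x = indicator {t<..} x - p" for x
  have g [measurable]: "g \<in> borel_measurable borel" by (simp add: g_def[abs_def])
  have p: "0 \<le> p" "p \<le> 1" by (auto simp: p_def)
  have g1: "\<bar>g x\<bar> \<le> 1" for x using p by (auto simp: g_def split: split_indicator)
  have g2: "(g x)\<^sup>2 \<le> 1" for x using g1[of x] by (simp add: abs_square_le_1)
  have int2: "integrable D (\<lambda>x. (g x)\<^sup>2)" using g2 by (intro D.integrable_const_bound[of _ 1]) auto
  have "integrable D (indicator {t<..} :: real \<Rightarrow> real)" by (intro integrable_real_indicator) (auto simp: D.emeasure_eq_measure sD)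
  then have g0: "(\<integral>x. g x \<partial>D) = 0"
    using D.prob_space by (simp add: g_def p_def spD)
  have "(\<integral>x. (g x)\<^sup>2 \<partial>D) \<le> (\<integral>x. 1 \<partial>D)" using g2 int2 by (intro integral_mono) auto
  then have v: "(\<integral>x. (g x)\<^sup>2 \<partial>D) \<le> 1" using D.prob_space by simp
  define I where "I = (\<lambda>i. n + i) ` {..<n}"
  have I: "I \<subseteq> {..<2 * n}" "card I = n" by (auto simp: I_def card_image)
  have n0: "real n > 0" using n by simp
  have f: "frac_above n t (\<lambda>i\<in>{..<n}. X (n + i)) - p = (\<Sum>l\<in>I. g (X l)) / real n" for X
  proof -
    have "(\<Sum>l\<in>I. g (X l)) = (\<Sum>i<n. g (X (n + i)))" unfolding I_def by (subst sum.reindex) auto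
    also have "\<dots> = (\<Sum>i<n. if (\<lambda>i\<in>{..<n}. X (n + i)) i > t then 1 else 0) - real n * p"
      unfolding g_def by (subst sum_subtractf) (auto intro!: sum.cong)
    finally show ?thesis using n0 by (simp add: frac_above_def field_simps)
  qed
  have eq: "?A = {X \<in> space ?P. 10 * sqrt n \<le> \<bar>\<Sum>l\<in>I. g (X l)\<bar>}"
  proof -
    have "10 / sqrt n \<le> \<bar>S / real n\<bar> \<longleftrightarrow> 10 * sqrt n \<le> \<bar>S\<bar>" for S
    proof -
      have "10 / sqrt n = 10 * sqrt n / real n"
        using n0 by (simp add: field_simps)
      then show ?thesis using n0 by (simp add: abs_divide divide_le_cancel)
    qed
    then show ?thesis unfolding p_def[symmetric] f by simp
  qed
  have comp: "(\<lambda>X. X l) \<in> borel_measurable ?P" if "l \<in> I" for l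
    using that I by (intro measurable_coordinate sD) auto
  have [measurable]: "(\<lambda>X. \<Sum>l\<in>I. g (X l)) \<in> borel_measurable ?P"
    using comp by (intro borel_measurable_sum measurable_compose[OF _ g])
  show "?A \<in> sets ?P" unfolding eq by measurable
  have "measure ?P ?A \<le> real (card I) * (\<integral>x. (g x)\<^sup>2 \<partial>D) / (10 * sqrt n)\<^sup>2"
    unfolding eq using n0 I by (intro Chebyshev_coordinates assms(1,2) g int2 g0) auto
  also have "\<dots> = (\<integral>x. (g x)\<^sup>2 \<partial>D) / 100" using n0 I by (simp add: power_mult_distrib)
  finally show "measure ?P ?A \<le> 1 / 100" using v by simp
qed

context expfam_neighbourhood
begin

lemma Count_close:
  assumes \<epsilon>: "\<epsilon> > 0" and n: "n \<ge> 1" and t: "\<bar>t - dlog_partition \<mu> \<theta>\<^sub>0\<bar> \<le> \<sigma> / (4 * sqrt \<zeta>)"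
    and f: "\<bar>frac_above n t X - prob_above \<mu> t \<theta>\<^sub>0\<bar> \<le> d"
    and small: "d + 38 / (\<epsilon> * real n) \<le> \<rho> * (\<sigma> / (8 * sqrt \<zeta>))"
  shows "measure (Count \<mu> n X t (\<epsilon> / 2)) {\<theta>. \<bar>\<theta> - \<theta>\<^sub>0\<bar> \<le> 8 * sqrt \<zeta> * (d + 38 / (\<epsilon> * real n)) / \<sigma>} \<ge> 19 / 20"
proof -
  define s where "s = 1 / (\<epsilon> / 2 * real n)"
  have s: "s > 0" "19 * s = 38 / (\<epsilon> * real n)" using \<epsilon> n by (simp_all add: s_def)
  interpret L: prob_space "laplace s" by (rule prob_space_laplace[OF s(1)])
  let ?S = "{\<theta>. \<bar>\<theta> - \<theta>\<^sub>0\<bar> \<le> 8 * sqrt \<zeta> * (d + 38 / (\<epsilon> * real n)) / \<sigma>}"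
  have S: "?S \<in> sets borel" by measurable
  have inv: "prob_above_inv \<mu> t -` ?S \<in> sets borel"
    using \<epsilon> n S by (intro measure_Count(2)[OF sets_mu]) auto
  \<comment> \<open>Counting runs at level \<open>\<epsilon> / 2\<close>, so
    \<open>s = 2 / (\<epsilon> * n)\<close> and \<open>38 / (\<epsilon> * n)\<close> is
    \<open>19 * s\<close>; the crude bound \<open>1 + 19 \<le> exp 19\<close> leaves failure
    probability 1/20.\<close>
  have "(20 :: real) \<le> exp 19" using exp_ge_add_one_self[of "19::real"] by simp
  then have "exp (- 19 :: real) \<le> 1 / 20" by (simp add: exp_minus field_simps)
  moreover have "- (19 * s) / s = - 19" using s(1) by simp
  ultimately have "19 / 20 \<le> 1 - exp (- (19 * s) / s)" by simp
  also have "\<dots> \<le> measure (laplace s) {z. \<bar>z\<bar> \<le> 19 * s}"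
    using s(1) by (intro laplace_concentration) auto
  also have "\<dots> \<le> measure (laplace s) {z. frac_above n t X + z \<in> prob_above_inv \<mu> t -` ?S}"
  proof (rule L.finite_measure_mono)
    show "{z. \<bar>z\<bar> \<le> 19 * s} \<subseteq> {z. frac_above n t X + z \<in> prob_above_inv \<mu> t -` ?S}"
    proof clarsimp
      fix z assume z: "\<bar>z\<bar> \<le> 19 * s"
      let ?p = "frac_above n t X + z"
      have p: "\<bar>?p - prob_above \<mu> t \<theta>\<^sub>0\<bar> \<le> d + 38 / (\<epsilon> * real n)" using z f s by linarith
      then have "\<bar>prob_above_inv \<mu> t ?p - \<theta>\<^sub>0\<bar> \<le> 8 * sqrt \<zeta> * \<bar>?p - prob_above \<mu> t \<theta>\<^sub>0\<bar> / \<sigma>"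
        using small by (intro prob_above_inv_close t) linarith
      also have "\<dots> \<le> 8 * sqrt \<zeta> * (d + 38 / (\<epsilon> * real n)) / \<sigma>"
        using p \<sigma> \<zeta> by (intro divide_right_mono mult_left_mono) auto
      finally show "\<bar>prob_above_inv \<mu> t ?p - \<theta>\<^sub>0\<bar> \<le> 8 * sqrt \<zeta> * (d + 38 / (\<epsilon> * real n)) / \<sigma>" .
    qed
    have "(\<lambda>z. frac_above n t X + z) -` (prob_above_inv \<mu> t -` ?S) \<inter> space borel \<in> sets borel"
      by (rule measurable_sets[OF _ inv]) simp
    then have "{z. frac_above n t X + z \<in> prob_above_inv \<mu> t -` ?S} \<in> sets borel"
      by (simp only: vimage_def mem_Collect_eq space_borel Int_UNIV_right)
    then show "{z. frac_above n t X + z \<in> prob_above_inv \<mu> t -` ?S} \<in> sets (laplace s)" unfolding sets_laplace .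
  qed
  also have "\<dots> = measure (Count \<mu> n X t (\<epsilon> / 2)) ?S"
    unfolding s_def by (rule measure_Count(1)[OF sets_mu _ n S, symmetric]) (use \<epsilon> in simp)
  finally show ?thesis .
qed

text \<open>Failure budget: 1/20 for too many bad blocks, 1/25 for a deviating fraction at one of
  the four thresholds, 1/50 for the sampler, 1/20 for the Laplace noise. The choice of
  \<open>\<tau>\<close> turns the label accuracy \<open>2 * \<tau> * \<sigma>\<close> into exactly
  the tolerance \<open>\<sigma> / (4 * sqrt \<zeta>)\<close>.\<close>

lemma A_high_close:
  fixes B n :: nat and \<epsilon> \<delta> :: real
  defines "\<tau> \<equiv> 1 / (8 * sqrt \<zeta>)" and "k \<equiv> n div B"
    and "R \<equiv> 8 * sqrt \<zeta> * (10 / sqrt n + 38 / (\<epsilon> * real n)) / \<sigma>"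
  assumes \<epsilon>: "0 < \<epsilon>" "\<epsilon> \<le> 2" and n: "n \<ge> 1" and \<delta>: "0 < \<delta>" "\<delta> \<le> 1"
    and B: "real B \<ge> 10 ^ 6 * \<zeta>" and k: "k > 0"
    and u: "\<epsilon> / 4 * real k \<ge> 800" "\<epsilon> / 4 * real k \<ge> 10 * ln (1 / \<delta>)"
    and small: "10 / sqrt n + 38 / (\<epsilon> * real n) \<le> \<rho> * (\<sigma> / (8 * sqrt \<zeta>))"
  shows "measure ((\<Pi>\<^sub>M i\<in>{..<2 * n}. expfam \<mu> \<theta>\<^sub>0) \<bind> pooled n (A_high \<mu> n \<epsilon> (mean_estimator B \<tau> \<delta> \<epsilon> n)))
    {\<theta>. \<bar>\<theta> - \<theta>\<^sub>0\<bar> \<le> R} \<ge> 3 / 4"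
proof -
  define D where "D = expfam \<mu> \<theta>\<^sub>0"
  define m where "m = dlog_partition \<mu> \<theta>\<^sub>0"
  define M where "M = mean_estimator B \<tau> \<delta> \<epsilon> n"
  define G where "G = good_labels \<tau> \<sigma> m"
  define W where "W = exp (\<epsilon> / 2) / \<delta>"
  define S where "S = {\<theta>. \<bar>\<theta> - \<theta>\<^sub>0\<bar> \<le> R}"
  let ?P = "\<Pi>\<^sub>M i\<in>{..<2 * n}. D"
  have \<zeta>1: "\<zeta> \<ge> 1" by (rule zeta_ge_1)
  have \<tau>: "0 < \<tau>" "\<tau> \<le> 1 / 8" using \<zeta>1 by (auto simp: \<tau>_def intro!: divide_left_mono)
  have B0: "B > 0" using B \<zeta>1 by (intro Nat.gr0I) auto
  have n0: "\<theta>\<^sub>0 \<in> natural_params \<mu>" using r by (intro near_natural[OF loc]) simp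
  have pD: "prob_space D" unfolding D_def by (rule prob_space_expfam[OF n0])
  have sD: "sets D = sets borel" unfolding D_def by (rule sets_expfam[OF sets_mu])
  interpret P: prob_space ?P by (intro prob_space_PiM pD)
  have sP: "sets ?P = sets (datasets (2 * n))" by (intro sets_PiM_cong) (auto simp: sD)
  have spP: "space ?P = space (datasets (2 * n))" by (rule sets_eq_imp_space_eq[OF sP])
  have PP: "?P \<in> space (prob_algebra (datasets (2 * n)))"
    using sP P.prob_space_axioms by (simp add: space_prob_algebra)
  have Mp: "diff_private n (\<epsilon> / 2) \<delta> M" unfolding M_def using \<epsilon> \<delta> B0 by (intro mean_estimator_private) auto
  then have Mk: "M \<in> datasets n \<rightarrow>\<^sub>M prob_algebra borel" by (simp add: diff_private_def)
  have kern: "pooled n (A_high \<mu> n \<epsilon> M) \<in> datasets (2 * n) \<rightarrow>\<^sub>M prob_algebra borel"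
    by (rule A_high_kernel[OF sets_mu \<epsilon>(1) n Mk])
  have S: "S \<in> sets borel" unfolding S_def by measurable
  have G: "finite G" "G \<noteq> {}" "card G \<le> 4" unfolding G_def by (rule finite_good_labels)+
  have Gb: "G \<in> sets borel" using G by (intro borel_closed finite_imp_closed)
  have Gclose: "\<bar>t - m\<bar> \<le> \<sigma> / (4 * sqrt \<zeta>)" if "t \<in> G" for t
    using good_labels_close[OF \<tau>(1) \<sigma>, of t m] that by (simp add: G_def \<tau>_def field_simps)

  define bad where "bad X = (\<Sum>i<k. if block_label B \<tau> X i \<in> G then 0 else 1 :: real)" for X
  define A0 where "A0 = {X \<in> space ?P. real k / 10 \<le> bad X}"
  define A where "A t = {X \<in> space ?P. \<bar>frac_above n t (\<lambda>i\<in>{..<n}. X (n + i)) - measure D {t<..}\<bar> \<ge> 10 / sqrt n}" for t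
  have mb: "bad \<in> borel_measurable ?P" "measure ?P A0 \<le> 10 * (64 / \<tau>\<^sup>2 + 16 * \<zeta>) / real B"
    using many_blocks_good[OF pD sD \<sigma> \<tau> B0 _ _ expfam_mean[folded D_def] expfam_variance[folded D_def]
        expfam_integrable_fourth[folded D_def] fourth[folded D_def], where n = n and N = "2 * n"] k
    unfolding A0_def bad_def[abs_def] G_def k_def m_def by auto
  have A0: "A0 \<in> sets ?P" unfolding A0_def using mb(1) by measurable
  have A: "A t \<in> sets ?P" "measure ?P (A t) \<le> 1 / 100" for t
    unfolding A_def by (rule frac_above_deviation[OF pD sD n])+
  \<comment> \<open>As \<open>64 / \<tau>\<^sup>2 = 4096 * \<zeta>\<close>, the factor
    \<open>10 ^ 6\<close> in the block size is a round number above
    \<open>20 * 41120\<close>.\<close>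
  have "10 * (64 / \<tau>\<^sup>2 + 16 * \<zeta>) = 41120 * \<zeta>" using \<zeta>1 by (simp add: \<tau>_def power_mult_distrib power_divide)
  then have "measure ?P A0 \<le> 41120 * \<zeta> / real B" using mb(2) by simp
  also have "\<dots> \<le> 41120 * \<zeta> / (10 ^ 6 * \<zeta>)" using B \<zeta>1 B0 by (intro divide_left_mono) auto
  also have "\<dots> \<le> 1 / 20" using \<zeta>1 by simp
  finally have PA0: "measure ?P A0 \<le> 1 / 20" .
  have "measure ?P (\<Union>t\<in>G. A t) \<le> (\<Sum>t\<in>G. measure ?P (A t))"
    using G A by (intro measure_UNION_le) auto
  also have "\<dots> \<le> (\<Sum>t\<in>G. 1 / 100)" by (intro sum_mono A)
  also have "\<dots> \<le> 1 / 25" using G by simp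
  finally have PA: "measure ?P (\<Union>t\<in>G. A t) \<le> 1 / 25" .
  define good where "good = space ?P - (A0 \<union> (\<Union>t\<in>G. A t))"
  have UA: "A0 \<union> (\<Union>t\<in>G. A t) \<in> sets ?P"
    using G by (intro sets.Un A0 sets.finite_UN A) auto
  then have good: "good \<in> sets ?P" by (auto simp: good_def)
  have "measure ?P (A0 \<union> (\<Union>t\<in>G. A t)) \<le> measure ?P A0 + measure ?P (\<Union>t\<in>G. A t)"
    using G by (intro measure_Un_le A0 sets.finite_UN A) auto
  then have Pgood: "measure ?P good \<ge> 91 / 100"
    unfolding good_def P.prob_compl[OF UA] using PA0 PA by linarith

  have W: "W \<ge> 1" "W \<le> exp (1 + ln (1 / \<delta>))"
  proof -
    have "1 \<le> exp (\<epsilon> / 2)" using \<epsilon> by simp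
    then show "W \<ge> 1" using \<delta> order_trans[OF \<delta>(2)] by (simp add: W_def)
    have "exp (1 + ln (1 / \<delta>)) = exp 1 / \<delta>" using \<delta> by (simp add: exp_add)
    then show "W \<le> exp (1 + ln (1 / \<delta>))"
      using \<epsilon> \<delta> unfolding W_def by (simp only:) (intro divide_right_mono, auto)
  qed
  have on_good: "measure (pooled n (A_high \<mu> n \<epsilon> M) X) S \<ge> 9 / 10" if X: "X \<in> good" for X
  proof -
    define X1 X2 where "X1 = (\<lambda>i\<in>{..<n}. X i)" and "X2 = (\<lambda>i\<in>{..<n}. X (n + i))"
    have sp: "X1 \<in> space (datasets n)" "X2 \<in> space (datasets n)" by (auto simp: X1_def X2_def space_PiM)
    have lab: "block_label B \<tau> X1 i = block_label B \<tau> X i" if "i < k" for i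
      using that block_index_less[of i n B] by (intro block_label_cong) (auto simp: X1_def k_def)
    have "bad X < real k / 10" using X by (auto simp: good_def A0_def)
    then have bad: "(\<Sum>i<k. if block_label B \<tau> X1 i \<in> G then 0 else 1) \<le> real k / 10"
      using lab by (simp add: bad_def)
    have MX: "M X1 = label_sampler k (\<epsilon> / 4) W (block_label B \<tau> X1)"
      using \<delta> by (simp add: M_def mean_estimator_def k_def W_def)
    have MN: "M X1 \<in> space (prob_algebra borel)" by (rule measurable_space[OF Mk sp(1)])
    then have sM: "sets (M X1) = sets borel" by (simp add: space_prob_algebra)
    interpret N: prob_space "M X1" using MN by (simp add: space_prob_algebra)
    have "measure (M X1) (- G) \<le> (W + exp (\<epsilon> / 4 * (real k / 10))) / exp (\<epsilon> / 4 * ((real k - real k / 10) / card G))"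
      unfolding MX using \<epsilon> W G bad by (intro label_sampler_utility) auto
    also have "\<dots> = (W + exp ((\<epsilon> / 4 * real k) / 10)) / exp (9 / 10 * (\<epsilon> / 4 * real k) / card G)"
      by simp
    also have "\<dots> \<le> 1 / 50"
      using u W(2) G by (intro sampler_failure_bound[where l = "ln (1 / \<delta>)"]) (auto simp: card_gt_0_iff)
    finally have "measure (M X1) (- G) \<le> 1 / 50" .
    moreover have "measure (M X1) (- G) = 1 - measure (M X1) G"
      using N.prob_compl[of G] Gb sets_eq_imp_space_eq[OF sM] by (simp add: sM Compl_eq_Diff_UNIV)
    ultimately have MG: "measure (M X1) G \<ge> 49 / 50" by simp
    have pt: "19 / 20 * indicator G t \<le> measure (Count \<mu> n X2 t (\<epsilon> / 2)) S" for t
    proof (cases "t \<in> G")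
      case True
      then have "\<bar>frac_above n t X2 - measure D {t<..}\<bar> \<le> 10 / sqrt n"
        using X by (auto simp: good_def A_def X2_def)
      then have "\<bar>frac_above n t X2 - prob_above \<mu> t \<theta>\<^sub>0\<bar> \<le> 10 / sqrt n" by (simp add: prob_above_def D_def)
      then have "19 / 20 \<le> measure (Count \<mu> n X2 t (\<epsilon> / 2)) S"
        unfolding S_def R_def by (intro Count_close[OF \<epsilon>(1) n Gclose[OF True, unfolded m_def] _ small])
      then show ?thesis using True by simp
    qed simp
    note Ck = Count_kernel[OF sets_mu _ n sp(2), of "\<epsilon> / 2"]
    have "19 / 20 * measure (M X1) G = (\<integral>t. 19 / 20 * indicator G t \<partial>M X1)"
      using Gb by (simp add: sM sets_eq_imp_space_eq[OF sM])
    also have "\<dots> \<le> (\<integral>t. measure (Count \<mu> n X2 t (\<epsilon> / 2)) S \<partial>M X1)"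
      using Gb \<epsilon> pt by (intro integral_mono measure_bind_kernel(2)[OF MN Ck S] integrable_mult_right integrable_real_indicator)
        (auto simp: sM N.emeasure_eq_measure)
    also have "\<dots> = measure (M X1 \<bind> (\<lambda>t. Count \<mu> n X2 t (\<epsilon> / 2))) S"
      using \<epsilon> by (intro measure_bind_kernel(1)[OF MN Ck S, symmetric]) auto
    also have "M X1 \<bind> (\<lambda>t. Count \<mu> n X2 t (\<epsilon> / 2)) = pooled n (A_high \<mu> n \<epsilon> M) X"
      by (simp add: pooled_def A_high_def X1_def X2_def)
    finally show ?thesis using MG by simp
  qed
  \<comment> \<open>On \<open>good\<close> the success probability is at least
    \<open>49 / 50 * (19 / 20)\<close>, hence above 9/10; together with the 91/100 for
    \<open>good\<close> this exceeds 3/4.\<close>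
  have "9 / 10 * measure ?P good = (\<integral>X. 9 / 10 * indicator good X \<partial>?P)"
    using good by (simp add: Int_absorb2 sets.sets_into_space)
  also have "\<dots> \<le> (\<integral>X. measure (pooled n (A_high \<mu> n \<epsilon> M) X) S \<partial>?P)"
    using good on_good
    by (intro integral_mono measure_bind_kernel(2)[OF PP kern S] integrable_mult_right integrable_real_indicator)
      (auto simp: P.emeasure_eq_measure split: split_indicator)
  also have "\<dots> = measure (?P \<bind> pooled n (A_high \<mu> n \<epsilon> M)) S"
    by (rule measure_bind_kernel(1)[OF PP kern S, symmetric])
  finally show ?thesis using Pgood unfolding S_def M_def D_def by simp
qed

end

text \<open>\<open>kappa\<close> is a supremum that need not be attained, so only a radius above
  \<open>q / 2\<close> is claimed. The lower ratio bound 1/2 also forces the second derivative to be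
  positive nearby.\<close>

lemma kappa_neighbourhood:
  assumes d2: "d2log_partition \<mu> \<theta>\<^sub>0 > 0" and q: "q > 0" "ereal q \<le> kappa \<mu> \<theta>\<^sub>0"
  obtains r where "r > q / 2" "\<theta>\<^sub>0 - r \<in> natural_params \<mu>" "\<theta>\<^sub>0 + r \<in> natural_params \<mu>"
    "\<And>\<theta>. \<bar>\<theta> - \<theta>\<^sub>0\<bar> < r \<Longrightarrow> d2log_partition \<mu> \<theta> \<le> 2 * d2log_partition \<mu> \<theta>\<^sub>0"
proof -
  have "ereal (q / 2) < ereal q" using q by simp
  also note q(2)
  finally obtain r where r: "q / 2 < r" "0 \<le> r"
      "\<And>\<theta>. \<theta> \<in> {\<theta>\<^sub>0 - r..\<theta>\<^sub>0 + r} \<Longrightarrow> \<theta> \<in> natural_params \<mu> \<and>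
        d2log_partition \<mu> \<theta>\<^sub>0 / d2log_partition \<mu> \<theta> \<in> {1/2..2}"
    unfolding kappa_def less_Sup_iff by auto
  show ?thesis
  proof (rule that[OF r(1)])
    show "\<theta>\<^sub>0 - r \<in> natural_params \<mu>" "\<theta>\<^sub>0 + r \<in> natural_params \<mu>" using r(2,3) by auto
    fix \<theta> assume "\<bar>\<theta> - \<theta>\<^sub>0\<bar> < r"
    then have "\<theta> \<in> {\<theta>\<^sub>0 - r..\<theta>\<^sub>0 + r}" by auto
    then have half: "1 / 2 \<le> d2log_partition \<mu> \<theta>\<^sub>0 / d2log_partition \<mu> \<theta>" using r(3) by auto
    then have "0 < d2log_partition \<mu> \<theta>\<^sub>0 / d2log_partition \<mu> \<theta>" by linarith
    then have "d2log_partition \<mu> \<theta> > 0" using d2 by (simp add: zero_less_divide_iff)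
    then show "d2log_partition \<mu> \<theta> \<le> 2 * d2log_partition \<mu> \<theta>\<^sub>0" using half by (simp add: field_simps)
  qed
qed

text \<open>The radius is \<open>\<rho>\<^sub>0 / \<sigma>\<close> with
  \<open>\<rho>\<^sub>0\<close> independent of the family: \<open>1 / (2 * C)\<close> is half of the
  radius granted by \<open>kappa\<close>, and \<open>1 / (16 * sqrt \<zeta>)\<close> controls the
  covariance drift. The number \<open>\<beta> / (2 * \<sigma>)\<close> lies below the total
  variation modulus at \<open>\<beta>\<close> and links it to the risk. The bound on
  \<open>ln (1 / \<delta>)\<close> is conditional because \<open>\<zeta> \<ge> 1\<close> is only
  derived inside.\<close>

lemma A_high_accuracy:
  fixes \<mu> :: "real measure" and B n :: nat and \<theta>\<^sub>0 \<zeta> C b \<epsilon> \<delta> :: real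
  defines "\<sigma> \<equiv> sqrt (d2log_partition \<mu> \<theta>\<^sub>0)" and "\<rho>\<^sub>0 \<equiv> min (1 / (2 * C)) (1 / (16 * sqrt \<zeta>))"
    and "\<beta> \<equiv> 1 / (\<epsilon> * real n)" and "k \<equiv> n div B"
  assumes sets_mu: "sets \<mu> = sets borel" and d2: "d2log_partition \<mu> \<theta>\<^sub>0 > 0" and \<zeta>: "\<zeta> > 0" and C: "C > 0"
    and fourth: "(\<integral>x. (x - dlog_partition \<mu> \<theta>\<^sub>0) ^ 4 \<partial>expfam \<mu> \<theta>\<^sub>0) / (d2log_partition \<mu> \<theta>\<^sub>0)\<^sup>2 \<le> \<zeta>"
    and kappa: "kappa \<mu> \<theta>\<^sub>0 \<ge> ereal (1 / C * (1 / \<sigma>))"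
    and \<epsilon>: "0 < \<epsilon>" "\<epsilon> \<le> 2" and n: "n \<ge> 1" and \<delta>: "0 < \<delta>" "\<delta> \<le> 1"
    and B: "real B \<ge> 10 ^ 6 * \<zeta>" and k: "k > 0"
    and u: "\<epsilon> / 4 * real k \<ge> 800" "\<zeta> \<ge> 1 \<Longrightarrow> \<epsilon> / 4 * real k \<ge> 10 * ln (1 / \<delta>)"
    and b: "b > 0" "1 / sqrt n \<le> b * \<beta>" and small: "(10 * b + 38) * \<beta> \<le> \<rho>\<^sub>0 / (8 * sqrt \<zeta>)"
  shows "risk n \<mu> \<theta>\<^sub>0 (A_high \<mu> n \<epsilon> (mean_estimator B (1 / (8 * sqrt \<zeta>)) \<delta> \<epsilon> n))
      \<le> ereal (16 * sqrt \<zeta> * (10 * b + 38)) * J_TV_inv \<mu> \<theta>\<^sub>0 \<beta>"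
    and "J_TV_inv \<mu> \<theta>\<^sub>0 \<beta> \<le> ereal (8 * sqrt \<zeta> * \<beta> / \<sigma>)"
proof -
  have \<sigma>: "\<sigma> > 0" "\<sigma>\<^sup>2 = d2log_partition \<mu> \<theta>\<^sub>0" using d2 by (simp_all add: \<sigma>_def)
  obtain r where r: "r > 1 / C * (1 / \<sigma>) / 2" "\<theta>\<^sub>0 - r \<in> natural_params \<mu>" "\<theta>\<^sub>0 + r \<in> natural_params \<mu>"
    "\<And>\<theta>. \<bar>\<theta> - \<theta>\<^sub>0\<bar> < r \<Longrightarrow> d2log_partition \<mu> \<theta> \<le> 2 * d2log_partition \<mu> \<theta>\<^sub>0"
    using kappa C \<sigma> by (elim kappa_neighbourhood[OF d2, rotated]) auto
  have \<rho>0: "\<rho>\<^sub>0 > 0" using C \<zeta> by (simp add: \<rho>\<^sub>0_def)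
  have "0 < 1 / C * (1 / \<sigma>) / 2" using C \<sigma> by simp
  then have r0: "r > 0" using r(1) by linarith
  have \<rho>C: "\<rho>\<^sub>0 / \<sigma> \<le> 1 / C * (1 / \<sigma>) / 2"
  proof -
    have "\<rho>\<^sub>0 / \<sigma> \<le> 1 / (2 * C) / \<sigma>" using \<sigma> by (intro divide_right_mono) (auto simp: \<rho>\<^sub>0_def)
    then show ?thesis by simp
  qed
  have \<rho>\<zeta>: "\<rho>\<^sub>0 / \<sigma> \<le> 1 / (16 * sqrt \<zeta> * \<sigma>)"
  proof -
    have "\<rho>\<^sub>0 / \<sigma> \<le> 1 / (16 * sqrt \<zeta>) / \<sigma>" using \<sigma> by (intro divide_right_mono) (auto simp: \<rho>\<^sub>0_def)
    then show ?thesis by simp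
  qed
  have \<sigma>4: "\<sigma> ^ 4 = (d2log_partition \<mu> \<theta>\<^sub>0)\<^sup>2" unfolding \<sigma>(2)[symmetric] by simp
  interpret expfam_neighbourhood \<mu> \<theta>\<^sub>0 r \<sigma> \<zeta> "\<rho>\<^sub>0 / \<sigma>"
  proof
    show "(\<integral>x. (x - dlog_partition \<mu> \<theta>\<^sub>0) ^ 4 \<partial>expfam \<mu> \<theta>\<^sub>0) \<le> \<zeta> * \<sigma> ^ 4"
      using fourth d2 unfolding \<sigma>4 by (simp add: pos_divide_le_eq)
    show "\<rho>\<^sub>0 / \<sigma> < r" using \<rho>C r(1) by linarith
    show "\<And>\<theta>. \<bar>\<theta> - \<theta>\<^sub>0\<bar> < r \<Longrightarrow> d2log_partition \<mu> \<theta> \<le> 2 * \<sigma>\<^sup>2" using r(4) \<sigma>(2) by simp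
  qed (use sets_mu r0 r(2,3) \<sigma> \<zeta> \<rho>0 \<rho>\<zeta> in auto)
  have \<zeta>1: "\<zeta> \<ge> 1" by (rule zeta_ge_1)
  have \<beta>: "\<beta> > 0" using \<epsilon> n by (simp add: \<beta>_def)
  \<comment> \<open>\<open>K * \<beta>\<close> covers the sampling error
    \<open>10 / sqrt n \<le> 10 * b * \<beta>\<close> and the Laplace noise
    \<open>38 * \<beta>\<close>.\<close>
  define K where "K = 10 * b + 38"
  have K: "K > 38" using b by (simp add: K_def)
  have c8: "\<rho>\<^sub>0 / \<sigma> * (\<sigma> / (8 * sqrt \<zeta>)) = \<rho>\<^sub>0 / (8 * sqrt \<zeta>)" using \<sigma> by simp
  have small': "K * \<beta> \<le> \<rho>\<^sub>0 / (8 * sqrt \<zeta>)" using small by (simp add: K_def)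
  have noise: "10 / sqrt n + 38 / (\<epsilon> * real n) \<le> K * \<beta>"
  proof -
    have "10 / sqrt n = 10 * (1 / sqrt n)" "38 / (\<epsilon> * real n) = 38 * \<beta>" by (simp_all add: \<beta>_def)
    then show ?thesis using b(2) unfolding K_def by (simp only: distrib_right)
  qed
  then have noise_small: "10 / sqrt n + 38 / (\<epsilon> * real n) \<le> \<rho>\<^sub>0 / \<sigma> * (\<sigma> / (8 * sqrt \<zeta>))"
    unfolding c8 using small' by linarith
  define R where "R = 8 * sqrt \<zeta> * (10 / sqrt n + 38 / (\<epsilon> * real n)) / \<sigma>"
  have "R \<ge> 0" unfolding R_def using \<sigma> \<zeta> \<epsilon> by simp
  moreover have "measure ((\<Pi>\<^sub>M i\<in>{..<2 * n}. expfam \<mu> \<theta>\<^sub>0) \<bind>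
      pooled n (A_high \<mu> n \<epsilon> (mean_estimator B (1 / (8 * sqrt \<zeta>)) \<delta> \<epsilon> n))) {\<theta>. \<bar>\<theta> - \<theta>\<^sub>0\<bar> \<le> R} \<ge> 3 / 4"
    unfolding R_def using k u(1) u(2)[OF \<zeta>1]
    by (intro A_high_close \<epsilon> n \<delta> B noise_small) (auto simp: k_def)
  ultimately have "risk n \<mu> \<theta>\<^sub>0 (A_high \<mu> n \<epsilon> (mean_estimator B (1 / (8 * sqrt \<zeta>)) \<delta> \<epsilon> n)) \<le> ereal R"
    unfolding risk_def by (intro Inf_lower) auto
  also have "R \<le> 16 * sqrt \<zeta> * K * (\<beta> / (2 * \<sigma>))"
  proof -
    have "R \<le> 8 * sqrt \<zeta> * (K * \<beta>) / \<sigma>"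
      unfolding R_def using noise \<sigma> \<zeta> by (intro divide_right_mono mult_left_mono) auto
    then show ?thesis using \<sigma> by (simp add: mult_ac)
  qed
  then have "ereal R \<le> ereal (16 * sqrt \<zeta> * K) * ereal (\<beta> / (2 * \<sigma>))" by simp
  also have "\<dots> \<le> ereal (16 * sqrt \<zeta> * K) * J_TV_inv \<mu> \<theta>\<^sub>0 \<beta>"
  proof (intro ereal_mult_left_mono J_TV_inv_lower \<beta>)
    have "\<beta> \<le> K * \<beta>" using K \<beta> by simp
    also note small'
    also have "1 \<le> 8 * sqrt \<zeta>" using real_sqrt_ge_one[OF \<zeta>1] by linarith
    then have "\<rho>\<^sub>0 / (8 * sqrt \<zeta>) \<le> \<rho>\<^sub>0 / 1" using \<zeta>1 \<rho>0 by (intro divide_left_mono) auto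
    finally have "\<beta> / 2 \<le> \<rho>\<^sub>0" using \<beta> by simp
    then have "\<beta> / 2 / \<sigma> \<le> \<rho>\<^sub>0 / \<sigma>" using \<sigma> by (intro divide_right_mono) auto
    then show "\<beta> / (2 * \<sigma>) \<le> \<rho>\<^sub>0 / \<sigma>" by simp
    show "0 \<le> ereal (16 * sqrt \<zeta> * K)" using K \<zeta> by simp
  qed
  finally show "risk n \<mu> \<theta>\<^sub>0 (A_high \<mu> n \<epsilon> (mean_estimator B (1 / (8 * sqrt \<zeta>)) \<delta> \<epsilon> n))
      \<le> ereal (16 * sqrt \<zeta> * (10 * b + 38)) * J_TV_inv \<mu> \<theta>\<^sub>0 \<beta>"
    by (simp add: K_def)
  have "1 * \<beta> < K * \<beta>" using K \<beta> by (intro mult_strict_right_mono) auto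
  then have "\<beta> < \<rho>\<^sub>0 / \<sigma> * (\<sigma> / (8 * sqrt \<zeta>))" unfolding c8 using small' by linarith
  then show "J_TV_inv \<mu> \<theta>\<^sub>0 \<beta> \<le> ereal (8 * sqrt \<zeta> * \<beta> / \<sigma>)"
    using \<beta> by (intro J_TV_inv_upper) auto
qed

theorem proposition4p10:
  shows "(\<forall>(\<mu> :: real measure) n \<epsilon> \<delta> M.
            sets \<mu> = sets borel \<longrightarrow> n \<ge> 1 \<longrightarrow> \<epsilon> > 0 \<longrightarrow> \<delta> \<in> {0..1} \<longrightarrow>
            diff_private n (\<epsilon> / 2) \<delta> M \<longrightarrow>
            diff_private (2 * n) \<epsilon> \<delta> (pooled n (A_high \<mu> n \<epsilon> M)))
       \<and>
         (\<exists>c>0. \<forall>\<zeta>>0. \<forall>C>0. \<forall>\<delta> :: nat \<Rightarrow> real. (\<forall>n. \<delta> n \<in> {0..1}) \<longrightarrow>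
            (\<exists>M :: real \<Rightarrow> nat \<Rightarrow> mechanism.
               (\<forall>e>0. \<forall>n. diff_private n (e / 2) (\<delta> n) (M e n)) \<and>
               (\<forall>a>0. \<forall>b>0. \<forall>m\<ge>1 :: nat. \<exists>(N :: nat) C' K. C' > 0 \<and> K > 0 \<and>
                  (\<forall>(\<epsilon> :: nat \<Rightarrow> real) (\<mu> :: real measure) \<theta>\<^sub>0.
                     (\<forall>n. \<epsilon> n > 0) \<longrightarrow>
                     (\<forall>n\<ge>m. a * (ln (real n) / real n) \<le> \<epsilon> n \<and> \<epsilon> n \<le> b * (1 / sqrt (real n))) \<longrightarrow>
                     sets \<mu> = sets borel \<longrightarrow>
                     \<theta>\<^sub>0 \<in> natural_params \<mu> \<longrightarrow>
                     d2log_partition \<mu> \<theta>\<^sub>0 > 0 \<longrightarrow>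
                     (\<integral>x. (x - dlog_partition \<mu> \<theta>\<^sub>0) ^ 4 \<partial>expfam \<mu> \<theta>\<^sub>0)
                        / (d2log_partition \<mu> \<theta>\<^sub>0)\<^sup>2 \<le> \<zeta> \<longrightarrow>
                     kappa \<mu> \<theta>\<^sub>0 \<ge> ereal (1 / C * (1 / sqrt (d2log_partition \<mu> \<theta>\<^sub>0))) \<longrightarrow>
                     (\<forall>n. kappa \<mu> \<theta>\<^sub>0 \<ge> J_TV_inv \<mu> \<theta>\<^sub>0 (1 / (\<epsilon> n * real n)) \<longrightarrow>
                        \<delta> n > 0 \<longrightarrow>
                        real n \<ge> max (real N) (c * \<zeta>\<^sup>2 * ln (1 / \<delta> n) / \<epsilon> n) \<longrightarrow>
                        risk n \<mu> \<theta>\<^sub>0 (A_high \<mu> n (\<epsilon> n) (M (\<epsilon> n) n))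
                          \<le> ereal C' * J_TV_inv \<mu> \<theta>\<^sub>0 (1 / (\<epsilon> n * real n)) \<and>
                        ereal C' * J_TV_inv \<mu> \<theta>\<^sub>0 (1 / (\<epsilon> n * real n))
                          \<le> ereal (K * (1 / (real n * \<epsilon> n * sqrt (d2log_partition \<mu> \<theta>\<^sub>0)))))))))"
  (is "?private \<and> ?accurate")
proof
  show ?private using A_high_private by auto
  \<comment> \<open>This is \<open>80 * 2 * 10 ^ 6\<close>: the sampler needs
    \<open>\<epsilon> * n \<ge> 80 * B * ln (1 / \<delta>)\<close> when at least
    \<open>n / (2 * B)\<close> blocks are available, and
    \<open>B \<le> 2 * 10 ^ 6 * \<zeta>\<^sup>2\<close> for \<open>\<zeta> \<ge> 1\<close>.\<close>
  define c :: real where "c = 160000000"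
  show ?accurate
  proof (rule exI[of _ c], intro conjI allI impI, goal_cases)
    case 1
    show ?case by (simp add: c_def)
  next
    case (2 \<zeta> C \<delta>)
    then have \<zeta>: "\<zeta> > 0" and C: "C > 0" and \<delta>: "\<forall>n. \<delta> n \<in> {0..1}" by auto
    define B where "B = nat \<lceil>10 ^ 6 * \<zeta>\<rceil>"
    have "10 ^ 6 * \<zeta> > 0" using \<zeta> by simp
    then have B: "real B \<ge> 10 ^ 6 * \<zeta>" "real B \<le> 10 ^ 6 * \<zeta> + 1" and B0: "real B > 0"
      unfolding B_def by linarith+
    \<comment> \<open>Fixed before \<open>a\<close>, \<open>b\<close> and the family: block size and
      relative grid width depend on \<open>\<zeta>\<close> alone, while location and scale are read
      off the data.\<close>
    define M where "M e n = mean_estimator B (1 / (8 * sqrt \<zeta>)) (\<delta> n) e n" for e n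
    show ?case
    proof (rule exI[of _ M], intro conjI allI impI, goal_cases)
      case (1 e n)
      then show ?case
        unfolding M_def using \<delta> B0 by (intro mean_estimator_private) auto
    next
      case (2 a b m)
      then have a: "a > 0" and b: "b > 0" and m: "m \<ge> 1" by auto
      define \<rho>\<^sub>0 where "\<rho>\<^sub>0 = min (1 / (2 * C)) (1 / (16 * sqrt \<zeta>))"
      define H where "H = 10 * b + 38"
      \<comment> \<open>Since \<open>\<epsilon> * n \<ge> a * ln n \<ge> a * L\<close>, the first
        entry gives the sampler its exponent 800, and the second keeps the total error inside the
        neighbourhood.\<close>
      define L where "L = max (6400 * real B / a) (8 * sqrt \<zeta> * H / (\<rho>\<^sub>0 * a))"
      \<comment> \<open>\<open>m\<close> activates the bounds on \<open>\<epsilon>\<close>,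
        \<open>2 * B\<close> limits the loss in \<open>n div B\<close> to a factor 2,
        \<open>b\<^sup>2\<close> gives \<open>\<epsilon> \<le> 1\<close>, and \<open>exp L\<close>
        gives \<open>ln n \<ge> L\<close>.\<close>
      define N where "N = max m (max (2 * B) (max (nat \<lceil>b\<^sup>2\<rceil>) (nat \<lceil>exp L\<rceil>)))"
      define C' where "C' = 16 * sqrt \<zeta> * H"
      define K where "K = C' * (8 * sqrt \<zeta>)"
      have \<rho>0: "\<rho>\<^sub>0 > 0" using C \<zeta> by (simp add: \<rho>\<^sub>0_def)
      have H: "H > 0" using b by (simp add: H_def)
      have C': "C' > 0" using H \<zeta> by (simp add: C'_def)
      have K: "K > 0" using C' \<zeta> by (simp add: K_def)
      have main: "risk n \<mu> \<theta>\<^sub>0 (A_high \<mu> n (\<epsilon> n) (M (\<epsilon> n) n)) \<le> ereal C' * J_TV_inv \<mu> \<theta>\<^sub>0 (1 / (\<epsilon> n * real n)) \<and>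
          ereal C' * J_TV_inv \<mu> \<theta>\<^sub>0 (1 / (\<epsilon> n * real n)) \<le> ereal (K * (1 / (real n * \<epsilon> n * sqrt (d2log_partition \<mu> \<theta>\<^sub>0))))"
        if \<epsilon>0: "\<forall>n. \<epsilon> n > 0"
          and \<epsilon>: "\<forall>n\<ge>m. a * (ln (real n) / real n) \<le> \<epsilon> n \<and> \<epsilon> n \<le> b * (1 / sqrt (real n))"
          and sets_mu: "sets \<mu> = sets borel" and d2: "d2log_partition \<mu> \<theta>\<^sub>0 > 0"
          and fourth: "(\<integral>x. (x - dlog_partition \<mu> \<theta>\<^sub>0) ^ 4 \<partial>expfam \<mu> \<theta>\<^sub>0) / (d2log_partition \<mu> \<theta>\<^sub>0)\<^sup>2 \<le> \<zeta>"
          and kappa: "kappa \<mu> \<theta>\<^sub>0 \<ge> ereal (1 / C * (1 / sqrt (d2log_partition \<mu> \<theta>\<^sub>0)))"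
          and \<delta>n: "\<delta> n > 0" and nN: "real n \<ge> max (real N) (c * \<zeta>\<^sup>2 * ln (1 / \<delta> n) / \<epsilon> n)"
        for \<epsilon> :: "nat \<Rightarrow> real" and \<mu> :: "real measure" and \<theta>\<^sub>0 :: real and n :: nat
      proof -
        have e0: "\<epsilon> n > 0" using \<epsilon>0 by simp
        have n: "n \<ge> N" using nN by simp
        then have nm: "n \<ge> m" "n \<ge> 2 * B" "n \<ge> 1" using m by (auto simp: N_def)
        have nb: "real n \<ge> b\<^sup>2" using n unfolding N_def by linarith
        have nL: "real n \<ge> exp L" using n unfolding N_def by linarith
        have n0: "real n > 0" using nm by simp
        have lnL: "ln (real n) \<ge> L" using nL n0 by (simp add: ln_ge_iff)
        have elo: "a * ln (real n) \<le> \<epsilon> n * real n" and ehi: "\<epsilon> n * sqrt n \<le> b"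
        proof -
          have "a * (ln (real n) / real n) \<le> \<epsilon> n" "\<epsilon> n \<le> b * (1 / sqrt (real n))" using \<epsilon> nm by auto
          then show "a * ln (real n) \<le> \<epsilon> n * real n" "\<epsilon> n * sqrt n \<le> b" using n0 by (simp_all add: field_simps)
        qed
        define \<beta> where "\<beta> = 1 / (\<epsilon> n * real n)"
        have "b \<le> sqrt n" using nb b by (intro real_le_rsqrt) 
        then have "\<epsilon> n * sqrt n \<le> 1 * sqrt n" using ehi by simp
        then have e1: "\<epsilon> n \<le> 2" using n0 by simp
        have bs: "1 / sqrt n \<le> b * \<beta>"
        proof -
          have "1 / sqrt n = \<epsilon> n * sqrt n * \<beta>"
            using n0 e0 by (simp add: \<beta>_def field_simps)
          also have "\<dots> \<le> b * \<beta>" using ehi e0 by (intro mult_right_mono) (auto simp: \<beta>_def)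
          finally show ?thesis .
        qed
        define k where "k = n div B"
        have kB: "real k * real B \<ge> real n / 2"
        proof -
          have "n = k * B + n mod B" by (simp add: k_def)
          moreover have "n mod B < B" using B0 by simp
          ultimately have "n \<le> k * B + B" by linarith
          then have "2 * n \<le> 2 * (k * B) + n" using nm(2) by linarith
          then have "n \<le> 2 * (k * B)" by linarith
          then have "real n \<le> real (2 * (k * B))" by (simp only: of_nat_le_iff)
          then show ?thesis by simp
        qed
        have klo: "\<epsilon> n / 4 * real k \<ge> \<epsilon> n * real n / (8 * real B)"
        proof -
          have "\<epsilon> n * (real n / 2) \<le> \<epsilon> n * (real k * real B)" using kB e0 by (intro mult_left_mono) auto
          then show ?thesis using B0 by (simp add: field_simps)
        qed
        have k0: "k > 0" using kB n0 B0 by (intro Nat.gr0I) auto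
        have u1: "\<epsilon> n / 4 * real k \<ge> 800"
        proof -
          have "6400 * real B / a \<le> ln (real n)" using lnL by (simp add: L_def)
          then have "6400 * real B \<le> a * ln (real n)" using a by (simp add: field_simps)
          then have "6400 * real B \<le> \<epsilon> n * real n" using elo by linarith
          then have "800 \<le> \<epsilon> n * real n / (8 * real B)" using B0 by (simp add: field_simps)
          then show ?thesis using klo by linarith
        qed
        have u2: "\<epsilon> n / 4 * real k \<ge> 10 * ln (1 / \<delta> n)" if \<zeta>1: "\<zeta> \<ge> 1"
        proof -
          have l0: "ln (1 / \<delta> n) \<ge> 0" using \<delta> \<delta>n by simp
          have "real B \<le> 1000000 * \<zeta> + 1" using B(2) by simp
          moreover have "1 * \<zeta> \<le> \<zeta> * \<zeta>" using \<zeta>1 by (intro mult_right_mono) auto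
          ultimately have "real B \<le> 2000000 * (\<zeta> * \<zeta>)" using \<zeta>1 by linarith
          then have "real B \<le> 2 * 10 ^ 6 * \<zeta>\<^sup>2" by (simp add: power2_eq_square)
          then have "80 * real B * ln (1 / \<delta> n) \<le> 80 * (2 * 10 ^ 6 * \<zeta>\<^sup>2) * ln (1 / \<delta> n)"
            using l0 by (intro mult_right_mono mult_left_mono) auto
          also have "\<dots> = c * \<zeta>\<^sup>2 * ln (1 / \<delta> n)" by (simp add: c_def)
          also have "\<dots> \<le> \<epsilon> n * real n" using nN e0 by (simp add: pos_divide_le_eq mult.commute)
          finally have "10 * ln (1 / \<delta> n) \<le> \<epsilon> n * real n / (8 * real B)" using B0 by (simp add: field_simps)
          then show ?thesis using klo by linarith
        qed
        have small: "H * \<beta> \<le> \<rho>\<^sub>0 / (8 * sqrt \<zeta>)"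
        proof -
          have "8 * sqrt \<zeta> * H / (\<rho>\<^sub>0 * a) \<le> ln (real n)" using lnL by (simp add: L_def)
          then have "8 * sqrt \<zeta> * H \<le> \<rho>\<^sub>0 * (a * ln (real n))" using a \<rho>0 by (simp add: field_simps)
          also have "\<dots> \<le> \<rho>\<^sub>0 * (\<epsilon> n * real n)" using elo \<rho>0 by (intro mult_left_mono) auto
          finally show ?thesis using e0 n0 \<zeta> by (simp add: \<beta>_def field_simps)
        qed
        have \<delta>1: "\<delta> n \<le> 1" using \<delta> by auto
        note acc = A_high_accuracy[OF sets_mu d2 \<zeta> C fourth kappa e0 e1 nm(3) \<delta>n \<delta>1 B(1) k0[unfolded k_def]
            u1[unfolded k_def] u2[unfolded k_def] b bs[unfolded \<beta>_def] small[unfolded H_def \<beta>_def \<rho>\<^sub>0_def]]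
        have "ereal C' * J_TV_inv \<mu> \<theta>\<^sub>0 \<beta> \<le>
            ereal C' * ereal (8 * sqrt \<zeta> * \<beta> / sqrt (d2log_partition \<mu> \<theta>\<^sub>0))"
          using acc(2) C' unfolding \<beta>_def by (intro ereal_mult_left_mono) auto
        also have "\<dots> = ereal (K * (1 / (real n * \<epsilon> n * sqrt (d2log_partition \<mu> \<theta>\<^sub>0))))"
          by (simp add: K_def \<beta>_def mult_ac)
        finally show ?thesis using acc(1) by (simp add: M_def C'_def H_def \<beta>_def)
      qed
      show ?case
        by (rule exI[of _ N], rule exI[of _ C'], rule exI[of _ K]) (intro conjI[OF C'] conjI[OF K] allI impI, rule main, assumption+)
    qed
  qed
qed

end
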